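(* Let $r=1$, let $k_0\in E$ with $k_0\neq0$, and let $\lambda$ be a simple nonzero eigenvalue of $\mathcal{C}(k_0)$, so that there is a unique index $j^*$ such that $\lambda$ is a (simple) eigenvalue of the submatrix $C_{j^*}$ of $\mathcal{C}(k_0)$. Let $\mathcal{I}_{j^*}=[a_{j^*},b_{j^*}]\cap\mathbb{Z}$ be the corresponding integer interval, let $s$ be the number of even integers in $\mathcal{I}_{j^*}$ (namely $2\lceil a_{j^*}/2\rceil,2\lceil a_{j^*}/2\rceil+2,\dots,2\lfloor b_{j^*}/2\rfloor$), and set $j_0=2\lceil a_{j^*}/2\rceil-2$. Suppose that $k(\delta)=k_0\pm\sqrt{\lambda\delta/r}+\mathcal{O}(\delta)$ is a resonant frequency (i.e. $\omega(\delta)=k(\delta)v$ is a resonant frequency of the scattering problem) as $\delta\to0$, and let $u(x)$ be its associated eigenmode, normalized by a suitable nonzero ($\delta$-dependent) scalar factor. Then for each $1\le j\le s$, $$u(x)=\beta_{j_0+2j}\sin\bigl(k_0(x-x_{a_{j^*}})\bigr)+\mathcal{O}(\delta^{1/2}),\qquad x\in(x_{j_0+2j},x_{j_0+2j+1}),$$ where $(\lambda,\bm\beta=(\beta_{j_0+2j})_{j=1}^s)$ is an eigenpair of the matrix $D_{j^*}$. Moreover, on any interval $(x_i,x_{i+1})$, $1\le i\le 2N-1$, with $i\notin\{j_0+2j:1\le j\le s\}$, there exists some positive integer $\gamma_i$ such that $$u(x)=\mathcal{O}(\delta^{\gamma_i/2}),\qquad x\in(x_i,x_{i+1}).$$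
   Context: Scattering problem. Let $N\ge1$ and $x_1<x_2<\dots<x_{2N}$ be real numbers, $D=\bigcup_{i=1}^N(x_{2i-1},x_{2i})$, $\ell_i=x_{2i}-x_{2i-1}$ ($1\le i\le N$), $s_i=x_{2i+1}-x_{2i}$ ($1\le i\le N-1$). Let $v,v_b>0$, $r=v/v_b$ (here $r=1$), $\delta\in\mathbb{C}$, and for $\omega\in\mathbb{C}$ let $k=\omega/v$. The scattering problem is: $u''+\frac{\omega^2}{v^2}u=0$ on $\mathbb{R}\setminus D$; $u''+\frac{\omega^2}{v_b^2}u=0$ on $D$; $u|_+(x_j)=u|_-(x_j)$ for $1\le j\le2N$; $u'|_+(x_{2j-1})=\delta\,u'|_-(x_{2j-1})$ and $u'|_-(x_{2j})=\delta\,u'|_+(x_{2j})$ for $1\le j\le N$; and the radiation condition $\left(\frac{d}{d|x|}-\mathrm{i}k\right)u=0$ on $(-\infty,x_1)\cup(x_{2N},\infty)$, i.e. $u'=-\mathrm{i}ku$ on $(-\infty,x_1)$ and $u'=\mathrm{i}ku$ on $(x_{2N},\infty)$. Here $w|_\pm(x)$ are the one-sided limits at $x$ from the right ($+$) and from the left ($-$). $\omega$ is a resonant frequency if there is a nontrivial solution $u$, which is called an eigenmode. Capacitance matrix. Let $\bm t=(t_1,\dots,t_{2N-1})^\top=(r\ell_1,s_1,r\ell_2,s_2,\dots,r\ell_{N-1},s_{N-1},r\ell_N)^\top$. For $k\in\mathbb{R}$ set $t_j(k)=t_j$ if $t_jk\in\pi\mathbb{Z}$, $t_j(k)=\infty$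 otherwise ($1/\infty=0$), $\theta_j(k)=\frac{1}{t_j(k)t_{j+1}(k)}$ for $1\le j\le2N-2$, and $\theta_0(k)=\theta_{2N-1}(k)=0$. $\mathcal{C}(k)$ is the $N\times N$ tridiagonal matrix with $\mathcal{C}(k)_{i,i}=\theta_{2i-2}(k)+\theta_{2i-1}(k)$, $\mathcal{C}(k)_{i,i+1}=-\theta_{2i-1}(k)$, $\mathcal{C}(k)_{i,i-1}=-\theta_{2i-2}(k)$. $E=\bigcup_{j=1}^{2N-1}\frac{\pi}{t_j}\mathbb{Z}$. For $k_0\in E$, $I(k_0)=\{j:t_jk_0\in\pi\mathbb{Z},\ 1\le j\le2N-1\}$, partitioned into maximal disjoint integer intervals $\mathcal{I}_j=[a_j,b_j]\cap\mathbb{Z}$, $1\le j\le p$, with $a_{j+1}-b_j>1$. $C_j$ is the principal submatrix of $\mathcal{C}(k_0)$ with rows and columns indexed from $\lfloor a_j/2\rfloor+1$ to $\lceil b_j/2\rceil$ (empty if this range is empty). The nonzero eigenvalues of $\mathcal{C}(k_0)$ are the union, with multiplicity, of those of the $C_j$. Matrix $D_j$. Let $s$ and $l$ be the numbers of even and odd integers in $\mathcal{I}_j$, and $\xi=a_j-2\lfloor a_j/2\rfloor\in\{0,1\}$. Let $A_j$ be the $s\times l$ matrix with $(A_j)_{i,i-1+\xi}=-1$, $(A_j)_{i,i+\xi}=1$ (whenever the column index lies in $\{1,\dots,l\}$) and all other entries zero. Let $\mathcal{S}_j$ ($s\times s$) and $\mathcal{L}_j$ ($l\times l$) be the diagonal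 matrices with diagonal entries the $t_i$, $i\in\mathcal{I}_j$, with $i$ even, respectively odd, in increasing order of $i$. Then $D_j=\mathcal{S}_j^{-1}A_j\mathcal{L}_j^{-1}A_j^\top$. *)

theory Defs
  imports
    Complex_Main
    "HOL-Library.Landau_Symbols"
    "HOL-Library.Extended_Real"
    "Jordan_Normal_Form.Char_Poly"
    "Jordan_Normal_Form.DL_Submatrix"
    "Jordan_Normal_Form.Gauss_Jordan_Elimination"
begin

section \<open>The scattering problem\<close>

text \<open>The interfaces are \<open>x 1 < \<dots> < x (2 * N)\<close>; values of \<open>x\<close> outside
  \<open>{1..2 * N}\<close> are never used. The resonators are the intervals between \<open>x (2 * i - 1)\<close>
  and \<open>x (2 * i)\<close>.\<close>

definition ell :: "(nat \<Rightarrow> real) \<Rightarrow> nat \<Rightarrow> real" where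
  "ell x i = x (2 * i) - x (2 * i - 1)"

definition gap :: "(nat \<Rightarrow> real) \<Rightarrow> nat \<Rightarrow> real" where
  "gap x i = x (2 * i + 1) - x (2 * i)"

definition resonators :: "nat \<Rightarrow> (nat \<Rightarrow> real) \<Rightarrow> real set" where
  "resonators N x = (\<Union>i\<in>{1..N}. {x (2 * i - 1)<..<x (2 * i)})"

text \<open>The differential equation is imposed on the open components of the complement of the
  interfaces, \<open>u'\<close> being the derivative of \<open>u\<close> there. The value of \<open>u\<close> at an interface is
  required to be the common one-sided limit; otherwise the zero function altered at an interface
  would count as a nontrivial solution.\<close>

definition scattering_solution ::
  "nat \<Rightarrow> (nat \<Rightarrow> real) \<Rightarrow> real \<Rightarrow> real \<Rightarrow> complex \<Rightarrow> complex \<Rightarrow> (real \<Rightarrow> complex) \<Rightarrow> bool" where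
  "scattering_solution N x v vb \<delta> \<omega> u \<longleftrightarrow> (\<exists>u'.
     (\<forall>y. y \<notin> x ` {1..2 * N} \<longrightarrow> (u has_vector_derivative u' y) (at y)) \<and>
     (\<forall>y. y \<notin> x ` {1..2 * N} \<longrightarrow> y \<notin> resonators N x \<longrightarrow>
        (u' has_vector_derivative - (\<omega>\<^sup>2 / (complex_of_real v)\<^sup>2) * u y) (at y)) \<and>
     (\<forall>y\<in>resonators N x.
        (u' has_vector_derivative - (\<omega>\<^sup>2 / (complex_of_real vb)\<^sup>2) * u y) (at y)) \<and>
     (\<forall>j\<in>{1..2 * N}. (u \<longlongrightarrow> u (x j)) (at_left (x j)) \<and> (u \<longlongrightarrow> u (x j)) (at_right (x j))) \<and>
     (\<forall>j\<in>{1..N}.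
        (\<exists>d. (u' \<longlongrightarrow> d) (at_left (x (2 * j - 1))) \<and> (u' \<longlongrightarrow> \<delta> * d) (at_right (x (2 * j - 1)))) \<and>
        (\<exists>d. (u' \<longlongrightarrow> d) (at_right (x (2 * j))) \<and> (u' \<longlongrightarrow> \<delta> * d) (at_left (x (2 * j))))) \<and>
     (\<forall>y<x 1. u' y = - \<i> * (\<omega> / complex_of_real v) * u y) \<and>
     (\<forall>y>x (2 * N). u' y = \<i> * (\<omega> / complex_of_real v) * u y))"

definition eigenmode ::
  "nat \<Rightarrow> (nat \<Rightarrow> real) \<Rightarrow> real \<Rightarrow> real \<Rightarrow> complex \<Rightarrow> complex \<Rightarrow> (real \<Rightarrow> complex) \<Rightarrow> bool" where
  "eigenmode N x v vb \<delta> \<omega> u \<longleftrightarrow> scattering_solution N x v vb \<delta> \<omega> u \<and> (\<exists>y. u y \<noteq> 0)"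

definition resonant_frequency ::
  "nat \<Rightarrow> (nat \<Rightarrow> real) \<Rightarrow> real \<Rightarrow> real \<Rightarrow> complex \<Rightarrow> complex \<Rightarrow> bool" where
  "resonant_frequency N x v vb \<delta> \<omega> \<longleftrightarrow> (\<exists>u. eigenmode N x v vb \<delta> \<omega> u)"

section \<open>The capacitance matrix\<close>

definition tlen :: "real \<Rightarrow> (nat \<Rightarrow> real) \<Rightarrow> nat \<Rightarrow> real" where
  "tlen r x j = (if odd j then r * ell x ((j + 1) div 2) else gap x (j div 2))"

definition tlen_at :: "real \<Rightarrow> (nat \<Rightarrow> real) \<Rightarrow> real \<Rightarrow> nat \<Rightarrow> ereal" where
  "tlen_at r x k j = (if \<exists>n::int. tlen r x j * k = pi * of_int n then ereal (tlen r x j) else \<infinity>)"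

definition theta :: "nat \<Rightarrow> real \<Rightarrow> (nat \<Rightarrow> real) \<Rightarrow> real \<Rightarrow> nat \<Rightarrow> real" where
  "theta N r x k j = (if 1 \<le> j \<and> j \<le> 2 * N - 2
     then real_of_ereal (1 / (tlen_at r x k j * tlen_at r x k (j + 1))) else 0)"

text \<open>Matrix indices of the library start at 0; here \<open>i\<close> and \<open>j\<close> are the 1-based indices.\<close>

definition cap_mat :: "nat \<Rightarrow> real \<Rightarrow> (nat \<Rightarrow> real) \<Rightarrow> real \<Rightarrow> real mat" where
  "cap_mat N r x k = mat N N (\<lambda>(p, q). let i = p + 1; j = q + 1 in
     if j = i then theta N r x k (2 * i - 2) + theta N r x k (2 * i - 1)
     else if j = i + 1 then - theta N r x k (2 * i - 1)
     else if i = j + 1 then - theta N r x k (2 * i - 2)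
     else 0)"

definition critical_set :: "nat \<Rightarrow> real \<Rightarrow> (nat \<Rightarrow> real) \<Rightarrow> real set" where
  "critical_set N r x = (\<Union>j\<in>{1..2 * N - 1}. range (\<lambda>n::int. pi / tlen r x j * of_int n))"

definition index_set :: "nat \<Rightarrow> real \<Rightarrow> (nat \<Rightarrow> real) \<Rightarrow> real \<Rightarrow> nat set" where
  "index_set N r x k = {j \<in> {1..2 * N - 1}. \<exists>n::int. tlen r x j * k = pi * of_int n}"

definition maximal_interval :: "nat set \<Rightarrow> nat \<Rightarrow> nat \<Rightarrow> bool" where
  "maximal_interval I a b \<longleftrightarrow> a \<le> b \<and> {a..b} \<subseteq> I \<and>
     (\<forall>a' b'. {a..b} \<subseteq> {a'..b'} \<and> {a'..b'} \<subseteq> I \<longrightarrow> {a'..b'} = {a..b})"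

text \<open>Rows and columns \<open>\<lfloor>a / 2\<rfloor> + 1\<close> to \<open>\<lceil>b / 2\<rceil>\<close> in 1-based numbering.\<close>

definition cap_block :: "nat \<Rightarrow> real \<Rightarrow> (nat \<Rightarrow> real) \<Rightarrow> real \<Rightarrow> nat \<Rightarrow> nat \<Rightarrow> real mat" where
  "cap_block N r x k a b =
     submatrix (cap_mat N r x k) {a div 2..<(b + 1) div 2} {a div 2..<(b + 1) div 2}"

section \<open>The matrix \<open>D\<^sub>j\<close> of an index interval\<close>

definition evens :: "nat \<Rightarrow> nat \<Rightarrow> nat list" where
  "evens a b = filter even [a..<b + 1]"

definition odds :: "nat \<Rightarrow> nat \<Rightarrow> nat list" where
  "odds a b = filter odd [a..<b + 1]"

definition incidence_mat :: "nat \<Rightarrow> nat \<Rightarrow> real mat" where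
  "incidence_mat a b = mat (length (evens a b)) (length (odds a b)) (\<lambda>(p, q).
     let \<xi> = a - 2 * (a div 2); i = p + 1; j = q + 1 in
     if j = i - 1 + \<xi> then - 1 else if j = i + \<xi> then 1 else 0)"

definition S_mat :: "real \<Rightarrow> (nat \<Rightarrow> real) \<Rightarrow> nat \<Rightarrow> nat \<Rightarrow> real mat" where
  "S_mat r x a b = mat_diag (length (evens a b)) (\<lambda>p. tlen r x (evens a b ! p))"

definition L_mat :: "real \<Rightarrow> (nat \<Rightarrow> real) \<Rightarrow> nat \<Rightarrow> nat \<Rightarrow> real mat" where
  "L_mat r x a b = mat_diag (length (odds a b)) (\<lambda>p. tlen r x (odds a b ! p))"

definition D_mat :: "real \<Rightarrow> (nat \<Rightarrow> real) \<Rightarrow> nat \<Rightarrow> nat \<Rightarrow> real mat" where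
  "D_mat r x a b =
     the (mat_inverse (S_mat r x a b)) * incidence_mat a b *
     the (mat_inverse (L_mat r x a b)) * (incidence_mat a b)\<^sup>T"

section \<open>Eigenvalues and asymptotics\<close>

abbreviation complex_mat :: "real mat \<Rightarrow> complex mat" where
  "complex_mat \<equiv> map_mat complex_of_real"

definition simple_eigenvalue :: "complex mat \<Rightarrow> complex \<Rightarrow> bool" where
  "simple_eigenvalue A z \<longleftrightarrow> eigenvalue A z \<and> order z (char_poly A) = 1"

text \<open>\<open>f \<delta> y = \<O>(\<delta>\<^sup>e)\<close> as \<open>\<delta> \<rightarrow> 0\<close> in the punctured complex plane, uniformly for \<open>y\<close> in \<open>S\<close>.\<close>

definition uniform_bigo :: "real set \<Rightarrow> (complex \<Rightarrow> real \<Rightarrow> complex) \<Rightarrow> real \<Rightarrow> bool" where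
  "uniform_bigo S f e \<longleftrightarrow>
     (\<exists>C. \<forall>\<^sub>F \<delta> in at 0. \<forall>y\<in>S. norm (f \<delta> y) \<le> C * norm \<delta> powr e)"

end

theory Submission
  imports "HOL-Analysis.Complex_Transcendental" Defs
begin

text \<open>On every interval between neighbouring interfaces an eigenmode is a combination of
  \<open>cos (k (y - x i))\<close> and \<open>sin (k (y - x i))\<close>. Write \<open>e\<^sup>2 = \<delta>\<close> with \<open>k - k0 = \<mu> e + \<O>(\<delta>)\<close> and
  \<open>\<mu>\<^sup>2 = \<lambda>\<close>, and rescale the value at \<open>x i\<close> to \<open>U i = u (x i) / e\<close>, keeping as second unknown
  \<open>w i\<close>, the derivative divided by \<open>k\<close> on the side of \<open>x i\<close> facing away from the resonator. In these
  unknowns the transfer relations are bounded perturbations, with relative error \<open>\<O>(e)\<close>, of a limit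
  problem. In the limit the intervals outside the index set force \<open>w = 0\<close> (gaps) or \<open>U = 0\<close>
  (resonators) at both their ends, so the problem splits into one recurrence for each maximal interval
  of indices. That recurrence has one free parameter, and its end condition holds exactly when
  \<open>\<lambda>\<close> is an eigenvalue of the block of the capacitance matrix. As the eigenvalue is simple, this
  happens in a single block, and there the values of \<open>w\<close> in the gaps form an eigenvector of the
  matrix \<open>D\<close>.\<close>

text \<open>The rescaling balances the two kinds of interval. Where the sine has size
  \<open>e\<close>, a gap feeds \<open>w\<close> times the sine into \<open>u\<close>, while a
  resonator feeds \<open>u\<close> times the sine, divided by \<delta>, into \<open>w\<close>. Once
  \<open>u\<close> is divided by \<open>e\<close>, both couplings become the sine divided by
  \<open>e\<close>, of order one, and the opposite couplings carry a factor \<open>e\<close>. Two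
  obstacles shape the rest. A mode comes without any normalization, so every error is measured
  against the total size \<open>M\<close> of the data, and only afterwards is the free parameter of
  the one closed block seen to dominate \<open>M\<close>. Moreover the capacitance matrix need not
  be symmetric and is only block triangular: a block that starts or ends with a gap can couple its
  outermost row to a resonator outside the index set, whose own row is zero. Simplicity is therefore
  passed to the blocks through factorizations of the characteristic polynomial.\<close>

section \<open>Tridiagonal matrices\<close>

text \<open>The row index \<open>p\<close> starts at 0 and stands for the interval with index \<open>2 p + 1\<close>; the argument
  of \<open>\<theta>\<close> keeps the numbering of the intervals.\<close>

definition tridiag :: "(nat \<Rightarrow> 'a::comm_ring_1) \<Rightarrow> nat \<Rightarrow> nat \<Rightarrow> 'a" where
  "tridiag \<theta> p q = (if q = p then \<theta> (2 * p) + \<theta> (2 * p + 1)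
     else if q = p + 1 then - \<theta> (2 * p + 1) else if p = q + 1 then - \<theta> (2 * p) else 0)"

definition tri_mat :: "(nat \<Rightarrow> 'a::comm_ring_1) \<Rightarrow> nat \<Rightarrow> nat \<Rightarrow> 'a mat" where
  "tri_mat \<theta> p q = mat (q - p) (q - p) (\<lambda>(i, j). tridiag \<theta> (p + i) (p + j))"

lemma tri_mat_carrier [simp]: "tri_mat \<theta> p q \<in> carrier_mat (q - p) (q - p)"
  by (simp add: tri_mat_def)

lemma dim_tri_mat [simp]: "dim_row (tri_mat \<theta> p q) = q - p" "dim_col (tri_mat \<theta> p q) = q - p"
  by (simp_all add: tri_mat_def)

lemma complex_cap_mat:
  "complex_mat (cap_mat N r x k) = tri_mat (\<lambda>j. complex_of_real (theta N r x k j)) 0 N"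
  by (rule eq_matI) (auto simp: cap_mat_def tri_mat_def tridiag_def Let_def)

lemma pick_atLeastLessThan: "i < q - p \<Longrightarrow> pick {p..<q} i = p + i"
proof (induction i)
  case 0
  then show ?case by (auto intro!: Least_equality)
next
  case (Suc i)
  then have "pick {p..<q} i = p + i" by simp
  with Suc.prems show ?case by (auto intro!: Least_equality)
qed

lemma complex_cap_block:
  assumes "b \<le> 2 * N - 1"
  shows "complex_mat (cap_block N r x k a b) =
    tri_mat (\<lambda>j. complex_of_real (theta N r x k j)) (a div 2) ((b + 1) div 2)"
proof -
  let ?J = "{a div 2..<(b + 1) div 2}"
  have "(b + 1) div 2 \<le> N" using assms by linarith
  then have "{i. i < N \<and> i \<in> ?J} = ?J" by auto
  then have "card {i. i < N \<and> i \<in> ?J} = (b + 1) div 2 - a div 2" by simp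
  moreover have "pick ?J i < N" if "i < (b + 1) div 2 - a div 2" for i
    using that \<open>(b + 1) div 2 \<le> N\<close> by (simp add: pick_atLeastLessThan)
  ultimately show ?thesis
    by (intro eq_matI)
      (auto simp: cap_block_def submatrix_def cap_mat_def tri_mat_def tridiag_def Let_def
        pick_atLeastLessThan)
qed

text \<open>Extending \<open>V\<close> by zero gives the first and last rows of the window the same
  form as the inner ones. In row 0 the truncated \<open>i - 1\<close> makes the first difference
  vanish, and \<open>\<theta> 0 = 0\<close> makes the diagonal agree with this.\<close>

lemma sum_tridiag:
  assumes "\<theta> 0 = 0" "\<And>i. i \<notin> {p..<q} \<Longrightarrow> V i = 0" "i \<in> {p..<q}"
  shows "(\<Sum>j\<in>{p..<q}. tridiag \<theta> i j * V j) =
    \<theta> (2 * i) * (V i - V (i - 1)) + \<theta> (2 * i + 1) * (V i - V (i + 1))"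
proof -
  have "(\<Sum>j\<in>{p..<q}. tridiag \<theta> i j * V j) = (\<Sum>j\<in>{i - 1, i, i + 1} \<inter> {p..<q}. tridiag \<theta> i j * V j)"
    by (rule sum.mono_neutral_right) (auto simp: tridiag_def)
  also have "\<dots> = (\<Sum>j\<in>{i - 1, i, i + 1}. tridiag \<theta> i j * V j)"
    by (rule sum.mono_neutral_left) (use assms(2) in force)+
  also have "\<dots> = \<theta> (2 * i) * (V i - V (i - 1)) + \<theta> (2 * i + 1) * (V i - V (i + 1))"
    by (cases i) (auto simp: tridiag_def algebra_simps assms(1))
  finally show ?thesis .
qed

lemma tri_mat_mult_vec:
  fixes \<theta> :: "nat \<Rightarrow> 'a::comm_ring_1"
  assumes "\<theta> 0 = 0" "\<And>i. i \<notin> {p..<q} \<Longrightarrow> V i = 0" "i < q - p"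
  shows "(tri_mat \<theta> p q *\<^sub>v vec (q - p) (\<lambda>j. V (p + j))) $ i =
    \<theta> (2 * (p + i)) * (V (p + i) - V (p + i - 1)) + \<theta> (2 * (p + i) + 1) * (V (p + i) - V (p + i
      + 1))"
proof -
  have "(tri_mat \<theta> p q *\<^sub>v vec (q - p) (\<lambda>j. V (p + j))) $ i
      = (\<Sum>j<q - p. tridiag \<theta> (p + i) (p + j) * V (p + j))"
    using assms(3) by (simp add: tri_mat_def scalar_prod_def atLeast0LessThan)
  also have "\<dots> = (\<Sum>j\<in>{p..<q}. tridiag \<theta> (p + i) j * V j)"
    by (rule sum.reindex_bij_witness[of _ "\<lambda>j. j - p" "\<lambda>j. p + j"]) auto
  also have "\<dots> = \<theta> (2 * (p + i)) * (V (p + i) - V (p + i - 1))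
      + \<theta> (2 * (p + i) + 1) * (V (p + i) - V (p + i + 1))"
    by (rule sum_tridiag) (use assms in auto)
  finally show ?thesis .
qed

text \<open>Eigenvectors become functions on all of \<open>nat\<close> that vanish off the window,
  so those of the whole matrix and of a block can be compared without shifting indices.\<close>

lemma eigenvalue_tri_mat:
  fixes \<theta> :: "nat \<Rightarrow> 'a::field"
  assumes "\<theta> 0 = 0"
  shows "eigenvalue (tri_mat \<theta> p q) l \<longleftrightarrow>
    (\<exists>V. (\<exists>i. V i \<noteq> 0) \<and> (\<forall>i. i \<notin> {p..<q} \<longrightarrow> V i = 0) \<and>
      (\<forall>i\<in>{p..<q}. l * V i =
        \<theta> (2 * i) * (V i - V (i - 1)) + \<theta> (2 * i + 1) * (V i - V (i + 1))))"
    (is "_ \<longleftrightarrow> (\<exists>V. ?P V)")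
proof
  assume "eigenvalue (tri_mat \<theta> p q) l"
  then obtain w where w: "w \<in> carrier_vec (q - p)" "w \<noteq> 0\<^sub>v (q - p)"
      "tri_mat \<theta> p q *\<^sub>v w = l \<cdot>\<^sub>v w"
    by (auto simp: eigenvalue_def eigenvector_def)
  define V where "V i = (if i \<in> {p..<q} then w $ (i - p) else 0)" for i
  have wV: "vec (q - p) (\<lambda>j. V (p + j)) = w"
    using w(1) by (intro eq_vecI) (auto simp: V_def)
  have supp: "V i = 0" if "i \<notin> {p..<q}" for i
    using that unfolding V_def by presburger
  obtain j where j: "j < q - p" "w $ j \<noteq> 0"
    using w(1,2) by (metis carrier_vecD eq_vecI index_zero_vec(1,2))
  then have "V (p + j) \<noteq> 0" by (simp add: V_def)
  moreover have "l * V i = \<theta> (2 * i) * (V i - V (i - 1)) + \<theta> (2 * i + 1) * (V i - V (i + 1))"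
    if "i \<in> {p..<q}" for i
  proof -
    have i: "i - p < q - p" "p + (i - p) = i" using that by auto
    show ?thesis
      using tri_mat_mult_vec[where \<theta> = \<theta> and V = V and p = p and q = q and i = "i - p"] supp i w(1)
      unfolding wV w(3) by (simp add: V_def[of i] that assms)
  qed
  ultimately show "\<exists>V. ?P V" using supp by blast
next
  assume "\<exists>V. ?P V"
  then obtain V where V: "?P V" by blast
  let ?w = "vec (q - p) (\<lambda>j. V (p + j))"
  obtain i where "V i \<noteq> 0" "i \<in> {p..<q}" using V by blast
  then have "?w $ (i - p) \<noteq> 0" "i - p < q - p" by auto
  then have "?w \<noteq> 0\<^sub>v (q - p)" by (metis index_zero_vec(1))
  moreover have "tri_mat \<theta> p q *\<^sub>v ?w = l \<cdot>\<^sub>v ?w"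
  proof (rule eq_vecI)
    fix i assume "i < dim_vec (l \<cdot>\<^sub>v ?w)"
    then have i: "i < q - p" by simp
    moreover have "p + i \<in> {p..<q}" using i by auto
    ultimately show "(tri_mat \<theta> p q *\<^sub>v ?w) $ i = (l \<cdot>\<^sub>v ?w) $ i"
      using tri_mat_mult_vec[where \<theta> = \<theta> and V = V and p = p and q = q and i = i] V assms
      by (metis index_smult_vec(1) index_vec dim_vec)
  qed simp
  ultimately show "eigenvalue (tri_mat \<theta> p q) l"
    unfolding eigenvalue_def eigenvector_def by (intro exI[of _ ?w]) simp
qed

section \<open>Block triangular splitting of characteristic polynomials\<close>

lemma four_block_tri_mat:
  assumes "p \<le> m" "m \<le> q"
  shows "tri_mat \<theta> p q = four_block_mat (tri_mat \<theta> p m)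
    (mat (m - p) (q - m) (\<lambda>(i, j). tridiag \<theta> (p + i) (m + j)))
    (mat (q - m) (m - p) (\<lambda>(i, j). tridiag \<theta> (m + i) (p + j))) (tri_mat \<theta> m q)"
  by (rule eq_matI)
    (use assms in \<open>auto simp: tri_mat_def four_block_mat_def Let_def add.commute\<close>)

lemma char_poly_four_block_upper_right_zero:
  fixes A :: "'a::idom mat"
  assumes A: "A \<in> carrier_mat n n" and C: "C \<in> carrier_mat m n" and D: "D \<in> carrier_mat m m"
  shows "char_poly (four_block_mat A (0\<^sub>m n m) C D) = char_poly A * char_poly D"
proof -
  let ?M = "map_mat (\<lambda>a. [:- a:])"
  have "char_poly_matrix (four_block_mat A (0\<^sub>m n m) C D)
      = four_block_mat (char_poly_matrix A) (0\<^sub>m n m) (?M C) (char_poly_matrix D)"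
    using assms by (intro eq_matI) (auto simp: char_poly_matrix_def four_block_mat_def Let_def)
  then show ?thesis
    unfolding char_poly_def using assms
    by (simp add: det_four_block_mat_upper_right_zero[where n = n and m = m])
qed

lemma char_poly_four_block_lower_left_zero:
  fixes A :: "'a::idom mat"
  assumes A: "A \<in> carrier_mat n n" and B: "B \<in> carrier_mat n m" and D: "D \<in> carrier_mat m m"
  shows "char_poly (four_block_mat A B (0\<^sub>m m n) D) = char_poly A * char_poly D"
proof -
  let ?M = "map_mat (\<lambda>a. [:- a:])"
  have "char_poly_matrix (four_block_mat A B (0\<^sub>m m n) D)
      = four_block_mat (char_poly_matrix A) (?M B) (0\<^sub>m m n) (char_poly_matrix D)"
    using assms by (intro eq_matI) (auto simp: char_poly_matrix_def four_block_mat_def Let_def)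
  then show ?thesis
    unfolding char_poly_def using assms
    by (simp add: det_four_block_mat_lower_left_zero[where n = n and m = m])
qed

text \<open>Across a cut at \<open>m\<close> only two entries can be nonzero,
  \<open>- \<theta> (2 * m)\<close> below the diagonal and \<open>- \<theta> (2 * m - 1)\<close>
  above it. If either is zero the matrix is block triangular; the cases \<open>m = p\<close> and
  \<open>m = q\<close> are those with an empty block.\<close>

lemma char_poly_tri_mat_split:
  fixes \<theta> :: "nat \<Rightarrow> 'a::idom"
  assumes "p \<le> m" "m \<le> q" "m = q \<or> \<theta> (2 * m) = 0 \<or> m = p \<or> \<theta> (2 * m - 1) = 0"
  shows "char_poly (tri_mat \<theta> p q) = char_poly (tri_mat \<theta> p m) * char_poly (tri_mat \<theta> m q)"
proof -
  let ?B = "mat (m - p) (q - m) (\<lambda>(i, j). tridiag \<theta> (p + i) (m + j))"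
  let ?C = "mat (q - m) (m - p) (\<lambda>(i, j). tridiag \<theta> (m + i) (p + j))"
  from assms(3) consider "m = q \<or> \<theta> (2 * m) = 0" | "m = p \<or> \<theta> (2 * m - 1) = 0" by blast
  then show ?thesis
  proof cases
    case 1
    have "?C = 0\<^sub>m (q - m) (m - p)"
    proof (rule eq_matI)
      fix i j assume "i < dim_row (0\<^sub>m (q - m) (m - p) :: 'a mat)" "j < dim_col (0\<^sub>m (q - m) (m
        - p) :: 'a mat)"
      then have ij: "i < q - m" "j < m - p" by auto
      have "i = 0" if "m + i = p + j + 1" using that ij by linarith
      then have "tridiag \<theta> (m + i) (p + j) = 0"
        using 1 ij by (auto simp: tridiag_def)
      then show "?C $$ (i, j) = 0\<^sub>m (q - m) (m - p) $$ (i, j)" using ij by simp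
    qed simp_all
    then show ?thesis
      unfolding four_block_tri_mat[OF assms(1,2)]
      by (simp add: char_poly_four_block_lower_left_zero[where n = "m - p" and m = "q - m"])
  next
    case 2
    have "?B = 0\<^sub>m (m - p) (q - m)"
    proof (rule eq_matI)
      fix i j assume "i < dim_row (0\<^sub>m (m - p) (q - m) :: 'a mat)" "j < dim_col (0\<^sub>m (m - p) (q
        - m) :: 'a mat)"
      then have ij: "i < m - p" "j < q - m" by auto
      have "2 * m - 1 = 2 * (p + i) + 1" if "m + j = p + i + 1"
        using that ij by arith
      then have "tridiag \<theta> (p + i) (m + j) = 0"
        using 2 ij by (auto simp: tridiag_def)
      then show "?B $$ (i, j) = 0\<^sub>m (m - p) (q - m) $$ (i, j)" using ij by simp
    qed simp_all
    then show ?thesis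
      unfolding four_block_tri_mat[OF assms(1,2)]
      by (simp add: char_poly_four_block_upper_right_zero[where n = "m - p" and m = "q - m"])
  qed
qed

section \<open>The limit recurrence\<close>

text \<open>\<open>A\<close> and \<open>B\<close> are the limits of \<open>U\<close> and \<open>w\<close> on one block, up to the sign of \<open>cos (k0 (x i
  - x a))\<close>;
  the component forced to vanish at the left end is \<open>B\<close> when \<open>a\<close> is a resonator (odd),
    and \<open>A\<close> otherwise.\<close>

definition chain :: "(nat \<Rightarrow> complex) \<Rightarrow> complex \<Rightarrow> nat \<Rightarrow> nat \<Rightarrow> (nat \<Rightarrow> complex) \<Rightarrow> (nat \<Rightarrow> complex) \<Rightarrow> bool"
  where "chain t \<mu> a b A B \<longleftrightarrow>
    A a = (if odd a then 1 else 0) \<and> B a = (if odd a then 0 else 1) \<and>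
    (\<forall>i\<in>{a..b}. even i \<longrightarrow> A (Suc i) = A i + t i * \<mu> * B i \<and> B (Suc i) = B i) \<and>
    (\<forall>i\<in>{a..b}. odd i \<longrightarrow> A (Suc i) = A i \<and> B (Suc i) = B i - t i * \<mu> * A i)"

text \<open>The condition at the right end. After a resonator comes a gap outside the index set or
  the exterior, which forces the derivative to vanish; after a gap comes a resonator outside the
  index set, which forces the value to vanish.\<close>

definition chain_closed :: "nat \<Rightarrow> (nat \<Rightarrow> complex) \<Rightarrow> (nat \<Rightarrow> complex) \<Rightarrow> bool"
  where "chain_closed b A B \<longleftrightarrow> (if odd b then B (Suc b) else A (Suc b)) = 0"

text \<open>The difference quotient of \<open>V\<close> over the gap between the resonators
  \<open>m - 1\<close> and \<open>m\<close>, cut off to zero where that gap is not in the interval.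
  Up to the resonator length, a row of the matrix is a difference of two consecutive fluxes.\<close>

definition flux :: "(nat \<Rightarrow> complex) \<Rightarrow> nat \<Rightarrow> nat \<Rightarrow> (nat \<Rightarrow> complex) \<Rightarrow> nat \<Rightarrow> complex"
  where "flux t a b V m = (if a \<le> 2 * m \<and> 2 * m \<le> b then (V m - V (m - 1)) / t (2 * m) else 0)"

lemma chainD:
  assumes "chain t \<mu> a b A B"
  shows "A a = (if odd a then 1 else 0)" "B a = (if odd a then 0 else 1)"
    "\<And>i. a \<le> i \<Longrightarrow> i \<le> b \<Longrightarrow> even i \<Longrightarrow> A (Suc i) = A i + t i * \<mu> * B i"
    "\<And>i. a \<le> i \<Longrightarrow> i \<le> b \<Longrightarrow> even i \<Longrightarrow> B (Suc i) = B i"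
    "\<And>i. a \<le> i \<Longrightarrow> i \<le> b \<Longrightarrow> odd i \<Longrightarrow> A (Suc i) = A i"
    "\<And>i. a \<le> i \<Longrightarrow> i \<le> b \<Longrightarrow> odd i \<Longrightarrow> B (Suc i) = B i - t i * \<mu> * A i"
  using assms by (auto simp: chain_def)

lemma chain_exists: "\<exists>A B. chain t \<mu> a b A B"
proof -
  define S where "S = rec_nat (if odd a then (1, 0) else (0, 1))
    (\<lambda>d (A, B). if even (a + d) then (A + t (a + d) * \<mu> * B, B) else (A, B - t (a + d) * \<mu> * A))"
  have "chain t \<mu> a b (\<lambda>i. fst (S (i - a))) (\<lambda>i. snd (S (i - a)))"
    by (auto simp: chain_def S_def Suc_diff_le split: prod.splits)
  then show ?thesis by blast
qed

text \<open>Up to the factor \<open>f\<close>, an eigenvector \<open>V\<close> of the block determines the recurrence: the values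
  of \<open>V\<close> are those of \<open>A\<close>, its fluxes those of \<open>\<mu> B\<close>.\<close>

lemma chain_closed_of_mode:
  assumes ab: "1 \<le> a" "a \<le> b" and t: "\<forall>i\<in>{a..b}. t i \<noteq> 0" and mu: "\<mu> \<noteq> 0"
    and ch: "chain t \<mu> a b A B"
    and V: "V i0 \<noteq> 0" "\<And>p. p \<notin> {a div 2..<(b + 1) div 2} \<Longrightarrow> V p = 0"
    and modeq: "\<And>p. p \<in> {a div 2..<(b + 1) div 2} \<Longrightarrow>
      \<mu>\<^sup>2 * t (2 * p + 1) * V p = flux t a b V p - flux t a b V (Suc p)"
  shows "chain_closed b A B"
proof -
  note c = chainD[OF ch]
  \<comment> \<open>The factor is read off at the left end, from whichever of \<open>A a\<close> and
    \<open>B a\<close> equals 1.\<close>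
  define f where "f = (if odd a then V (a div 2) else flux t a b V (a div 2) / \<mu>)"
  \<comment> \<open>Interface \<open>i\<close> touches one resonator, with row number
    \<open>(i - 1) div 2\<close>, and one gap, with index twice \<open>i div 2\<close>; both
    formulas hold for either parity of \<open>i\<close>.\<close>
  have scaled: "f * A i = V ((i - 1) div 2) \<and> f * \<mu> * B i = flux t a b V (i div 2)"
    if "a \<le> i" "i \<le> Suc b" for i
    using that
  proof (induction i rule: dec_induct)
    case base
    show ?case
    proof (cases "odd a")
      case True
      then have "\<not> a \<le> 2 * (a div 2)" by presburger
      moreover have "(a - 1) div 2 = a div 2" using True by presburger
      ultimately show ?thesis using True by (simp add: c f_def flux_def)
    next
      case False
      then have "(a - 1) div 2 \<notin> {a div 2..<(b + 1) div 2}" using ab by auto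
      then show ?thesis using False V(2) mu by (simp add: c f_def)
    qed
  next
    case (step i)
    then have i: "a \<le> i" "i \<le> b" and IH: "f * A i = V ((i - 1) div 2)" "f * \<mu> * B i =
      flux t a b V (i div 2)"
      by auto
    have ti: "t i \<noteq> 0" using t i by simp
    show ?case
    proof (cases "even i")
      case True
      then obtain m where m: "i = 2 * m" by blast
      with i ab have "(i - 1) div 2 = m - 1" by auto
      then have IH1: "f * A i = V (m - 1)" using IH(1) by (simp only:)
      have "f * A (Suc i) = f * A i + t i * (f * \<mu> * B i)"
        by (simp add: c(3)[OF i True] algebra_simps)
      also have "\<dots> = V m"
        unfolding IH1 IH(2) using i ti by (simp add: flux_def m)
      finally show ?thesis using IH(2) c(4)[OF i True] by (simp add: m)
    next
      case False
      then obtain m where m: "i = 2 * m + 1" by (elim oddE)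
      have mb: "m \<in> {a div 2..<(b + 1) div 2}" using i m by auto
      have "f * \<mu> * B (Suc i) = f * \<mu> * B i - \<mu>\<^sup>2 * t i * (f * A i)"
        by (simp add: c(6)[OF i False] algebra_simps power2_eq_square)
      also have "\<dots> = flux t a b V (Suc m)"
        unfolding IH using modeq[OF mb] by (simp add: m)
      finally show ?thesis using IH(1) c(5)[OF i False] by (simp add: m)
    qed
  qed
  have "f \<noteq> 0"
  proof
    assume f0: "f = 0"
    have "V p = 0" if "p \<in> {a div 2..<(b + 1) div 2}" for p
      using scaled[of "2 * p + 1"] that f0 by auto
    then show False using V by blast
  qed
  have *: "f * A (Suc b) = V (b div 2)" "f * \<mu> * B (Suc b) = flux t a b V (Suc b div 2)"
    using scaled[of "Suc b"] ab by auto
  show ?thesis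
  proof (cases "odd b")
    case True
    then have "\<not> 2 * (Suc b div 2) \<le> b" by presburger
    then have "f * \<mu> * B (Suc b) = 0" using *(2) by (simp add: flux_def)
    then show ?thesis using True \<open>f \<noteq> 0\<close> mu by (simp add: chain_closed_def)
  next
    case False
    then have "b div 2 \<notin> {a div 2..<(b + 1) div 2}" by auto
    then have "f * A (Suc b) = 0" using *(1) V(2) by simp
    then show ?thesis using False \<open>f \<noteq> 0\<close> by (simp add: chain_closed_def)
  qed
qed

text \<open>\<open>A\<close> is constant along a resonator, so \<open>V\<close> can be read off at
  its left end \<open>2 * p + 1\<close>. The start and closing conditions are what the extension by
  zero and the cut-off of \<open>flux\<close> require: the component that vanishes at an end of the
  interval is the outside value or the outside flux.\<close>

lemma mode_of_chain_closed:
  assumes ab: "1 \<le> a" "a \<le> b" and t: "\<forall>i\<in>{a..b}. t i \<noteq> 0" and mu: "\<mu> \<noteq> 0"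
    and ch: "chain t \<mu> a b A B" and cl: "chain_closed b A B"
  defines "V \<equiv> \<lambda>p. if p \<in> {a div 2..<(b + 1) div 2} then A (2 * p + 1) else 0"
  shows "\<exists>p. V p \<noteq> 0"
    and "\<And>m. flux t a b V m = (if a \<le> 2 * m \<and> 2 * m \<le> b then \<mu> * B (2 * m) else 0)"
    and "\<And>p. p \<in> {a div 2..<(b + 1) div 2} \<Longrightarrow>
      \<mu>\<^sup>2 * t (2 * p + 1) * V p = flux t a b V p - flux t a b V (Suc p)"
proof -
  note c = chainD[OF ch]
  \<comment> \<open>At the ends, an even \<open>a\<close> uses \<open>A a = 0\<close> and an even
    \<open>b\<close> uses the closing condition; both match the zero extension of
    \<open>V\<close>.\<close>
  have A: "A i = V ((i - 1) div 2)" if i: "a \<le> i" "i \<le> Suc b" for i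
  proof (cases "odd i")
    case True
    then obtain m where m: "i = 2 * m + 1" by (elim oddE)
    show ?thesis
    proof (cases "i \<le> b")
      case True
      then have "m \<in> {a div 2..<(b + 1) div 2}" using i m by auto
      then show ?thesis using m by (simp add: V_def)
    next
      case False
      then have b: "b = 2 * m" using i m by simp
      then show ?thesis using cl m by (simp add: V_def chain_closed_def)
    qed
  next
    case False
    then obtain m where m: "i = 2 * m" by blast
    show ?thesis
    proof (cases "i = a")
      case True
      then have "(i - 1) div 2 \<notin> {a div 2..<(b + 1) div 2}" using m ab by auto
      then have "V ((i - 1) div 2) = 0" unfolding V_def by presburger
      then show ?thesis using True False c(1) by simp
    next
      case ia: False
      then obtain j where j: "i = Suc j" "a \<le> j" "j \<le> b" using i by (cases i) auto
      with False obtain n where n: "j = 2 * n + 1" by (metis even_Suc oddE)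
      then have "n \<in> {a div 2..<(b + 1) div 2}" using j by auto
      then show ?thesis using c(5)[OF j(2,3)] j n by (simp add: V_def)
    qed
  qed
  have flux_even: "flux t a b V m = \<mu> * B (2 * m)" if m: "a \<le> 2 * m" "2 * m \<le> b" for m
  proof -
    have "m \<ge> 1" "(2 * m - 1) div 2 = m - 1" using m ab by auto
    then have "V m - V (m - 1) = t (2 * m) * \<mu> * B (2 * m)"
      using A[of "2 * m"] A[of "2 * m + 1"] c(3)[of "2 * m"] m
      by (simp add: algebra_simps)
    then show ?thesis using m t by (simp add: flux_def)
  qed
  then show fl: "flux t a b V m = (if a \<le> 2 * m \<and> 2 * m \<le> b then \<mu> * B (2 * m) else 0)" for m
    by (simp add: flux_def)
  show "\<mu>\<^sup>2 * t (2 * p + 1) * V p = flux t a b V p - flux t a b V (Suc p)"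
    if p: "p \<in> {a div 2..<(b + 1) div 2}" for p
  proof -
    have i: "a \<le> 2 * p + 1" "2 * p + 1 \<le> b" using p by auto
    have "flux t a b V p = \<mu> * B (2 * p + 1)"
    proof (cases "a = 2 * p + 1")
      case True
      then show ?thesis using c(2) by (simp add: flux_def)
    next
      case False
      then have "a \<le> 2 * p" using i by simp
      then show ?thesis using flux_even[of p] c(4)[of "2 * p"] i by simp
    qed
    moreover have "flux t a b V (Suc p) = \<mu> * B (2 * p + 2)"
    proof (cases "b = 2 * p + 1")
      case True
      then show ?thesis using cl by (simp add: flux_def chain_closed_def)
    next
      case False
      then show ?thesis using flux_even[of "Suc p"] i by simp
    qed
    moreover have "B (2 * p + 1) - B (2 * p + 2) = t (2 * p + 1) * \<mu> * V p"
      using c(6)[OF i] A[of "2 * p + 1"] i by simp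
    then have "\<mu> * (B (2 * p + 1) - B (2 * p + 2)) = \<mu>\<^sup>2 * t (2 * p + 1) * V p"
      by (simp add: power2_eq_square)
    ultimately show ?thesis by (simp only: right_diff_distrib)
  qed
  show "\<exists>p. V p \<noteq> 0"
  proof (cases "odd a")
    case True
    then show ?thesis using A[of a] c(1) ab by (intro exI[of _ "(a - 1) div 2"]) simp
  next
    case False
    then have "A (Suc a) \<noteq> 0" using c(1-3) ab t mu by simp
    then show ?thesis using A[of "Suc a"] ab by (intro exI[of _ "a div 2"]) simp
  qed
qed

section \<open>Blocks of the capacitance matrix\<close>

lemma maximal_intervalD:
  assumes "maximal_interval I a b" "0 \<notin> I"
  shows "1 \<le> a" "a \<le> b" "{a..b} \<subseteq> I" "a - 1 \<notin> I" "Suc b \<notin> I"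
proof -
  show ab: "a \<le> b" and sub: "{a..b} \<subseteq> I" using assms by (auto simp: maximal_interval_def)
  then show a: "1 \<le> a" using assms(2) by (cases a) auto
  have max: "{a'..b'} = {a..b}" if "{a..b} \<subseteq> {a'..b'}" "{a'..b'} \<subseteq> I" for a' b'
    using assms(1) that unfolding maximal_interval_def by blast
  show "a - 1 \<notin> I"
  proof
    assume "a - 1 \<in> I"
    moreover have "{a - 1..b} \<subseteq> insert (a - 1) {a..b}" by auto
    ultimately have "{a - 1..b} \<subseteq> I" using sub by blast
    then have "{a - 1..b} = {a..b}" by (intro max) auto
    then show False using a ab by (simp add: Icc_eq_Icc)
  qed
  show "Suc b \<notin> I"
  proof
    assume "Suc b \<in> I"
    moreover have "{a..Suc b} \<subseteq> insert (Suc b) {a..b}" by auto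
    ultimately have "{a..Suc b} \<subseteq> I" using sub by blast
    then have "{a..Suc b} = {a..b}" by (intro max) auto
    then show False using ab by (simp add: Icc_eq_Icc)
  qed
qed

lemma maximal_interval_disjoint:
  assumes "maximal_interval I a b" "maximal_interval I a' b'" "0 \<notin> I"
  shows "(a, b) = (a', b') \<or> Suc b < a' \<or> Suc b' < a"
proof (rule ccontr)
  note d = maximal_intervalD[OF assms(1,3)] and d' = maximal_intervalD[OF assms(2,3)]
  assume "\<not> ?thesis"
  then have neq: "(a, b) \<noteq> (a', b')" and le: "a' \<le> Suc b" "a \<le> Suc b'" by auto
  have "a' \<noteq> Suc b" using d(5) d'(2,3) by auto
  then have "a' \<le> b" using le by simp
  have "a \<noteq> Suc b'" using d'(5) d(2,3) by auto
  then have "a \<le> b'" using le by simp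
  have "\<not> a < a'"
  proof
    assume "a < a'"
    then have "a' - 1 \<in> {a..b}" using \<open>a' \<le> b\<close> by auto
    then show False using d(3) d'(4) by blast
  qed
  moreover have "\<not> a' < a"
  proof
    assume "a' < a"
    then have "a - 1 \<in> {a'..b'}" using \<open>a \<le> b'\<close> by auto
    then show False using d(4) d'(3) by blast
  qed
  moreover have "\<not> b < b'"
  proof
    assume "b < b'"
    then have "Suc b \<in> {a'..b'}" using \<open>a' \<le> b\<close> by auto
    then show False using d(5) d'(3) by blast
  qed
  moreover have "\<not> b' < b"
  proof
    assume "b' < b"
    then have "Suc b' \<in> {a..b}" using \<open>a \<le> b'\<close> by auto
    then show False using d(3) d'(5) by blast
  qed
  ultimately show False using neq by auto
qed

lemma maximal_interval_exists:
  assumes "finite I" "i \<in> I"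
  shows "\<exists>a b. maximal_interval I a b \<and> i \<in> {a..b}"
proof -
  let ?P = "\<lambda>J. i \<in> J \<and> J \<subseteq> I \<and> (\<exists>a b. J = {a..b})"
  have "finite {J. ?P J}" by (rule finite_subset[of _ "Pow I"]) (use assms in auto)
  moreover have "{i..i} \<in> {J. ?P J}" using assms by fastforce
  ultimately obtain M where M: "M \<in> {J. ?P J}" "\<And>J. J \<in> {J. ?P J} \<Longrightarrow> M \<subseteq> J \<Longrightarrow> M = J"
    using finite_has_maximal2[of "{J. ?P J}" "{i..i}"] by (metis (no_types, lifting))
  then obtain a b where ab: "M = {a..b}" by blast
  have "maximal_interval I a b"
    unfolding maximal_interval_def
  proof (intro conjI allI impI)
    show "a \<le> b" "{a..b} \<subseteq> I" using M(1) ab by auto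
    fix a' b' assume "{a..b} \<subseteq> {a'..b'} \<and> {a'..b'} \<subseteq> I"
    then show "{a'..b'} = {a..b}" using M(1) M(2)[of "{a'..b'}"] ab by blast
  qed
  moreover have "i \<in> {a..b}" using M(1) ab by auto
  ultimately show ?thesis by blast
qed

lemma index_set_bounds:
  "finite (index_set N r x k)" "0 \<notin> index_set N r x k"
  "j \<in> index_set N r x k \<Longrightarrow> j \<in> {1..2 * N - 1}"
  by (auto simp: index_set_def)

text \<open>With positive lengths, one infinite factor makes the product infinite and its reciprocal
  zero, so the extended reals reduce to a case distinction on membership of two neighbours.\<close>

lemma theta_eq:
  assumes "\<And>j. j \<in> {1..2 * N - 1} \<Longrightarrow> tlen r x j > 0"
  shows "theta N r x k j = (if j \<in> index_set N r x k \<and> Suc j \<in> index_set N r x k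
    then 1 / (tlen r x j * tlen r x (Suc j)) else 0)"
proof (cases "1 \<le> j \<and> j \<le> 2 * N - 2")
  case True
  then have "j \<in> {1..2 * N - 1}" "Suc j \<in> {1..2 * N - 1}" by auto
  moreover from this have "tlen r x j > 0" "tlen r x (Suc j) > 0" using assms by blast+
  ultimately show ?thesis
    using True by (auto simp: theta_def tlen_at_def index_set_def one_ereal_def)
next
  case False
  then have "\<not> (j \<in> {1..2 * N - 1} \<and> Suc j \<in> {1..2 * N - 1})" by auto
  then show ?thesis using False by (auto simp: theta_def index_set_def)
qed

lemma char_poly_nonzero:
  fixes M :: "'a::idom mat"
  assumes "M \<in> carrier_mat n n"
  shows "char_poly M \<noteq> 0"
  using degree_monic_char_poly[OF assms] by (metis coeff_0 zero_neq_one)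

lemma order_char_poly_pos:
  fixes M :: "'a::field mat"
  assumes "eigenvalue M l" "M \<in> carrier_mat n n"
  shows "order l (char_poly M) \<ge> 1"
proof -
  have "poly (char_poly M) l = 0" using eigenvalue_root_char_poly[OF assms(2)] assms(1) by simp
  then have "order l (char_poly M) \<noteq> 0" using char_poly_nonzero[OF assms(2)] by
    (simp add: order_root)
  then show ?thesis by simp
qed

section \<open>Eigenvalues of the capacitance matrix and of its blocks\<close>

context
  fixes N :: nat and x :: "nat \<Rightarrow> real" and r k0 :: real
  assumes tpos: "\<And>j. j \<in> {1..2 * N - 1} \<Longrightarrow> tlen r x j > 0"
begin

private abbreviation (input) "I \<equiv> index_set N r x k0"
private abbreviation (input) "\<theta> \<equiv> \<lambda>j. complex_of_real (theta N r x k0 j)"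
private abbreviation (input) "t \<equiv> \<lambda>j. complex_of_real (tlen r x j)"

lemma theta_I:
  "theta N r x k0 j = (if j \<in> I \<and> Suc j \<in> I then 1 / (tlen r x j * tlen r x (Suc j)) else 0)"
  by (rule theta_eq) (rule tpos)

lemma tlen_nonzero: "maximal_interval I a b \<Longrightarrow> i \<in> {a..b} \<Longrightarrow> t i \<noteq> 0"
  using tpos[of i] index_set_bounds(3)[of i N r x k0]
  by (fastforce simp: maximal_interval_def)

text \<open>Both coefficients of a row share the factor \<open>1 / t (2 * p + 1)\<close>, and
  maximality of the interval makes them vanish exactly where \<open>flux\<close> is cut off.\<close>

lemma theta_flux:
  assumes mi: "maximal_interval I a b" and p: "p \<in> {a div 2..<(b + 1) div 2}"
  shows "\<theta> (2 * p) * (V p - V (p - 1)) + \<theta> (2 * p + 1) * (V p - V (p + 1)) =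
    (flux t a b V p - flux t a b V (Suc p)) / t (2 * p + 1)"
proof -
  note d = maximal_intervalD[OF mi index_set_bounds(2)]
  have i: "a \<le> 2 * p + 1" "2 * p + 1 \<le> b" using p by auto
  then have iI: "Suc (2 * p) \<in> I" using d(3) by auto
  have "2 * p \<in> I \<longleftrightarrow> a \<le> 2 * p"
  proof
    show "2 * p \<in> I \<Longrightarrow> a \<le> 2 * p" using d(4) i(1) by (cases "a = 2 * p + 1") auto
    show "a \<le> 2 * p \<Longrightarrow> 2 * p \<in> I" using d(3) i(2) by auto
  qed
  moreover have "Suc (Suc (2 * p)) \<in> I \<longleftrightarrow> 2 * Suc p \<le> b"
  proof
    show "Suc (Suc (2 * p)) \<in> I \<Longrightarrow> 2 * Suc p \<le> b" using d(5) i(2) by (cases "b = 2 * p + 1") auto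
    show "2 * Suc p \<le> b \<Longrightarrow> Suc (Suc (2 * p)) \<in> I" using d(3) i(1) by auto
  qed
  ultimately show ?thesis
    using i iI tlen_nonzero[OF mi, of "2 * p"] tlen_nonzero[OF mi, of "2 * p + 1"]
      tlen_nonzero[OF mi, of "2 * p + 2"]
    by (simp add: theta_I flux_def divide_simps)
qed

lemma eigenvalue_cap_block_iff:
  assumes mi: "maximal_interval I a b" and ch: "chain t \<mu> a b A B" and mu: "\<mu> \<noteq> 0"
  shows "eigenvalue (complex_mat (cap_block N r x k0 a b)) (\<mu>\<^sup>2) \<longleftrightarrow> chain_closed b A B"
proof -
  note d = maximal_intervalD[OF mi index_set_bounds(2)]
  have "b \<le> 2 * N - 1" using d(2,3) index_set_bounds(3)[of b N r x k0] by auto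
  note blk = complex_cap_block[OF this]
  have tn: "\<forall>i\<in>{a..b}. t i \<noteq> 0" using tlen_nonzero[OF mi] by blast
  let ?B = "{a div 2..<(b + 1) div 2}"
  have t0: "\<theta> 0 = 0" by (simp add: theta_def)
  \<comment> \<open>Multiplying by the resonator length turns a row of the eigenvalue equation into
    a balance of fluxes.\<close>
  have eqv: "(\<mu>\<^sup>2 * V p = \<theta> (2 * p) * (V p - V (p - 1)) + \<theta> (2 * p + 1) * (V p - V (p + 1)))
      \<longleftrightarrow> \<mu>\<^sup>2 * t (2 * p + 1) * V p = flux t a b V p - flux t a b V (Suc p)"
    if "p \<in> ?B" for V p
  proof -
    have "t (2 * p + 1) \<noteq> 0" using that by (intro tn[rule_format]) auto
    then show ?thesis unfolding theta_flux[OF mi that] by (simp add: field_simps)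
  qed
  show ?thesis
  proof
    assume "eigenvalue (complex_mat (cap_block N r x k0 a b)) (\<mu>\<^sup>2)"
    then obtain V i0 where V: "V i0 \<noteq> 0" "\<And>p. p \<notin> ?B \<Longrightarrow> V p = 0"
      "\<And>p. p \<in> ?B \<Longrightarrow> \<mu>\<^sup>2 * V p = \<theta> (2 * p) * (V p - V (p - 1)) + \<theta> (2 * p + 1) * (V p - V (p + 1))"
      unfolding blk eigenvalue_tri_mat[of \<theta>, OF t0] by blast
    show "chain_closed b A B"
      by (rule chain_closed_of_mode[of a b t \<mu> A B V, OF d(1,2) tn mu ch V(1,2)])
        (use V(3) eqv in auto)
  next
    assume "chain_closed b A B"
    note m = mode_of_chain_closed[OF d(1,2) tn mu ch this]
    let ?V = "\<lambda>p. if p \<in> ?B then A (2 * p + 1) else 0"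
    show "eigenvalue (complex_mat (cap_block N r x k0 a b)) (\<mu>\<^sup>2)"
      unfolding blk eigenvalue_tri_mat[of \<theta>, OF t0]
    proof (intro exI[of _ ?V] conjI ballI)
      show "\<exists>i. ?V i \<noteq> 0" using m(1) by blast
      show "\<forall>i. i \<notin> ?B \<longrightarrow> ?V i = 0" by presburger
      show "\<mu>\<^sup>2 * ?V i = \<theta> (2 * i) * (?V i - ?V (i - 1)) + \<theta> (2 * i + 1) * (?V i - ?V (i + 1))"
        if "i \<in> ?B" for i
        using eqv[OF that, of ?V] m(3)[OF that] by blast
    qed
  qed
qed

text \<open>A row whose resonator is not in the index set vanishes, so an eigenvector for a nonzero
  eigenvalue vanishes there; hence its restriction to a block is an eigenvector of the block.\<close>

lemma eigenvalue_some_block: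
  assumes "eigenvalue (complex_mat (cap_mat N r x k0)) l" "l \<noteq> 0"
  shows "\<exists>a b. maximal_interval I a b \<and> eigenvalue (complex_mat (cap_block N r x k0 a b)) l"
proof -
  have t0: "\<theta> 0 = 0" by (simp add: theta_def)
  obtain V i0 where V: "V i0 \<noteq> 0" "\<And>p. p \<notin> {0..<N} \<Longrightarrow> V p = 0"
      "\<And>p. p \<in> {0..<N} \<Longrightarrow> l * V p = \<theta> (2 * p) * (V p - V (p - 1)) + \<theta> (2 * p + 1) * (V p - V (p
        + 1))"
    using assms(1) unfolding complex_cap_mat eigenvalue_tri_mat[of \<theta>, OF t0] by blast
  have out: "V p = 0" if "2 * p + 1 \<notin> I" for p
  proof (cases "p < N")
    case True
    then have "l * V p = 0" using V(3)[of p] that by (simp add: theta_I)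
    then show ?thesis using assms(2) by simp
  qed (use V(2) in auto)
  have "2 * i0 + 1 \<in> I" using V(1) out by blast
  then obtain a b where mi: "maximal_interval I a b" and i0: "2 * i0 + 1 \<in> {a..b}"
    using maximal_interval_exists[OF index_set_bounds(1)] by blast
  note d = maximal_intervalD[OF mi index_set_bounds(2)]
  have bN: "b \<le> 2 * N - 1" using d(2,3) index_set_bounds(3)[of b N r x k0] by auto
  let ?B = "{a div 2..<(b + 1) div 2}"
  define W where "W p = (if p \<in> ?B then V p else 0)" for p
  have in_block: "p \<in> ?B \<longleftrightarrow> 2 * p + 1 \<in> {a..b}" for p by auto
  have "eigenvalue (tri_mat \<theta> (a div 2) ((b + 1) div 2)) l"
    unfolding eigenvalue_tri_mat[of \<theta>, OF t0]
  proof (intro exI[of _ W] conjI ballI)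
    show "\<exists>i. W i \<noteq> 0" using i0 V(1) in_block[of i0] by (intro exI[of _ i0]) (simp add: W_def)
    show "\<forall>i. i \<notin> ?B \<longrightarrow> W i = 0" unfolding W_def by presburger
    fix p assume p: "p \<in> ?B"
    then have "p \<in> {0..<N}" using bN by auto
    \<comment> \<open>The restriction can differ from \<open>V\<close> only at a neighbour outside
      the block. If the entry leading there is nonzero, the block starts with a gap and the
      neighbour is the resonator \<open>a - 1\<close>, where \<open>V\<close> vanishes by
      \<open>out\<close>.\<close>
    have e1: "W (p - 1) = V (p - 1)" if "\<theta> (2 * p) \<noteq> 0"
    proof (cases "p - 1 \<in> ?B")
      case False
      have I2: "2 * p \<in> I" using that by (auto simp: theta_I split: if_splits)
      then have "p \<noteq> 0" using index_set_bounds(2) by (metis mult_0_right)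
      have "a \<le> 2 * p" using I2 d(4) p by (cases "a = 2 * p + 1") auto
      then have "2 * (p - 1) + 1 = a - 1"
        using False p \<open>p \<noteq> 0\<close> unfolding in_block by auto
      then show ?thesis using False out d(4) by (simp add: W_def)
    qed (simp add: W_def)
    have e2: "W (p + 1) = V (p + 1)" if "\<theta> (2 * p + 1) \<noteq> 0"
    proof (cases "p + 1 \<in> ?B")
      case False
      have I2: "2 * p + 2 \<in> I" using that by (auto simp: theta_I split: if_splits)
      have "2 * p + 2 \<le> b" using I2 d(5) p by (cases "b = 2 * p + 1") auto
      then have "2 * (p + 1) + 1 = Suc b"
        using False p unfolding in_block by auto
      then show ?thesis using False out[of "p + 1"] d(5) by (simp add: W_def)
    qed (simp add: W_def)
    have e: "W p = V p" using p by (simp add: W_def)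
    have "\<theta> (2 * p) * (W p - W (p - 1)) = \<theta> (2 * p) * (V p - V (p - 1))"
      by (metis e e1 mult_zero_left)
    moreover have "\<theta> (2 * p + 1) * (W p - W (p + 1)) = \<theta> (2 * p + 1) * (V p - V (p + 1))"
      by (metis e e2 mult_zero_left)
    ultimately show "l * W p = \<theta> (2 * p) * (W p - W (p - 1)) + \<theta> (2 * p + 1) * (W p - W (p + 1))"
      using V(3)[OF \<open>p \<in> {0..<N}\<close>] by (simp only: e)
  qed
  then show ?thesis using mi complex_cap_block[OF bN] by metis
qed

text \<open>For either parity these entries involve the missing index \<open>a - 1\<close> or
  \<open>Suc b\<close>. Rows outside the block thus do not reach into it, though its own rows may
  reach out: the left cut clears the entry above the diagonal, the right cut the one below.\<close>

lemma cap_block_cut: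
  assumes mi: "maximal_interval I a b"
  shows "a div 2 = 0 \<or> \<theta> (2 * (a div 2) - 1) = 0" "\<theta> (2 * ((b + 1) div 2)) = 0"
proof -
  note d = maximal_intervalD[OF mi index_set_bounds(2)]
  show "a div 2 = 0 \<or> \<theta> (2 * (a div 2) - 1) = 0"
  proof (cases "odd a")
    case True
    then have "a div 2 = 0 \<or> Suc (2 * (a div 2) - 1) = a - 1" by presburger
    then show ?thesis using d(4) by (auto simp: theta_I)
  next
    case False
    then have "2 * (a div 2) - 1 = a - 1" by presburger
    then show ?thesis using d(4) by (auto simp: theta_I)
  qed
  show "\<theta> (2 * ((b + 1) div 2)) = 0"
  proof (cases "odd b")
    case True
    then have "2 * ((b + 1) div 2) = Suc b" by presburger
    then show ?thesis using d(5) by (auto simp: theta_I)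
  next
    case False
    then have "Suc (2 * ((b + 1) div 2)) = Suc b" by presburger
    then show ?thesis using d(5) by (auto simp: theta_I)
  qed
qed

text \<open>The factor to the left of the block is kept and the right end \<open>q\<close> is left
  free, so that the result applies once more to a block inside that left factor.\<close>

lemma char_poly_cap_block_dvd:
  assumes mi: "maximal_interval I a b" and q: "(b + 1) div 2 \<le> q"
  shows "char_poly (tri_mat \<theta> 0 (a div 2)) * char_poly (complex_mat (cap_block N r x k0 a b))
    dvd char_poly (tri_mat \<theta> 0 q)"
proof -
  note d = maximal_intervalD[OF mi index_set_bounds(2)]
  have bN: "b \<le> 2 * N - 1" using d(2,3) index_set_bounds(3)[of b N r x k0] by auto
  have "char_poly (tri_mat \<theta> 0 q) = char_poly (tri_mat \<theta> 0 ((b + 1) div 2)) *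
      char_poly (tri_mat \<theta> ((b + 1) div 2) q)"
    by (rule char_poly_tri_mat_split) (use q cap_block_cut(2)[OF mi] in auto)
  also have "char_poly (tri_mat \<theta> 0 ((b + 1) div 2)) = char_poly (tri_mat \<theta> 0 (a div 2)) *
      char_poly (tri_mat \<theta> (a div 2) ((b + 1) div 2))"
    by (rule char_poly_tri_mat_split) (use d cap_block_cut(1)[OF mi] in auto)
  finally show ?thesis unfolding complex_cap_block[OF bN] by simp
qed

lemma cap_block_carrier:
  "b \<le> 2 * N - 1 \<Longrightarrow>
    complex_mat (cap_block N r x k0 a b) \<in> carrier_mat ((b + 1) div 2 - a div 2) ((b
      + 1) div 2 - a div 2)"
  by (simp only: complex_cap_block tri_mat_carrier)

lemma simple_eigenvalue_cap_block:
  assumes simple: "simple_eigenvalue (complex_mat (cap_mat N r x k0)) l"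
    and mi: "maximal_interval I a b" and ev: "eigenvalue (complex_mat (cap_block N r x k0 a b)) l"
  shows "simple_eigenvalue (complex_mat (cap_block N r x k0 a b)) l"
proof -
  note d = maximal_intervalD[OF mi index_set_bounds(2)]
  have bN: "b \<le> 2 * N - 1" using d(2,3) index_set_bounds(3)[of b N r x k0] by auto
  then have "(b + 1) div 2 \<le> N" by linarith
  from dvd_mult_right[OF char_poly_cap_block_dvd[OF mi this]]
  have dvd: "char_poly (complex_mat (cap_block N r x k0 a b)) dvd char_poly (complex_mat (cap_mat N r x k0))"
    unfolding complex_cap_mat .
  have "char_poly (complex_mat (cap_mat N r x k0)) \<noteq> 0"
    by (rule char_poly_nonzero[of _ N]) (simp add: cap_mat_def)
  then have "order l (char_poly (complex_mat (cap_block N r x k0 a b))) \<le> 1"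
    using dvd_imp_order_le[OF _ dvd] simple by (metis simple_eigenvalue_def)
  then show ?thesis
    using order_char_poly_pos[OF ev cap_block_carrier[OF bN]] ev
    unfolding simple_eigenvalue_def by (metis le_antisym)
qed

text \<open>The characteristic polynomial of the earlier block divides the left factor of the later
  one, so the product of the two divides that of the whole matrix. A common eigenvalue would then
  have order at least 2.\<close>

lemma cap_block_eigenvalue_not_after:
  assumes simple: "simple_eigenvalue (complex_mat (cap_mat N r x k0)) l"
    and mi: "maximal_interval I a b" and ev: "eigenvalue (complex_mat (cap_block N r x k0 a b)) l"
    and mi': "maximal_interval I a' b'" and ev': "eigenvalue (complex_mat (cap_block N r x k0 a' b')) l"
  shows "\<not> Suc b < a'"
proof
  assume "Suc b < a'"
  then have le: "(b + 1) div 2 \<le> a' div 2" by auto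
  note d = maximal_intervalD[OF mi index_set_bounds(2)]
    and d' = maximal_intervalD[OF mi' index_set_bounds(2)]
  have bN: "b \<le> 2 * N - 1" "b' \<le> 2 * N - 1"
    using d(2,3) d'(2,3) index_set_bounds(3)[of b N r x k0]
      index_set_bounds(3)[of b' N r x k0] by auto
  then have "(b' + 1) div 2 \<le> N" by linarith
  let ?c = "char_poly (complex_mat (cap_block N r x k0 a b))"
    and ?c' = "char_poly (complex_mat (cap_block N r x k0 a' b'))"
  have "?c * ?c' dvd char_poly (tri_mat \<theta> 0 (a' div 2)) * ?c'"
    using dvd_mult_right[OF char_poly_cap_block_dvd[OF mi le]] by (rule mult_dvd_mono) simp
  also have "\<dots> dvd char_poly (complex_mat (cap_mat N r x k0))"
    unfolding complex_cap_mat by (rule char_poly_cap_block_dvd) fact+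
  finally have dvd: "?c * ?c' dvd char_poly (complex_mat (cap_mat N r x k0))" .
  have nz: "char_poly (complex_mat (cap_mat N r x k0)) \<noteq> 0"
    by (rule char_poly_nonzero[of _ N]) (simp add: cap_mat_def)
  then have "?c * ?c' \<noteq> 0" using dvd by auto
  then have "order l (?c * ?c') = order l ?c + order l ?c'" by (rule order_mult)
  moreover have "order l ?c \<ge> 1" "order l ?c' \<ge> 1"
    using order_char_poly_pos[OF ev cap_block_carrier[OF bN(1)]]
      order_char_poly_pos[OF ev' cap_block_carrier[OF bN(2)]] by auto
  ultimately show False
    using dvd_imp_order_le[OF nz dvd, of l] simple unfolding simple_eigenvalue_def by linarith
qed

lemma cap_block_eigenvalue_unique:
  assumes simple: "simple_eigenvalue (complex_mat (cap_mat N r x k0)) l"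
    and mi: "maximal_interval I a b" and ev: "eigenvalue (complex_mat (cap_block N r x k0 a b)) l"
    and mi': "maximal_interval I a' b'" and ev': "eigenvalue (complex_mat (cap_block N r x k0 a' b')) l"
  shows "(a, b) = (a', b')"
  using maximal_interval_disjoint[OF mi mi' index_set_bounds(2)]
    cap_block_eigenvalue_not_after[OF simple mi ev mi' ev']
    cap_block_eigenvalue_not_after[OF simple mi' ev' mi ev] by blast

end

section \<open>The matrix of gap amplitudes\<close>

lemma evens_eq: "evens a b = map (\<lambda>p. 2 * ((a + 1) div 2) + 2 * p) [0..<b div 2 + 1 - (a
  + 1) div 2]"
proof (induction b)
  case 0
  consider "a = 0" | "a = 1" | "a \<ge> 2" by linarith
  then show ?case by cases (auto simp: evens_def)
next
  case (Suc b)
  show ?case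
  proof (cases "a \<le> Suc b")
    case True
    then have e: "evens a (Suc b) = evens a b @ (if even (Suc b) then [Suc b] else [])"
      by (simp add: evens_def)
    show ?thesis
    proof (cases "even (Suc b)")
      case even: True
      then obtain m where m: "Suc b = 2 * Suc m"
        by (metis evenE not0_implies_Suc mult_0_right nat.distinct(1))
      then have "b div 2 = m" "Suc b div 2 = Suc m" "(a + 1) div 2 \<le> Suc m" using True by auto
      then show ?thesis using m unfolding e Suc by (simp add: Suc_diff_le)
    next
      case odd: False
      then have "Suc b div 2 = b div 2" by (metis div_Suc dvd_eq_mod_eq_0 even_Suc_div_two)
      then show ?thesis using odd unfolding e Suc by simp
    qed
  next
    case False
    then have "Suc b div 2 + 1 \<le> (a + 1) div 2" by auto
    then show ?thesis using False by (simp add: evens_def)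
  qed
qed

lemma odds_eq: "odds a b = map (\<lambda>q. 2 * (a div 2) + 1 + 2 * q) [0..<(b + 1) div 2 - a div 2]"
proof (induction b)
  case 0
  then show ?case by (cases "a = 0") (auto simp: odds_def)
next
  case (Suc b)
  show ?case
  proof (cases "a \<le> Suc b")
    case True
    then have e: "odds a (Suc b) = odds a b @ (if odd (Suc b) then [Suc b] else [])"
      by (simp add: odds_def)
    show ?thesis
    proof (cases "even (Suc b)")
      case odd: False
      then obtain m where m: "b = 2 * m" by auto
      then have "a div 2 \<le> m" using True by auto
      then show ?thesis using m unfolding e Suc by (simp add: Suc_diff_le)
    next
      case even: True
      then have "(Suc b + 1) div 2 = (b + 1) div 2" by (metis Suc_eq_plus1 even_Suc_div_two)
      then show ?thesis using even unfolding e Suc by simp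
    qed
  next
    case False
    then have "(Suc b + 1) div 2 \<le> a div 2" by auto
    then show ?thesis using False by (simp add: odds_def)
  qed
qed

lemma set_evens: "set (evens a b) = {i \<in> {a..b}. even i}" and set_odds: "set (odds a b) =
  {i \<in> {a..b}. odd i}"
  by (auto simp: evens_def odds_def)

lemma sum_nth_eq:
  assumes "distinct xs"
  shows "(\<Sum>p<length xs. f (xs ! p)) = (\<Sum>i\<in>set xs. f i)"
  by (rule sum.reindex_bij_betw[OF bij_betw_nth[OF assms refl refl]])

lemma distinct_evens [simp]: "distinct (evens a b)" and distinct_odds [simp]: "distinct (odds a b)"
  by (simp_all add: evens_def odds_def)

lemma nth_evens: "p < length (evens a b) \<Longrightarrow> evens a b ! p = 2 * ((a + 1) div 2) + 2 * p"
  and nth_odds: "q < length (odds a b) \<Longrightarrow> odds a b ! q = 2 * (a div 2) + 1 + 2 * q"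
  by (simp_all add: evens_eq odds_eq)

text \<open>The offset \<open>\<xi>\<close> only compensates for whether the interval starts with a
  gap or a resonator. In terms of the actual indices this is the incidence matrix of a path with
  resonators as vertices and gaps as edges directed to the right, where an outermost edge may lack
  an end.\<close>

lemma incidence_entry:
  assumes "p < length (evens a b)" "q < length (odds a b)"
  shows "incidence_mat a b $$ (p, q) = (if odds a b ! q + 1 = evens a b ! p then - 1
    else if odds a b ! q = evens a b ! p + 1 then 1 else 0)"
proof -
  have M: "incidence_mat a b $$ (p, q) = (if q + 1 = p + (a - 2 * (a div 2)) then - 1
      else if q = p + (a - 2 * (a div 2)) then 1 else 0)"
    using assms by (simp add: incidence_mat_def Let_def)
  show ?thesis
  proof (cases "even a")
    case True
    then obtain m where m: "a = 2 * m" by blast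
    have "odds a b ! q = 2 * m + 1 + 2 * q" "evens a b ! p = 2 * m + 2 * p"
      using nth_evens[OF assms(1)] nth_odds[OF assms(2)] by (simp_all add: m)
    moreover have "a - 2 * (a div 2) = 0" using m by simp
    ultimately show ?thesis unfolding M by auto
  next
    case False
    then obtain m where m: "a = 2 * m + 1" by (elim oddE)
    have "odds a b ! q = 2 * m + 1 + 2 * q" "evens a b ! p = 2 * m + 2 + 2 * p"
      using nth_evens[OF assms(1)] nth_odds[OF assms(2)] by (simp_all add: m)
    moreover have "a - 2 * (a div 2) = 1" using m by simp
    ultimately show ?thesis unfolding M by auto
  qed
qed

lemma mat_inverse_mat_diag:
  fixes f :: "nat \<Rightarrow> 'a::field"
  assumes "\<And>i. i < n \<Longrightarrow> f i \<noteq> 0"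
  shows "the (mat_inverse (mat_diag n f)) = mat_diag n (\<lambda>i. inverse (f i))"
proof -
  let ?A = "mat_diag n f" and ?B = "mat_diag n (\<lambda>i. inverse (f i))"
  have A: "?A \<in> carrier_mat n n" and B: "?B \<in> carrier_mat n n" by simp_all
  have AB: "?A * ?B = 1\<^sub>m n" "?B * ?A = 1\<^sub>m n"
    unfolding mat_diag_diag using assms by (auto simp: mat_diag_def intro!: eq_matI)
  have "?A \<in> Units (ring_mat TYPE('a) n n)"
    by (auto simp: Units_def ring_mat_def AB simp del: mat_diag_diag intro!: bexI[OF _ B])
  then obtain C where C: "mat_inverse ?A = Some C"
    using mat_inverse(1)[OF A] by fastforce
  note C' = mat_inverse(2)[OF A C]
  \<comment> \<open>Inverses are unique, so whatever \<open>mat_inverse\<close> returns is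
    \<open>?B\<close>.\<close>
  have "C = ?B * ?A * C" unfolding AB(2)
    by (rule left_mult_one_mat[symmetric]) (use C' in blast)
  also have "\<dots> = ?B * (?A * C)" using A B C' by (meson assoc_mult_mat)
  also have "\<dots> = ?B" using C' B by (metis right_mult_one_mat)
  finally show ?thesis using C by simp
qed

lemma complex_mat_diag: "complex_mat (mat_diag n f) = mat_diag n (\<lambda>i. complex_of_real (f i))"
  by (rule eq_matI) (auto simp: mat_diag_def)

lemma mat_diag_mult_vec:
  fixes f :: "nat \<Rightarrow> 'a::comm_ring_1"
  assumes "v \<in> carrier_vec n"
  shows "mat_diag n f *\<^sub>v v = vec n (\<lambda>i. f i * v $ i)"
proof (rule eq_vecI)
  fix i assume i: "i < dim_vec (vec n (\<lambda>i. f i * v $ i))"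
  then have "(mat_diag n f *\<^sub>v v) $ i = (\<Sum>j<n. (if i = j then f j else 0) * v $ j)"
    using assms by (simp add: mat_diag_def scalar_prod_def atLeast0LessThan)
  also have "\<dots> = (\<Sum>j<n. if i = j then f j * v $ j else 0)"
    by (rule sum.cong) auto
  also have "\<dots> = f i * v $ i" using i by (simp add: sum.delta)
  finally show "(mat_diag n f *\<^sub>v v) $ i = vec n (\<lambda>i. f i * v $ i) $ i" using i by simp
qed (simp add: mat_diag_def)

text \<open>The entry is \<open>B\<close> on the gap before the resonator minus \<open>B\<close> on
  the gap after it, and \<open>B\<close> is constant along a gap. A gap missing at an end of the
  interval contributes zero, and there \<open>B\<close> itself is zero by the start or the closing
  condition.\<close>

lemma incidence_transpose_mult_vec:
  assumes q: "q < length (odds a b)" and ch: "chain t \<mu> a b A B" and cl: "chain_closed b A B"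
    and a: "1 \<le> a"
  shows "(complex_mat ((incidence_mat a b)\<^sup>T) *\<^sub>v vec (length (evens a b)) (\<lambda>p. B (evens a b ! p))) $ q
    = t (odds a b ! q) * \<mu> * A (odds a b ! q)"
proof -
  note c = chainD[OF ch]
  define i where "i = odds a b ! q"
  have "i \<in> set (odds a b)" using q by (simp add: i_def)
  then have i: "a \<le> i" "i \<le> b" "odd i" by (auto simp: set_odds)
  have "(complex_mat ((incidence_mat a b)\<^sup>T) *\<^sub>v vec (length (evens a b)) (\<lambda>p. B (evens a b ! p))) $ q
      = (\<Sum>p<length (evens a b). complex_of_real (incidence_mat a b $$ (p, q)) * B (evens a b ! p))"
    using q by (simp add: incidence_mat_def scalar_prod_def atLeast0LessThan)
  also have "\<dots> = (\<Sum>p<length (evens a b). (\<lambda>e. (if i + 1 = e then - 1 else if i =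
    e + 1 then 1 else 0) * B e) (evens a b ! p))"
    by (rule sum.cong) (use q in \<open>auto simp: incidence_entry i_def\<close>)
  also have "\<dots> = (\<Sum>e\<in>{e \<in> {a..b}. even e}. (if i + 1 = e then - 1 else if i =
    e + 1 then 1 else 0) * B e)"
    using sum_nth_eq[OF distinct_evens, of "\<lambda>e. (if i + 1 = e then - 1 else if i =
      e + 1 then 1 else 0) * B e" a b]
    by (simp only: set_evens)
  also have "\<dots> = (\<Sum>e\<in>{e \<in> {a..b}. even e}. (if i + 1 = e then - B (i + 1) else 0) + (if i - 1 =
    e then B (i - 1) else 0))"
    by (rule sum.cong) (use i in auto)
  also have "\<dots> = (if i + 1 \<le> b then - B (i + 1) else 0) + (if a \<le> i - 1 then B (i - 1) else 0)"
    using i a by (auto simp: sum.distrib sum.delta)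
  also have "(if i + 1 \<le> b then - B (i + 1) else 0) = - B (i + 1)"
    using cl i by (cases "i = b") (auto simp: chain_closed_def)
  also have "(if a \<le> i - 1 then B (i - 1) else 0) = B i"
  proof (cases "i = a")
    case True
    then show ?thesis using c(2) i a by auto
  next
    case False
    then have "a \<le> i - 1" "i - 1 \<le> b" "even (i - 1)" "Suc (i - 1) = i" using i by auto
    then show ?thesis using c(4)[of "i - 1"] by simp
  qed
  also have "- B (i + 1) + B i = t i * \<mu> * A i" using c(6)[OF i] by simp
  finally show ?thesis by (simp add: i_def)
qed

text \<open>The dual computation: the entry is the jump of \<open>\<mu> * A\<close> over the gap,
  and at an end that lacks a resonator \<open>A\<close> is zero.\<close>

lemma incidence_mult_vec:
  assumes p: "p < length (evens a b)" and ch: "chain t \<mu> a b A B" and cl: "chain_closed b A B"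
    and a: "1 \<le> a"
  shows "(complex_mat (incidence_mat a b) *\<^sub>v vec (length (odds a b)) (\<lambda>q. \<mu>
    * A (odds a b ! q))) $ p
    = t (evens a b ! p) * \<mu>\<^sup>2 * B (evens a b ! p)"
proof -
  note c = chainD[OF ch]
  define i where "i = evens a b ! p"
  have "i \<in> set (evens a b)" using p by (simp add: i_def)
  then have i: "a \<le> i" "i \<le> b" "even i" by (auto simp: set_evens)
  then have i2: "i \<ge> 2" using a by (cases "i = 1") auto
  have "(complex_mat (incidence_mat a b) *\<^sub>v vec (length (odds a b)) (\<lambda>q. \<mu> * A (odds a b ! q))) $ p
      = (\<Sum>q<length (odds a b). complex_of_real (incidence_mat a b $$ (p, q)) * (\<mu>
        * A (odds a b ! q)))"
    using p by (simp add: incidence_mat_def scalar_prod_def atLeast0LessThan)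
  also have "\<dots> = (\<Sum>q<length (odds a b). (\<lambda>e. (if e + 1 = i then - 1 else if e =
    i + 1 then 1 else 0) * (\<mu> * A e)) (odds a b ! q))"
    by (rule sum.cong) (use p in \<open>auto simp: incidence_entry i_def\<close>)
  also have "\<dots> = (\<Sum>e\<in>{e \<in> {a..b}. odd e}. (if e + 1 = i then - 1 else if e =
    i + 1 then 1 else 0) * (\<mu> * A e))"
    using sum_nth_eq[OF distinct_odds, of "\<lambda>e. (if e + 1 = i then - 1 else if e =
      i + 1 then 1 else 0) * (\<mu> * A e)" a b]
    by (simp only: set_odds)
  also have "\<dots> = (\<Sum>e\<in>{e \<in> {a..b}. odd e}. (if i + 1 = e then \<mu> * A (i + 1) else 0) + (if i - 1 =
    e then - \<mu> * A (i - 1) else 0))"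
    by (rule sum.cong) (use i in auto)
  also have "\<dots> = (if i + 1 \<le> b then \<mu> * A (i + 1) else 0)
    + (if a \<le> i - 1 then - \<mu> * A (i - 1) else 0)"
    using i i2 by (auto simp: sum.distrib sum.delta)
  also have "(if i + 1 \<le> b then \<mu> * A (i + 1) else 0) = \<mu> * A (i + 1)"
    using cl i by (cases "i = b") (auto simp: chain_closed_def)
  also have "(if a \<le> i - 1 then - \<mu> * A (i - 1) else 0) = - \<mu> * A i"
  proof (cases "i = a")
    case True
    then show ?thesis using c(1) i a by auto
  next
    case False
    then have "a \<le> i - 1" "i - 1 \<le> b" "odd (i - 1)" "Suc (i - 1) = i" using i i2 by auto
    then show ?thesis using c(5)[of "i - 1"] by simp
  qed
  also have "\<mu> * A (i + 1) + - \<mu> * A i = t i * \<mu>\<^sup>2 * B i"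
    using c(3)[OF i] by (simp add: algebra_simps power2_eq_square)
  finally show ?thesis by (simp add: i_def)
qed

lemma mult_mat_vec_assoc4:
  fixes A B C E :: "'a::semiring_0 mat"
  assumes "A \<in> carrier_mat m m" "B \<in> carrier_mat m n" "C \<in> carrier_mat n n" "E \<in> carrier_mat n m"
    and v: "v \<in> carrier_vec m"
  shows "(A * B * C * E) *\<^sub>v v = A *\<^sub>v (B *\<^sub>v (C *\<^sub>v (E *\<^sub>v v)))"
proof -
  have Ev: "E *\<^sub>v v \<in> carrier_vec n" and CEv: "C *\<^sub>v (E *\<^sub>v v) \<in> carrier_vec n"
    and AB: "A * B \<in> carrier_mat m n" and ABC: "A * B * C \<in> carrier_mat m n"
    using assms by auto
  show ?thesis
    unfolding assoc_mult_mat_vec[OF ABC assms(4) v] assoc_mult_mat_vec[OF AB assms(3) Ev]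
      assoc_mult_mat_vec[OF assms(1,2) CEv] ..
qed

text \<open>The factors of \<open>D_mat\<close>, applied one at a time, run through the two halves
  of the recurrence: the transposed incidence matrix and the resonator lengths produce
  \<open>\<mu> * A\<close>, then the incidence matrix and the gap lengths return
  \<open>\<mu>\<^sup>2 * B\<close>.\<close>

lemma eigenvector_D_mat:
  assumes ab: "1 \<le> a" "a \<le> b" and t: "\<forall>i\<in>{a..b}. tlen r x i \<noteq> 0" and mu: "\<mu> \<noteq> 0"
    and ch: "chain (\<lambda>j. complex_of_real (tlen r x j)) \<mu> a b A B" and cl: "chain_closed b A B"
  shows "eigenvector (complex_mat (D_mat r x a b))
    (vec (length (evens a b)) (\<lambda>p. B (evens a b ! p))) (\<mu>\<^sup>2)"
proof -
  let ?t = "\<lambda>j. complex_of_real (tlen r x j)"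
  define s l where "s = length (evens a b)" and "l = length (odds a b)"
  let ?S = "mat_diag s (\<lambda>i. inverse (tlen r x (evens a b ! i)))"
    and ?L = "mat_diag l (\<lambda>i. inverse (tlen r x (odds a b ! i)))"
    and ?M = "incidence_mat a b" and ?\<beta> = "vec s (\<lambda>p. B (evens a b ! p))"
  have te: "tlen r x (evens a b ! p) \<noteq> 0" if "p < s" for p
  proof -
    have "evens a b ! p \<in> set (evens a b)" using that unfolding s_def by (rule nth_mem)
    then show ?thesis using t by (auto simp: set_evens)
  qed
  have to: "tlen r x (odds a b ! q) \<noteq> 0" if "q < l" for q
  proof -
    have "odds a b ! q \<in> set (odds a b)" using that unfolding l_def by (rule nth_mem)
    then show ?thesis using t by (auto simp: set_odds)
  qed
  have D: "D_mat r x a b = ?S * ?M * ?L * ?M\<^sup>T"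
    unfolding D_mat_def S_mat_def L_mat_def s_def[symmetric] l_def[symmetric]
    using te to by (simp add: mat_inverse_mat_diag)
  have car: "?S \<in> carrier_mat s s" "?L \<in> carrier_mat l l" "?M \<in> carrier_mat s l"
    "?M\<^sup>T \<in> carrier_mat l s"
    by (simp_all add: incidence_mat_def s_def l_def)
  have w1: "complex_mat (?M\<^sup>T) *\<^sub>v ?\<beta> = vec l (\<lambda>q. ?t (odds a b ! q) * \<mu> * A (odds a b ! q))"
    by (rule eq_vecI)
      (use incidence_transpose_mult_vec[OF _ ch cl ab(1)] car in \<open>auto simp: s_def l_def\<close>)
  have w2: "complex_mat ?L *\<^sub>v vec l (\<lambda>q. ?t (odds a b ! q) * \<mu> * A (odds a b ! q)) =
    vec l (\<lambda>q. \<mu> * A (odds a b ! q))"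
    unfolding complex_mat_diag by (subst mat_diag_mult_vec) (auto intro!: eq_vecI simp: to)
  have w3: "complex_mat ?M *\<^sub>v vec l (\<lambda>q. \<mu> * A (odds a b ! q)) =
    vec s (\<lambda>p. ?t (evens a b ! p) * \<mu>\<^sup>2 * B (evens a b ! p))"
    by (rule eq_vecI)
      (use incidence_mult_vec[OF _ ch cl ab(1)] car in \<open>auto simp: s_def l_def\<close>)
  have w4: "complex_mat ?S *\<^sub>v vec s (\<lambda>p. ?t (evens a b ! p) * \<mu>\<^sup>2 * B (evens a b ! p)) =
    \<mu>\<^sup>2 \<cdot>\<^sub>v ?\<beta>"
    unfolding complex_mat_diag by (subst mat_diag_mult_vec) (auto intro!: eq_vecI simp: te)
  have m1: "?S * ?M \<in> carrier_mat s l" and m2: "?S * ?M * ?L \<in> carrier_mat s l"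
    using car by (metis mult_carrier_mat)+
  have "complex_mat (D_mat r x a b) = complex_mat ?S * complex_mat ?M * complex_mat ?L
    * complex_mat (?M\<^sup>T)"
    unfolding D of_real_hom.mat_hom_mult[OF m2 car(4)] of_real_hom.mat_hom_mult[OF m1 car(2)]
      of_real_hom.mat_hom_mult[OF car(1,3)] ..
  then have "complex_mat (D_mat r x a b) *\<^sub>v ?\<beta> =
      complex_mat ?S *\<^sub>v (complex_mat ?M *\<^sub>v (complex_mat ?L *\<^sub>v (complex_mat (?M\<^sup>T) *\<^sub>v ?\<beta>)))"
    using car by (simp only: mult_mat_vec_assoc4[of _ s _ l] map_carrier_mat vec_carrier)
  also have "\<dots> = \<mu>\<^sup>2 \<cdot>\<^sub>v ?\<beta>" unfolding w1 w2 w3 w4 ..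
  finally have eq: "complex_mat (D_mat r x a b) *\<^sub>v ?\<beta> = \<mu>\<^sup>2 \<cdot>\<^sub>v ?\<beta>" .
  \<comment> \<open>If \<open>B\<close> vanished on all gaps, every flux would be zero, and the flux
    form of the eigenvalue equation would annihilate the nonzero vector of the block.\<close>
  have "?\<beta> \<noteq> 0\<^sub>v s"
  proof
    assume z: "?\<beta> = 0\<^sub>v s"
    have B0: "B i = 0" if "a \<le> i" "i \<le> b" "even i" for i
    proof -
      have "i \<in> set (evens a b)" using that by (simp add: set_evens)
      then obtain p where "p < s" "evens a b ! p = i" by (auto simp: in_set_conv_nth s_def)
      then show ?thesis using z by (metis index_vec index_zero_vec(1))
    qed
    have tn: "\<forall>i\<in>{a..b}. ?t i \<noteq> 0" using t by simp
    note m = mode_of_chain_closed[OF ab tn mu ch cl]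
    let ?V = "\<lambda>p. if p \<in> {a div 2..<(b + 1) div 2} then A (2 * p + 1) else 0"
    have fl: "flux ?t a b ?V n = 0" for n using m(2)[of n] B0[of "2 * n"] by simp
    then have "?V p = 0" for p
    proof (cases "p \<in> {a div 2..<(b + 1) div 2}")
      case True
      then have "2 * p + 1 \<in> {a..b}" by auto
      then have "?t (2 * p + 1) \<noteq> 0" using tn by blast
      moreover have "\<mu>\<^sup>2 * ?t (2 * p + 1) * ?V p = 0" using m(3)[OF True] fl by simp
      moreover have "\<mu>\<^sup>2 \<noteq> 0" using mu by simp
      ultimately show ?thesis by (blast dest: mult_eq_0_iff[THEN iffD1])
    qed presburger
    then show False using m(1) by blast
  qed
  moreover have "dim_row (complex_mat (D_mat r x a b)) = s" unfolding D by (simp add: mat_diag_def)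
  ultimately show ?thesis using eq by (simp add: eigenvector_def s_def)
qed

section \<open>Eigenmodes as interface data\<close>

lemma strict_mono_on_gap_free:
  assumes "strict_mono_on {1..n} x" "i \<in> {1..<n}" "x i < y" "y < (x (Suc i) :: real)"
  shows "y \<notin> x ` {1..n}"
proof
  assume "y \<in> x ` {1..n}"
  then obtain j where j: "j \<in> {1..n}" "y = x j" by blast
  have i: "i \<in> {1..n}" "Suc i \<in> {1..n}" using assms(2) by auto
  have "\<not> j \<le> i" using j i assms(3) strict_mono_on_leD[OF assms(1) j(1) i(1)] by auto
  moreover have "\<not> Suc i \<le> j" using j i assms(4) strict_mono_on_leD[OF assms(1) i(2) j(1)] by auto
  ultimately show False by simp
qed

lemma point_in_partition:
  fixes x :: "nat \<Rightarrow> real"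
  assumes "x 1 \<le> y" "y \<le> x n" "1 \<le> n"
  shows "y \<in> x ` {1..n} \<or> (\<exists>i\<in>{1..<n}. x i < y \<and> y < x (Suc i))"
  using assms(3,2)
proof (induction n rule: dec_induct)
  case base
  then show ?case using assms(1) by auto
next
  case (step n)
  then show ?case
    by (cases "y \<le> x n"; cases "y = x (Suc n)") (force simp: less_Suc_eq)+
qed

section \<open>Solutions on one interval and on the outer half-lines\<close>

lemma has_vector_derivative_zero_ex_const:
  fixes f :: "real \<Rightarrow> complex"
  assumes "convex S" "\<And>y. y \<in> S \<Longrightarrow> (f has_vector_derivative 0) (at y within S)"
  shows "\<exists>c. \<forall>y\<in>S. f y = c"
  by (rule has_vector_derivative_zero_constant[OF assms]) auto

text \<open>Rotating the pair \<open>k * u\<close>, \<open>u'\<close> back by the angle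
  \<open>k * (y - p)\<close> gives two quantities with zero derivative, hence constants; undoing the
  rotation gives the formulas.\<close>

lemma helmholtz_representation:
  fixes u u' :: "real \<Rightarrow> complex" and k :: complex
  assumes k: "k \<noteq> 0"
    and u: "\<And>y. y \<in> {p<..<q} \<Longrightarrow> (u has_vector_derivative u' y) (at y)"
    and u': "\<And>y. y \<in> {p<..<q} \<Longrightarrow> (u' has_vector_derivative - k\<^sup>2 * u y) (at y)"
  shows "\<exists>A B. \<forall>y\<in>{p<..<q}.
    u y = A * cos (k * of_real (y - p)) + B * sin (k * of_real (y - p)) \<and>
    u' y = k * (B * cos (k * of_real (y - p)) - A * sin (k * of_real (y - p)))"
proof -
  let ?c = "\<lambda>y. cos (k * of_real (y - p))" and ?s = "\<lambda>y. sin (k * of_real (y - p))"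
  have c: "(?c has_vector_derivative - k * ?s y) (at y)" for y
  proof -
    have "((\<lambda>z. cos (k * (z - of_real p))) has_field_derivative - k * ?s y) (at (of_real y))"
      by (auto intro!: derivative_eq_intros)
    from has_vector_derivative_real_field[OF this, of UNIV] show ?thesis by simp
  qed
  have s: "(?s has_vector_derivative k * ?c y) (at y)" for y
  proof -
    have "((\<lambda>z. sin (k * (z - of_real p))) has_field_derivative k * ?c y) (at (of_real y))"
      by (auto intro!: derivative_eq_intros)
    from has_vector_derivative_real_field[OF this, of UNIV] show ?thesis by simp
  qed
  have alg1: "(k * U * (- k * S) + k * U' * C) - (U' * (k * C) + - k\<^sup>2 * U * S) = 0"
    and alg2: "(k * U * (k * C) + k * U' * S) + (U' * (- k * S) + - k\<^sup>2 * U * C) = 0" for U U' C S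
    by (simp_all add: algebra_simps power2_eq_square)
  have "((\<lambda>y. k * u y * ?c y - u' y * ?s y) has_vector_derivative 0) (at y within {p<..<q})"
    if "y \<in> {p<..<q}" for y
  proof -
    have "((\<lambda>y. k * u y * ?c y - u' y * ?s y) has_vector_derivative
        (k * u y * (- k * ?s y) + k * u' y * ?c y) - (u' y * (k * ?c y)
          + - k\<^sup>2 * u y * ?s y)) (at y)"
      by (intro has_vector_derivative_diff has_vector_derivative_mult
          has_vector_derivative_mult_right c s u u' that)
    then show ?thesis unfolding alg1 by (rule has_vector_derivative_at_within)
  qed
  from has_vector_derivative_zero_ex_const[OF _ this]
  obtain A where A: "\<And>y. y \<in> {p<..<q} \<Longrightarrow> k * u y * ?c y - u' y * ?s y = A"
    by auto
  have "((\<lambda>y. k * u y * ?s y + u' y * ?c y) has_vector_derivative 0) (at y within {p<..<q})"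
    if "y \<in> {p<..<q}" for y
  proof -
    have "((\<lambda>y. k * u y * ?s y + u' y * ?c y) has_vector_derivative
        (k * u y * (k * ?c y) + k * u' y * ?s y) + (u' y * (- k * ?s y)
          + - k\<^sup>2 * u y * ?c y)) (at y)"
      by (intro has_vector_derivative_add has_vector_derivative_mult
          has_vector_derivative_mult_right c s u u' that)
    then show ?thesis unfolding alg2 by (rule has_vector_derivative_at_within)
  qed
  from has_vector_derivative_zero_ex_const[OF _ this]
  obtain B where B: "\<And>y. y \<in> {p<..<q} \<Longrightarrow> k * u y * ?s y + u' y * ?c y = B"
    by auto
  show ?thesis
  proof (rule exI[of _ "A / k"], rule exI[of _ "B / k"], intro ballI conjI)
    fix y assume y: "y \<in> {p<..<q}"
    have pyth: "?c y * ?c y + ?s y * ?s y = 1"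
      using sin_cos_squared_add[of "k * of_real (y
        - p)"] by (simp add: power2_eq_square add.commute)
    have *: "(k * U * C - U' * S) * C + (k * U * S + U' * C) * S = k * U * (C * C + S * S)"
      "(k * U * S + U' * C) * C - (k * U * C - U' * S) * S = U' * (C * C + S * S)" for U U' C S
      by (simp_all add: algebra_simps)
    have "A * ?c y + B * ?s y = k * u y * (?c y * ?c y + ?s y * ?s y)"
      unfolding A[OF y, symmetric] B[OF y, symmetric] by (rule *)
    then show "u y = A / k * ?c y + B / k * ?s y"
      unfolding pyth using k by (simp add: divide_simps)
    have "B * ?c y - A * ?s y = u' y * (?c y * ?c y + ?s y * ?s y)"
      unfolding A[OF y, symmetric] B[OF y, symmetric] by (rule *)
    then show "u' y = k * (B / k * ?c y - A / k * ?s y)"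
      unfolding pyth using k by (simp add: right_diff_distrib)
  qed
qed

text \<open>The equation holds on the open interval, so the two constants are identified by
  uniqueness of one-sided limits. With the derivative measured in units of \<open>k\<close>,
  crossing the interval is a rotation.\<close>

lemma helmholtz_interval:
  fixes u u' :: "real \<Rightarrow> complex" and k :: complex
  assumes pq: "p < q" and k: "k \<noteq> 0"
    and u: "\<And>y. y \<in> {p<..<q} \<Longrightarrow> (u has_vector_derivative u' y) (at y)"
    and u': "\<And>y. y \<in> {p<..<q} \<Longrightarrow> (u' has_vector_derivative - k\<^sup>2 * u y) (at y)"
    and lim: "(u \<longlongrightarrow> u p) (at_right p)" "(u \<longlongrightarrow> u q) (at_left q)"
      "(u' \<longlongrightarrow> k * d) (at_right p)" "(u' \<longlongrightarrow> k * e) (at_left q)"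
  shows "y \<in> {p<..<q} \<Longrightarrow> u y = u p * cos (k * of_real (y - p)) + d * sin (k * of_real (y - p))"
    and "u q = u p * cos (k * of_real (q - p)) + d * sin (k * of_real (q - p))"
    and "e = d * cos (k * of_real (q - p)) - u p * sin (k * of_real (q - p))"
proof -
  obtain A B where rep: "\<And>y. y \<in> {p<..<q} \<Longrightarrow>
      u y = A * cos (k * of_real (y - p)) + B * sin (k * of_real (y - p))"
    "\<And>y. y \<in> {p<..<q} \<Longrightarrow>
      u' y = k * (B * cos (k * of_real (y - p)) - A * sin (k * of_real (y - p)))"
    using helmholtz_representation[OF k u u'] by metis
  let ?f = "\<lambda>y. A * cos (k * of_real (y - p)) + B * sin (k * of_real (y - p))"
  let ?g = "\<lambda>y. k * (B * cos (k * of_real (y - p)) - A * sin (k * of_real (y - p)))"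
  have f: "(?f \<longlongrightarrow> ?f z) (at z within S)" and g: "(?g \<longlongrightarrow> ?g z) (at z within S)" for z S
    by (intro tendsto_intros)+
  have ev: "\<forall>\<^sub>F y in at_right p. y \<in> {p<..<q}" "\<forall>\<^sub>F y in at_left q. y \<in> {p<..<q}"
    using pq by (rule eventually_at_right_real, rule eventually_at_left_real)
  have "(u \<longlongrightarrow> ?f p) (at_right p)"
    by (rule Lim_transform_eventually[OF f eventually_mono[OF ev(1)]]) (simp add: rep(1))
  from tendsto_unique[OF _ lim(1) this] have "u p = ?f p" by simp
  moreover have "(u \<longlongrightarrow> ?f q) (at_left q)"
    by (rule Lim_transform_eventually[OF f eventually_mono[OF ev(2)]]) (simp add: rep(1))
  from tendsto_unique[OF _ lim(2) this] have uq: "u q = ?f q" by simp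
  moreover have "(u' \<longlongrightarrow> ?g p) (at_right p)"
    by (rule Lim_transform_eventually[OF g eventually_mono[OF ev(1)]]) (simp add: rep(2))
  from tendsto_unique[OF _ lim(3) this] have "k * d = ?g p" by simp
  moreover have "(u' \<longlongrightarrow> ?g q) (at_left q)"
    by (rule Lim_transform_eventually[OF g eventually_mono[OF ev(2)]]) (simp add: rep(2))
  from tendsto_unique[OF _ lim(4) this] have ke: "k * e = ?g q" by simp
  ultimately have "A = u p" "B = d" using k by auto
  then show "y \<in> {p<..<q} \<Longrightarrow> u y = u p * cos (k * of_real (y - p)) + d * sin (k * of_real (y - p))"
    "u q = u p * cos (k * of_real (q - p)) + d * sin (k * of_real (q - p))"
    "e = d * cos (k * of_real (q - p)) - u p * sin (k * of_real (q - p))"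
    using rep(1) uq ke k by auto
qed

text \<open>\<open>u\<close> times the inverse exponential is constant on \<open>S\<close>, and its
  limit along \<open>F\<close> is zero. The filter is general so that both outer half-lines are
  covered, each approached towards its finite end.\<close>

lemma exponential_decay_unique:
  fixes u :: "real \<Rightarrow> complex"
  assumes S: "convex S" "open S" and F: "F \<noteq> bot" "\<forall>\<^sub>F y in F. y \<in> S" "((\<lambda>y. y) \<longlongrightarrow> p) F"
    and u: "\<And>y. y \<in> S \<Longrightarrow> (u has_vector_derivative c * u y) (at y)"
    and lim: "(u \<longlongrightarrow> 0) F" and y: "y \<in> S"
  shows "u y = 0"
proof -
  let ?e = "\<lambda>y. exp (- c * of_real y)"
  have e: "(?e has_vector_derivative - c * ?e y) (at y)" for y
  proof -
    have "((\<lambda>z. exp (- c * z)) has_field_derivative - c * ?e y) (at (of_real y))"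
      by (auto intro!: derivative_eq_intros)
    from has_vector_derivative_real_field[OF this, of UNIV] show ?thesis by simp
  qed
  have "((\<lambda>y. u y * ?e y) has_vector_derivative 0) (at y within S)" if "y \<in> S" for y
  proof -
    have "((\<lambda>y. u y * ?e y) has_vector_derivative u y * (- c * ?e y) + c * u y * ?e y) (at y)"
      by (intro has_vector_derivative_mult e u that)
    moreover have "u y * (- c * ?e y) + c * u y * ?e y = 0" by simp
    ultimately show ?thesis by (metis has_vector_derivative_at_within)
  qed
  from has_vector_derivative_zero_ex_const[OF S(1) this]
  obtain A where A: "\<And>y. y \<in> S \<Longrightarrow> u y * ?e y = A" by auto
  have "((\<lambda>y. u y * ?e y) \<longlongrightarrow> 0 * ?e p) F"
    by (intro tendsto_intros lim F(3))
  moreover have "((\<lambda>y. u y * ?e y) \<longlongrightarrow> A) F"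
    by (rule tendsto_eventually) (use F(2) A in \<open>auto elim!: eventually_mono\<close>)
  ultimately have "A = 0" using tendsto_unique[OF F(1)] by fastforce
  then show ?thesis using A[OF y] by simp
qed

text \<open>\<open>w i\<close> is \<open>u' / k\<close> on the gap side of \<open>x i\<close>, hence the factor \<open>\<delta>\<close> on the resonators.\<close>

definition interface_data ::
  "nat \<Rightarrow> (nat \<Rightarrow> real) \<Rightarrow> complex \<Rightarrow> complex \<Rightarrow> (real \<Rightarrow> complex) \<Rightarrow> (nat \<Rightarrow> complex) \<Rightarrow> bool" where
  "interface_data N x k \<delta> u w \<longleftrightarrow>
    (\<forall>i\<in>{1..2 * N - 1}.
      let \<tau> = (if odd i then \<delta> else 1); z = k * of_real (x (Suc i) - x i) in
        (\<forall>y\<in>{x i<..<x (Suc i)}.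
          u y = u (x i) * cos (k * of_real (y - x i)) + \<tau> * w i * sin (k * of_real (y - x i))) \<and>
        u (x (Suc i)) = u (x i) * cos z + \<tau> * w i * sin z \<and>
        \<tau> * w (Suc i) = \<tau> * w i * cos z - u (x i) * sin z) \<and>
    w 1 = - \<i> * u (x 1) \<and> w (2 * N) = \<i> * u (x (2 * N)) \<and>
    (\<exists>j\<in>{1..2 * N}. u (x j) \<noteq> 0 \<or> w j \<noteq> 0)"

text \<open>Nontriviality passes to the interfaces because vanishing data would propagate: to each
  interval by the representation through its left end, to the outer half-lines by the first-order
  radiation equation.\<close>

lemma eigenmode_interface_data:
  assumes N: "N \<ge> 1" and x: "strict_mono_on {1..2 * N} x" and v: "v > 0" and k: "k \<noteq> 0"
    and em: "eigenmode N x v v \<delta> (k * complex_of_real v) u"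
  shows "\<exists>w. interface_data N x k \<delta> u w"
proof -
  let ?P = "x ` {1..2 * N}"
  have \<omega>: "(k * complex_of_real v)\<^sup>2 / (complex_of_real v)\<^sup>2 =
    k\<^sup>2" "k * complex_of_real v / complex_of_real v = k"
    using v by (simp_all add: power_mult_distrib)
  from em obtain u' where
    u0: "\<forall>y. y \<notin> ?P \<longrightarrow> (u has_vector_derivative u' y) (at y)" and
    u1: "\<forall>y. y \<notin> ?P \<longrightarrow> y \<notin> resonators N x \<longrightarrow> (u' has_vector_derivative - k\<^sup>2 * u y) (at y)" and
    u2: "\<forall>y\<in>resonators N x. (u' has_vector_derivative - k\<^sup>2 * u y) (at y)" and
    c0: "\<forall>j\<in>{1..2 * N}. (u \<longlongrightarrow> u (x j)) (at_left (x j)) \<and> (u \<longlongrightarrow> u (x j)) (at_right (x j))" and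
    j0: "\<forall>j\<in>{1..N}.
      (\<exists>d. (u' \<longlongrightarrow> d) (at_left (x (2 * j - 1))) \<and> (u' \<longlongrightarrow> \<delta> * d) (at_right (x (2 * j - 1)))) \<and>
      (\<exists>d. (u' \<longlongrightarrow> d) (at_right (x (2 * j))) \<and> (u' \<longlongrightarrow> \<delta> * d) (at_left (x (2 * j))))" and
    out0: "\<forall>y<x 1. u' y = - \<i> * k * u y" "\<forall>y>x (2 * N). u' y = \<i> * k * u y"
    unfolding eigenmode_def scattering_solution_def \<omega> by (elim conjE exE) (rule that; assumption)
  note u = u0[rule_format] and u'1 = u1[rule_format] and u'2 = u2[rule_format]
    and cont = c0[rule_format, THEN conjunct1] c0[rule_format, THEN conjunct2]
    and jump = j0[rule_format, THEN conjunct1] j0[rule_format, THEN conjunct2]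
    and out = out0(1)[rule_format] out0(2)[rule_format]
  \<comment> \<open>Naming the limit on the side away from the resonator, left for odd
    \<open>j\<close> and right for even \<open>j\<close>, gives one number per interface without
    dividing by \<delta>.\<close>
  have "\<forall>j\<in>{1..2 * N}. \<exists>d. (u' \<longlongrightarrow> (if odd j then 1 else \<delta>) * (k * d)) (at_left (x j)) \<and>
      (u' \<longlongrightarrow> (if odd j then \<delta> else 1) * (k * d)) (at_right (x j))"
  proof
    fix j assume j: "j \<in> {1..2 * N}"
    show "\<exists>d. (u' \<longlongrightarrow> (if odd j then 1 else \<delta>) * (k * d)) (at_left (x j)) \<and>
      (u' \<longlongrightarrow> (if odd j then \<delta> else 1) * (k * d)) (at_right (x j))"
    proof (cases "odd j")
      case True
      then obtain m where m: "j = 2 * Suc m - 1" by (elim oddE) auto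
      then have "Suc m \<in> {1..N}" using j by auto
      from jump(1)[OF this] obtain d where "(u' \<longlongrightarrow> d) (at_left (x j)) \<and>
        (u' \<longlongrightarrow> \<delta> * d) (at_right (x j))"
        unfolding m by blast
      then show ?thesis using True k by (intro exI[of _ "d / k"]) simp
    next
      case False
      then obtain m where m: "j = 2 * m" by blast
      then have "m \<in> {1..N}" using j by auto
      from jump(2)[OF this] obtain d where "(u' \<longlongrightarrow> d) (at_right (x j)) \<and>
        (u' \<longlongrightarrow> \<delta> * d) (at_left (x j))"
        unfolding m by blast
      then show ?thesis using False k by (intro exI[of _ "d / k"]) simp
    qed
  qed
  then obtain w where
    wl: "\<And>j. j \<in> {1..2 * N} \<Longrightarrow> (u' \<longlongrightarrow> (if odd j then 1 else \<delta>) * (k * w j)) (at_left (x j))" and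
    wr: "\<And>j. j \<in> {1..2 * N} \<Longrightarrow> (u' \<longlongrightarrow> (if odd j then \<delta> else 1) * (k * w j)) (at_right (x j))"
    unfolding bchoice_iff by blast
  have mono: "x i < x (Suc i)" if "i \<in> {1..2 * N - 1}" for i
    using that by (intro strict_mono_onD[OF x]) auto
  have free: "y \<notin> ?P" if "i \<in> {1..2 * N - 1}" "y \<in> {x i<..<x (Suc i)}" for i y
  proof -
    have "i \<in> {1..<2 * N}" using that by auto
    then show ?thesis using strict_mono_on_gap_free[OF x] that by auto
  qed
  have inner: "(\<forall>y\<in>{x i<..<x (Suc i)}.
        u y = u (x i) * cos (k * of_real (y - x i)) + \<tau> * w i * sin (k * of_real (y - x i))) \<and>
      u (x (Suc i)) = u (x i) * cos (k * of_real (x (Suc i) - x i))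
        + \<tau> * w i * sin (k * of_real (x (Suc i) - x i)) \<and>
      \<tau> * w (Suc i) = \<tau> * w i * cos (k * of_real (x (Suc i) - x i))
        - u (x i) * sin (k * of_real (x (Suc i) - x i))"
    if i: "i \<in> {1..2 * N - 1}" and \<tau>: "\<tau> = (if odd i then \<delta> else 1)" for i \<tau>
  proof -
    have ij: "i \<in> {1..2 * N}" "Suc i \<in> {1..2 * N}" using i by auto
    have d: "(u has_vector_derivative u' y) (at y)" "(u' has_vector_derivative - k\<^sup>2 * u y) (at y)"
      if "y \<in> {x i<..<x (Suc i)}" for y
      using free[OF i that] u u'1 u'2 by blast+
    have lr: "(u' \<longlongrightarrow> k * (\<tau> * w i)) (at_right (x i))"
      "(u' \<longlongrightarrow> k * (\<tau> * w (Suc i))) (at_left (x (Suc i)))"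
      using wr[OF ij(1)] wl[OF ij(2)] by (auto simp: \<tau> mult.left_commute split: if_splits)
    note h = helmholtz_interval[of "x i" "x (Suc i)" k u u', OF mono[OF i] k d cont(2)[OF ij(1)] cont(1)[OF ij(2)] lr]
    show ?thesis using h by blast
  qed
  have ends: "1 \<in> {1..2 * N}" "2 * N \<in> {1..2 * N}" using N by auto
  have le: "x 1 \<le> x j" "x j \<le> x (2 * N)" if "j \<in> {1..2 * N}" for j
    using that strict_mono_on_leD[OF x] ends by auto
  have outP: "y \<notin> ?P" if "y < x 1 \<or> y > x (2 * N)" for y
    using that le by fastforce
  have evl: "\<forall>\<^sub>F y in at_left (x 1). y < x 1" "\<forall>\<^sub>F y in at_right (x (2 * N)). y > x (2 * N)"
    by (simp_all add: eventually_at_filter)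
  \<comment> \<open>The radiation condition holds only beyond the interfaces; it reaches
    \<open>x 1\<close> by comparing two expressions for the left limit of \<open>u'\<close>.\<close>
  have "k * w 1 = - \<i> * k * u (x 1)"
  proof (rule tendsto_unique)
    show "(u' \<longlongrightarrow> k * w 1) (at_left (x 1))" using wl[OF ends(1)] by simp
    have "((\<lambda>y. - \<i> * k * u y) \<longlongrightarrow> - \<i> * k * u (x 1)) (at_left (x 1))"
      by (intro tendsto_intros cont ends)
    then show "(u' \<longlongrightarrow> - \<i> * k * u (x 1)) (at_left (x 1))"
      by (rule Lim_transform_eventually) (use evl(1) out in \<open>auto elim!: eventually_mono\<close>)
  qed simp
  then have "k * w 1 = k * (- \<i> * u (x 1))" by (simp add: ac_simps)
  then have w1: "w 1 = - \<i> * u (x 1)" unfolding mult_left_cancel[OF k] .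
  have "k * w (2 * N) = \<i> * k * u (x (2 * N))"
  proof (rule tendsto_unique)
    show "(u' \<longlongrightarrow> k * w (2 * N)) (at_right (x (2 * N)))" using wr[OF ends(2)] by simp
    have "((\<lambda>y. \<i> * k * u y) \<longlongrightarrow> \<i> * k * u (x (2 * N))) (at_right (x (2 * N)))"
      by (intro tendsto_intros cont ends)
    then show "(u' \<longlongrightarrow> \<i> * k * u (x (2 * N))) (at_right (x (2 * N)))"
      by (rule Lim_transform_eventually) (use evl(2) out in \<open>auto elim!: eventually_mono\<close>)
  qed simp
  then have "k * w (2 * N) = k * (\<i> * u (x (2 * N)))" by (simp add: ac_simps)
  then have w2: "w (2 * N) = \<i> * u (x (2 * N))" unfolding mult_left_cancel[OF k] .
  have "\<exists>j\<in>{1..2 * N}. u (x j) \<noteq> 0 \<or> w j \<noteq> 0"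
  proof (rule ccontr)
    assume "\<not> ?thesis"
    then have zero: "\<And>j. j \<in> {1..2 * N} \<Longrightarrow> u (x j) = 0 \<and> w j = 0" by blast
    have "u y = 0" for y
    proof -
      consider "y < x 1" | "y > x (2 * N)" | "y \<in> ?P" | i where "i \<in> {1..2 * N
        - 1}" "y \<in> {x i<..<x (Suc i)}"
        using point_in_partition[of x y "2 * N"] N by force
      then show ?thesis
      proof cases
        case 1
        have "(u has_vector_derivative - \<i> * k * u z) (at z)" if "z \<in> {..<x 1}" for z
          using u[of z] outP[of z] out(1)[of z] that by simp
        moreover have "(u \<longlongrightarrow> 0) (at_left (x 1))"
          using cont(1)[OF ends(1)] zero[OF ends(1)] by simp
        ultimately show ?thesis
          using 1 evl(1) by (intro exponential_decay_unique[where S = "{..<x 1}" and F =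
            "at_left (x 1)"
                and c = "- \<i> * k"])
            (auto intro: tendsto_intros)
      next
        case 2
        have "(u has_vector_derivative \<i> * k * u z) (at z)" if "z \<in> {x (2 * N)<..}" for z
          using u[of z] outP[of z] out(2)[of z] that by simp
        moreover have "(u \<longlongrightarrow> 0) (at_right (x (2 * N)))"
          using cont(2)[OF ends(2)] zero[OF ends(2)] by simp
        ultimately show ?thesis
          using 2 evl(2) by (intro exponential_decay_unique[where S = "{x (2 * N)<..}" and F =
            "at_right (x (2 * N))"
                and c = "\<i> * k"])
            (auto intro: tendsto_intros)
      next
        case 3
        then show ?thesis using zero by auto
      next
        case (4 i)
        then have "i \<in> {1..2 * N}" by auto
        then show ?thesis using inner[OF 4(1) refl] 4(2) zero[of i] by auto
      qed
    qed
    then show False using em by (simp add: eigenmode_def)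
  qed
  then show ?thesis
    using inner w1 w2 by (intro exI[of _ w]) (simp add: interface_data_def Let_def)
qed

section \<open>Perturbed recurrences\<close>

lemma cmult_in_bigo: "f \<in> O[F](g) \<Longrightarrow> (\<lambda>p. z * f p) \<in> O[F](g)" for z :: complex
  by (cases "z = 0") simp_all

text \<open>\<open>c i\<close> is the sign of \<open>cos (k0 t i)\<close>.\<close>

locale near_chain =
  fixes N :: nat and t c :: "nat \<Rightarrow> complex" and I :: "nat set" and \<mu> :: complex
    and F :: "'p filter" and G :: "'p \<Rightarrow> complex" and U W :: "'p \<Rightarrow> nat \<Rightarrow> complex"
  assumes I: "I \<subseteq> {1..2 * N - 1}" and c: "\<And>i. i \<in> I \<Longrightarrow> c i * c i = 1"
    and even_res: "\<And>i. i \<in> I \<Longrightarrow> even i \<Longrightarrow> (\<lambda>p. U p (Suc i) - c i * (U p i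
      + t i * \<mu> * W p i)) \<in> O[F](G)"
      "\<And>i. i \<in> I \<Longrightarrow> even i \<Longrightarrow> (\<lambda>p. W p (Suc i) - c i * W p i) \<in> O[F](G)"
    and odd_res: "\<And>i. i \<in> I \<Longrightarrow> odd i \<Longrightarrow> (\<lambda>p. U p (Suc i) - c i * U p i) \<in> O[F](G)"
      "\<And>i. i \<in> I \<Longrightarrow> odd i \<Longrightarrow> (\<lambda>p. W p (Suc i) - c i * (W p i - t i * \<mu> * U p i)) \<in> O[F](G)"
    and even_non: "\<And>i. i \<in> {1..2 * N - 1} - I \<Longrightarrow> even i \<Longrightarrow> (\<lambda>p. W p i) \<in> O[F](G)"
      "\<And>i. i \<in> {1..2 * N - 1} - I \<Longrightarrow> even i \<Longrightarrow> (\<lambda>p. W p (Suc i)) \<in> O[F](G)"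
    and odd_non: "\<And>i. i \<in> {1..2 * N - 1} - I \<Longrightarrow> odd i \<Longrightarrow> (\<lambda>p. U p i) \<in> O[F](G)"
      "\<And>i. i \<in> {1..2 * N - 1} - I \<Longrightarrow> odd i \<Longrightarrow> (\<lambda>p. U p (Suc i)) \<in> O[F](G)"
    and boundary: "(\<lambda>p. W p 1) \<in> O[F](G)" "(\<lambda>p. W p (2 * N)) \<in> O[F](G)"
begin

lemma zero_notin_I: "0 \<notin> I"
  using I by auto

lemma finite_I: "finite I"
  using I finite_subset by blast

text \<open>The component at the left end of a block that nothing forces to be small: the free
  parameter of its recurrence, normalized to 1 in \<open>chain\<close>.\<close>

abbreviation lead :: "nat \<Rightarrow> 'p \<Rightarrow> complex" where
  "lead a p \<equiv> (if odd a then U p a else W p a)"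

text \<open>The interval before the block lies outside \<open>I\<close>, where a gap makes
  \<open>W\<close> and a resonator makes \<open>U\<close> small at both ends; a block starting at
  the first interface has the boundary condition instead.\<close>

lemma other_component_start:
  assumes "maximal_interval I a b"
  shows "(\<lambda>p. if odd a then W p a else U p a) \<in> O[F](G)"
proof (cases "a = 1")
  case True
  then show ?thesis using boundary by simp
next
  case False
  note d = maximal_intervalD[OF assms zero_notin_I]
  have "b \<in> I" using d by auto
  then have "b \<le> 2 * N - 1" using I by auto
  then have i: "a - 1 \<in> {1..2 * N - 1} - I" "Suc (a - 1) = a" using d False by auto
  then show ?thesis
    using even_non(2)[OF i(1)] odd_non(2)[OF i(1)] d(1) by (cases "odd a") auto
qed

lemma end_component:
  assumes "maximal_interval I a b"
  shows "(\<lambda>p. if odd b then W p (Suc b) else U p (Suc b)) \<in> O[F](G)"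
proof (cases "b = 2 * N - 1")
  case True
  note d = maximal_intervalD[OF assms zero_notin_I]
  have "Suc b = 2 * N" "odd b" using True d by auto
  then show ?thesis using boundary by simp
next
  case False
  note d = maximal_intervalD[OF assms zero_notin_I]
  have "b \<in> I" using d by auto
  then have "b \<le> 2 * N - 1" using I by auto
  then have i: "Suc b \<in> {1..2 * N - 1} - I" using d False by auto
  then show ?thesis
    using even_non(1)[OF i] odd_non(1)[OF i] by (cases "odd b") auto
qed

lemma prod_signs:
  assumes "{a..b} \<subseteq> I" "i \<le> Suc b"
  shows "(\<Prod>j\<in>{a..<i}. c j) * (\<Prod>j\<in>{a..<i}. c j) = 1"
proof -
  have "(\<Prod>j\<in>{a..<i}. c j * c j) = 1"
    by (rule prod.neutral) (use assms c in \<open>auto simp: subset_iff\<close>)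
  then show ?thesis by (simp add: prod.distrib)
qed

text \<open>Multiplying by the accumulated signs removes them from the recurrence, since each
  squares to 1. What remains is the recurrence of \<open>chain\<close> scaled by
  \<open>lead a\<close>; each interval adds its residual to a fixed linear combination of the
  earlier errors.\<close>

lemma block_approx:
  assumes mi: "maximal_interval I a b" and ch: "chain t \<mu> a b A B"
    and i: "a \<le> i" "i \<le> Suc b"
  shows "(\<lambda>p. (\<Prod>j\<in>{a..<i}. c j) * U p i - lead a p * A i) \<in> O[F](G) \<and>
    (\<lambda>p. (\<Prod>j\<in>{a..<i}. c j) * W p i - lead a p * B i) \<in> O[F](G)"
  using i
proof (induction i rule: dec_induct)
  case base
  then show ?case
    using other_component_start[OF mi] chainD(1,2)[OF ch] by (cases "odd a") auto
next
  case (step i)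
  note d = maximal_intervalD[OF mi zero_notin_I]
  let ?\<sigma> = "\<Prod>j\<in>{a..<i}. c j"
  have i: "a \<le> i" "i \<le> b" "i \<in> I" using step d by auto
  have U: "(\<lambda>p. ?\<sigma> * U p i - lead a p * A i) \<in> O[F](G)"
    and W: "(\<lambda>p. ?\<sigma> * W p i - lead a p * B i) \<in> O[F](G)"
    using step by auto
  have \<sigma>: "(\<Prod>j\<in>{a..<Suc i}. c j) = ?\<sigma> * c i" using i by simp
  have cc: "c i * (c i * z) = z" for z using c[OF i(3)] by (simp add: mult.assoc[symmetric])
  show ?case
  proof (cases "even i")
    case True
    have "(\<lambda>p. ?\<sigma> * c i * (U p (Suc i) - c i * (U p i + t i * \<mu> * W p i))
        + ((?\<sigma> * U p i - lead a p * A i) + t i * \<mu> * (?\<sigma> * W p i - lead a p * B i))) \<in> O[F](G)"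
      by (intro sum_in_bigo U W even_res(1)[OF i(3) True] cmult_in_bigo)
    moreover have "?\<sigma> * c i * (U p (Suc i) - c i * (U p i + t i * \<mu> * W p i))
        + ((?\<sigma> * U p i - lead a p * A i) + t i * \<mu> * (?\<sigma> * W p i - lead a p * B i))
      = ?\<sigma> * c i * U p (Suc i) - lead a p * A (Suc i)" for p
      unfolding chainD(3)[OF ch i(1,2) True] by (simp add: algebra_simps cc)
    moreover have "(\<lambda>p. ?\<sigma> * c i * (W p (Suc i) - c i * W p i)
      + (?\<sigma> * W p i - lead a p * B i)) \<in> O[F](G)"
      by (intro sum_in_bigo W even_res(2)[OF i(3) True] cmult_in_bigo)
    moreover have "?\<sigma> * c i * (W p (Suc i) - c i * W p i) + (?\<sigma> * W p i - lead a p * B i)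
      = ?\<sigma> * c i * W p (Suc i) - lead a p * B (Suc i)" for p
      unfolding chainD(4)[OF ch i(1,2) True] by (simp add: algebra_simps cc)
    ultimately show ?thesis unfolding \<sigma> by simp
  next
    case False
    have "(\<lambda>p. ?\<sigma> * c i * (W p (Suc i) - c i * (W p i - t i * \<mu> * U p i))
        + ((?\<sigma> * W p i - lead a p * B i) - t i * \<mu> * (?\<sigma> * U p i - lead a p * A i))) \<in> O[F](G)"
      by (intro sum_in_bigo U W odd_res(2)[OF i(3) False] cmult_in_bigo)
    moreover have "?\<sigma> * c i * (W p (Suc i) - c i * (W p i - t i * \<mu> * U p i))
        + ((?\<sigma> * W p i - lead a p * B i) - t i * \<mu> * (?\<sigma> * U p i - lead a p * A i))
      = ?\<sigma> * c i * W p (Suc i) - lead a p * B (Suc i)" for p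
      unfolding chainD(6)[OF ch i(1,2) False] by (simp add: algebra_simps cc)
    moreover have "(\<lambda>p. ?\<sigma> * c i * (U p (Suc i) - c i * U p i)
      + (?\<sigma> * U p i - lead a p * A i)) \<in> O[F](G)"
      by (intro sum_in_bigo U odd_res(1)[OF i(3) False] cmult_in_bigo)
    moreover have "?\<sigma> * c i * (U p (Suc i) - c i * U p i) + (?\<sigma> * U p i - lead a p * A i)
      = ?\<sigma> * c i * U p (Suc i) - lead a p * A (Suc i)" for p
      unfolding chainD(5)[OF ch i(1,2) False] by (simp add: algebra_simps cc)
    ultimately show ?thesis unfolding \<sigma> by simp
  qed
qed

text \<open>The component at the right end is small by \<open>end_component\<close>, and by
  \<open>block_approx\<close> it is, up to sign, close to \<open>lead a\<close> times a constant.
  When the chain does not close, this constant is nonzero, so \<open>lead a\<close> is small and the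
  whole block with it.\<close>

lemma block_small:
  assumes mi: "maximal_interval I a b" and ch: "chain t \<mu> a b A B" and cl: "\<not> chain_closed b A B"
    and i: "a \<le> i" "i \<le> Suc b"
  shows "(\<lambda>p. U p i) \<in> O[F](G)" "(\<lambda>p. W p i) \<in> O[F](G)"
proof -
  note d = maximal_intervalD[OF mi zero_notin_I]
  let ?\<sigma> = "\<lambda>i. \<Prod>j\<in>{a..<i}. c j"
  have lead: "lead a \<in> O[F](G)"
  proof (cases "odd b")
    case True
    have "(\<lambda>p. W p (Suc b)) \<in> O[F](G)" using end_component[OF mi] True by simp
    then have "(\<lambda>p. ?\<sigma> (Suc b) * W p (Suc b) - (?\<sigma> (Suc b) * W p (Suc b)
      - lead a p * B (Suc b))) \<in> O[F](G)"
      by (rule sum_in_bigo(2)[OF cmult_in_bigo]) (use block_approx[OF mi ch,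
        of "Suc b"] d(2) in auto)
    moreover have "?\<sigma> (Suc b) * W p (Suc b) - (?\<sigma> (Suc b) * W p (Suc b) - lead a p * B (Suc b))
      = lead a p * B (Suc b)" for p by (simp only: diff_diff_eq2 add_diff_cancel_left')
    ultimately have "(\<lambda>p. lead a p * B (Suc b)) \<in> O[F](G)" by (simp only:)
    moreover have "B (Suc b) \<noteq> 0" using cl True by (simp add: chain_closed_def)
    ultimately show ?thesis by simp
  next
    case False
    have "(\<lambda>p. U p (Suc b)) \<in> O[F](G)" using end_component[OF mi] False by simp
    then have "(\<lambda>p. ?\<sigma> (Suc b) * U p (Suc b) - (?\<sigma> (Suc b) * U p (Suc b)
      - lead a p * A (Suc b))) \<in> O[F](G)"
      by (rule sum_in_bigo(2)[OF cmult_in_bigo]) (use block_approx[OF mi ch,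
        of "Suc b"] d(2) in auto)
    moreover have "?\<sigma> (Suc b) * U p (Suc b) - (?\<sigma> (Suc b) * U p (Suc b) - lead a p * A (Suc b))
      = lead a p * A (Suc b)" for p by (simp only: diff_diff_eq2 add_diff_cancel_left')
    ultimately have "(\<lambda>p. lead a p * A (Suc b)) \<in> O[F](G)" by (simp only:)
    moreover have "A (Suc b) \<noteq> 0" using cl False by (simp add: chain_closed_def)
    ultimately show ?thesis by simp
  qed
  have \<sigma>: "?\<sigma> i \<noteq> 0" using prod_signs[OF d(3) i(2)] by (metis mult_zero_left zero_neq_one)
  have mono: "(\<lambda>p. lead a p * z) \<in> O[F](G)" for z
    using cmult_in_bigo[OF lead, of z] by (simp add: mult.commute)
  have "(\<lambda>p. (?\<sigma> i * U p i - lead a p * A i) + lead a p * A i) \<in> O[F](G)"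
    by (rule sum_in_bigo(1)[OF _ mono]) (use block_approx[OF mi ch i] in auto)
  then show "(\<lambda>p. U p i) \<in> O[F](G)" using \<sigma> by simp
  have "(\<lambda>p. (?\<sigma> i * W p i - lead a p * B i) + lead a p * B i) \<in> O[F](G)"
    by (rule sum_in_bigo(1)[OF _ mono]) (use block_approx[OF mi ch i] in auto)
  then show "(\<lambda>p. W p i) \<in> O[F](G)" using \<sigma> by simp
qed

lemma other_block_small:
  assumes unique: "\<forall>a b A B. maximal_interval I a b \<longrightarrow> chain t \<mu> a b A B \<longrightarrow>
      chain_closed b A B \<longrightarrow> (a, b) = (a0, b0)"
    and j: "j \<in> I" "j \<notin> {a0..b0}" "i \<in> {j, Suc j}"
  shows "(\<lambda>p. U p i) \<in> O[F](G)" "(\<lambda>p. W p i) \<in> O[F](G)"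
proof -
  obtain a b where mi: "maximal_interval I a b" and jab: "j \<in> {a..b}"
    using maximal_interval_exists[OF finite_I j(1)] by blast
  obtain A B where ch: "chain t \<mu> a b A B" using chain_exists by blast
  have cl: "\<not> chain_closed b A B" using unique mi ch jab j(2) by blast
  have i: "a \<le> i" "i \<le> Suc b" using jab j(3) by auto
  show "(\<lambda>p. U p i) \<in> O[F](G)" "(\<lambda>p. W p i) \<in> O[F](G)"
    using block_small[OF mi ch cl i] by auto
qed

text \<open>Interface \<open>j\<close> bounds the intervals \<open>j - 1\<close> and
  \<open>j\<close>. If one of them is in \<open>I\<close>, it belongs to another block. If neither
  is, the resonator among them makes \<open>U\<close> small, and the gap, or the exterior at the
  outermost interfaces, makes \<open>W\<close> small.\<close>

lemma outside_small:
  assumes unique: "\<forall>a b A B. maximal_interval I a b \<longrightarrow> chain t \<mu> a b A B \<longrightarrow>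
      chain_closed b A B \<longrightarrow> (a, b) = (a0, b0)"
    and j: "j \<in> {1..2 * N}" "j \<notin> {a0..Suc b0}"
  shows "(\<lambda>p. U p j) \<in> O[F](G) \<and> (\<lambda>p. W p j) \<in> O[F](G)"
proof -
  consider "j \<in> I" | "j \<ge> 2" "j - 1 \<in> I" | "j \<notin> I" "j = 1 \<or> j - 1 \<notin> I"
    using j(1) by force
  then show ?thesis
  proof cases
    case 1
    then show ?thesis using other_block_small[OF unique, of j j] j(2) by auto
  next
    case 2
    moreover from this have "Suc (j - 1) = j" "j - 1 \<notin> {a0..b0}" using j(2) by auto
    ultimately show ?thesis using other_block_small[OF unique, of "j - 1" j] by auto
  next
    case 3
    have left: "j - 1 \<in> {1..2 * N - 1} - I" "Suc (j - 1) = j" if "j \<noteq> 1" using 3 that j(1) by auto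
    have right: "j \<in> {1..2 * N - 1} - I" if "j \<noteq> 2 * N" using 3 that j(1) by auto
    show ?thesis
    proof (cases "odd j")
      case True
      then have "j \<noteq> 2 * N" by auto
      with True have "(\<lambda>p. U p j) \<in> O[F](G)" using odd_non(1)[of j] right by auto
      moreover have "(\<lambda>p. W p j) \<in> O[F](G)"
        using boundary(1) even_non(2)[of "j - 1"] left True by (cases "j = 1") auto
      ultimately show ?thesis by blast
    next
      case False
      then have "j \<noteq> 1" by auto
      then have "(\<lambda>p. U p j) \<in> O[F](G)" using odd_non(2)[of "j - 1"] left False by auto
      moreover have "(\<lambda>p. W p j) \<in> O[F](G)"
        using boundary(2) even_non(1)[of j] right False by (cases "j = 2 * N") auto
      ultimately show ?thesis by blast
    qed
  qed
qed

text \<open>This includes a gap \<open>i = Suc b0\<close> directly to the right of the block, whose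
  left interface is excluded in \<open>outside_small\<close>.\<close>

lemma outside_gap_small:
  assumes unique: "\<forall>a b A B. maximal_interval I a b \<longrightarrow> chain t \<mu> a b A B \<longrightarrow>
      chain_closed b A B \<longrightarrow> (a, b) = (a0, b0)"
    and i: "i \<in> {1..2 * N - 1}" "even i" "i \<notin> {a0..b0}"
  shows "(\<lambda>p. W p i) \<in> O[F](G)"
  using other_block_small(2)[OF unique, of i i] even_non(1)[of i] i by (cases "i \<in> I") auto

end

section \<open>Trigonometric estimates\<close>

text \<open>Bounding \<open>exp 1\<close> by 3 is the source of the constants below: 3 in the Taylor
  remainders, 6 after the addition theorems combine two of them, and 7 in
  \<open>uniform_trig\<close>, where a value of modulus at most 1 is added.\<close>

lemma exp_abs_Im_le:
  assumes "norm z \<le> 1"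
  shows "exp \<bar>Im z\<bar> \<le> 3"
proof -
  have "exp \<bar>Im z\<bar> \<le> exp 1" using abs_Im_le_cmod[of z] assms by simp
  then show ?thesis using exp_le by linarith
qed

lemma norm_sin_minus_id_le:
  fixes z :: complex
  assumes "norm z \<le> 1"
  shows "norm (sin z - z) \<le> 3 * norm z ^ 2"
proof -
  have "norm (sin z - z) \<le> exp \<bar>Im z\<bar> * norm z ^ 2"
    using Taylor_sin[of z 1] by (simp add: sin_coeff_def numeral_2_eq_2)
  also have "exp \<bar>Im z\<bar> * norm z ^ 2 \<le> 3 * norm z ^ 2"
    by (intro mult_right_mono exp_abs_Im_le assms) simp
  finally show ?thesis .
qed

lemma norm_sin_le_of_small:
  fixes z :: complex
  assumes "norm z \<le> 1"
  shows "norm (sin z) \<le> 3 * norm z"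
proof -
  have "norm (sin z) \<le> exp \<bar>Im z\<bar> * norm z"
    using Taylor_sin[of z 0] by (simp add: sin_coeff_def)
  also have "exp \<bar>Im z\<bar> * norm z \<le> 3 * norm z"
    by (intro mult_right_mono exp_abs_Im_le assms) simp
  finally show ?thesis .
qed

lemma norm_cos_minus_one_le:
  fixes z :: complex
  assumes "norm z \<le> 1"
  shows "norm (cos z - 1) \<le> 3 * norm z"
proof -
  have "norm (cos z - 1) \<le> exp \<bar>Im z\<bar> * norm z"
    using Taylor_cos[of z 0] by (simp add: cos_coeff_def)
  also have "exp \<bar>Im z\<bar> * norm z \<le> 3 * norm z"
    by (intro mult_right_mono exp_abs_Im_le assms) simp
  finally show ?thesis .
qed

lemma norm_sin_cos_perturb:
  fixes z :: complex and a :: real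
  assumes "norm z \<le> 1"
  shows "norm (sin (of_real a + z) - of_real (sin a)) \<le> 6 * norm z"
    and "norm (cos (of_real a + z) - of_real (cos a)) \<le> 6 * norm z"
proof -
  let ?s = "complex_of_real (sin a)" and ?c = "complex_of_real (cos a)"
  have sc: "norm ?s \<le> 1" "norm ?c \<le> 1" by simp_all
  have bound: "norm (p * (cos z - 1) + q * sin z) \<le> 6 * norm z" if "norm p \<le> 1" "norm q \<le> 1" for p q
  proof -
    have "norm (p * (cos z - 1) + q * sin z) \<le> norm p * norm (cos z - 1) + norm q * norm (sin z)"
      by (metis norm_mult norm_triangle_ineq)
    also have "\<dots> \<le> 1 * (3 * norm z) + 1 * (3 * norm z)"
      by (intro add_mono mult_mono norm_cos_minus_one_le norm_sin_le_of_small assms that) auto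
    finally show ?thesis by simp
  qed
  have "sin (of_real a + z) - ?s = ?s * (cos z - 1) + ?c * sin z"
    by (simp add: sin_add sin_of_real cos_of_real algebra_simps)
  then show "norm (sin (of_real a + z) - ?s) \<le> 6 * norm z" using bound[OF sc] by simp
  have "cos (of_real a + z) - ?c = ?c * (cos z - 1) + (- ?s) * sin z"
    by (simp add: cos_add sin_of_real cos_of_real algebra_simps)
  then show "norm (cos (of_real a + z) - ?c) \<le> 6 * norm z" using bound[of ?c "- ?s"] sc by simp
qed

context
  fixes F :: "'p filter" and \<kappa> e :: "'p \<Rightarrow> complex" and \<mu> :: complex
  assumes e0: "(e \<longlongrightarrow> 0) F" and e_nz: "\<forall>\<^sub>F p in F. e p \<noteq> 0"
    and \<kappa>: "(\<lambda>p. \<kappa> p - \<mu> * e p) \<in> O[F](\<lambda>p. e p ^ 2)"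
begin

lemma e_square_bigo: "(\<lambda>p. e p ^ 2) \<in> O[F](e)"
proof -
  have "e \<in> O[F](\<lambda>_. 1)" by (rule bigoI_tendsto[of _ _ 0]) (use e0 in simp_all)
  then have "(\<lambda>p. e p * e p) \<in> O[F](\<lambda>p. 1 * e p)" by (intro landau_o.big_mult) simp_all
  then show ?thesis by (simp add: power2_eq_square)
qed

lemma shift_bigo: "\<kappa> \<in> O[F](e)"
proof -
  have "(\<lambda>p. (\<kappa> p - \<mu> * e p) + \<mu> * e p) \<in> O[F](e)"
    by (intro sum_in_bigo landau_o.big_trans[OF \<kappa> e_square_bigo]) (cases "\<mu> = 0"; simp)
  then show ?thesis by simp
qed

lemma shift_tendsto: "(\<kappa> \<longlongrightarrow> 0) F"
proof -
  have "e \<in> o[F](\<lambda>_. 1)" using e0 by (intro smalloI_tendsto) simp_all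
  then have "\<kappa> \<in> o[F](\<lambda>_. 1)" using shift_bigo landau_o.big_small_trans by blast
  then show ?thesis using smalloD_tendsto by fastforce
qed

lemma shift_small: "\<forall>\<^sub>F p in F. norm (\<kappa> p) * T \<le> 1"
proof -
  have "((\<lambda>p. norm (\<kappa> p) * T) \<longlongrightarrow> norm (0::complex) * T) F"
    by (intro tendsto_intros shift_tendsto)
  then have "\<forall>\<^sub>F p in F. norm (\<kappa> p) * T < 1" by (rule order_tendstoD(2)) simp
  then show ?thesis by (rule eventually_mono) simp
qed

lemma trig_shift_bigo:
  fixes a T :: real
  shows "(\<lambda>p. sin (of_real a + \<kappa> p * of_real T) - of_real (sin a)) \<in> O[F](e)"
    and "(\<lambda>p. cos (of_real a + \<kappa> p * of_real T) - of_real (cos a)) \<in> O[F](e)"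
proof -
  have ev: "\<forall>\<^sub>F p in F. norm (\<kappa> p * of_real T) \<le> 1"
    using shift_small[of "\<bar>T\<bar>"] by (simp add: norm_mult)
  have "(\<lambda>p. sin (of_real a + \<kappa> p * of_real T) - of_real (sin a)) \<in> O[F](\<kappa>)"
    by (rule bigoI[of _ "6 * \<bar>T\<bar>"], rule eventually_mono[OF ev])
      (use norm_sin_cos_perturb(1) in \<open>fastforce simp: norm_mult mult_ac\<close>)
  then show "(\<lambda>p. sin (of_real a + \<kappa> p * of_real T) - of_real (sin a)) \<in> O[F](e)"
    using shift_bigo landau_o.big_trans by blast
  have "(\<lambda>p. cos (of_real a + \<kappa> p * of_real T) - of_real (cos a)) \<in> O[F](\<kappa>)"
    by (rule bigoI[of _ "6 * \<bar>T\<bar>"], rule eventually_mono[OF ev])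
      (use norm_sin_cos_perturb(2) in \<open>fastforce simp: norm_mult mult_ac\<close>)
  then show "(\<lambda>p. cos (of_real a + \<kappa> p * of_real T) - of_real (cos a)) \<in> O[F](e)"
    using shift_bigo landau_o.big_trans by blast
qed

text \<open>Where \<open>sin a\<close> vanishes, the addition theorem leaves \<open>cos a\<close>
  times the sine of the shift, which is \<open>T * \<mu> * e\<close> up to order \<open>e\<close>
  squared. Division by \<open>e\<close> costs one order.\<close>

lemma sin_quotient_bigo:
  fixes a T :: real
  assumes "sin a = 0"
  shows "(\<lambda>p. sin (of_real a + \<kappa> p * of_real T) / e p
    - of_real (cos a) * (of_real T * \<mu>)) \<in> O[F](e)"
proof -
  have ev: "\<forall>\<^sub>F p in F. norm (\<kappa> p * of_real T) \<le> 1"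
    using shift_small[of "\<bar>T\<bar>"] by (simp add: norm_mult)
  have "(\<lambda>p. sin (\<kappa> p * of_real T) - \<kappa> p * of_real T) \<in> O[F](\<lambda>p. \<kappa> p ^ 2)"
    by (rule bigoI[of _ "3 * T\<^sup>2"], rule eventually_mono[OF ev])
      (use norm_sin_minus_id_le in \<open>fastforce simp: norm_mult norm_power power_mult_distrib mult_ac\<close>)
  also have "(\<lambda>p. \<kappa> p ^ 2) \<in> O[F](\<lambda>p. e p ^ 2)" 
    unfolding power2_eq_square by (rule landau_o.big_mult[OF shift_bigo shift_bigo])
  finally have 1: "(\<lambda>p. sin (\<kappa> p * of_real T) - \<kappa> p * of_real T) \<in> O[F](\<lambda>p. e p ^ 2)" .
  have "(\<lambda>p. of_real (cos a) * ((sin (\<kappa> p * of_real T) - \<kappa> p * of_real T)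
      + of_real T * (\<kappa> p - \<mu> * e p))) \<in> O[F](\<lambda>p. e p ^ 2)"
    by (intro cmult_in_bigo sum_in_bigo 1 \<kappa>)
  moreover have "of_real (cos a) * ((sin (\<kappa> p * of_real T) - \<kappa> p * of_real T)
      + of_real T * (\<kappa> p - \<mu> * e p))
    = sin (of_real a + \<kappa> p * of_real T) - of_real (cos a) * (of_real T * \<mu>) * e p" for p
    using assms by (simp add: sin_add sin_of_real cos_of_real algebra_simps)
  ultimately have "(\<lambda>p. sin (of_real a + \<kappa> p * of_real T) - of_real (cos a) * (of_real T * \<mu>) * e p)
      \<in> O[F](\<lambda>p. e p ^ 2)"
    by simp
  then have "(\<lambda>p. (sin (of_real a + \<kappa> p * of_real T)
    - of_real (cos a) * (of_real T * \<mu>) * e p) / e p)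
      \<in> O[F](\<lambda>p. e p ^ 2 / e p)"
    using e_nz by (intro landau_o.big.divide_right) auto
  then show ?thesis
    by (rule landau_o.big.cong_ex[THEN iffD1, rotated 2])
      (use e_nz in \<open>auto elim!: eventually_mono simp: field_simps power2_eq_square\<close>)
qed

end

section \<open>Rescaled interface data\<close>

lemma bigo_eventually_eq:
  assumes "g \<in> O[F](h)" "\<forall>\<^sub>F p in F. f p = g p"
  shows "f \<in> O[F](h)"
  using landau_o.big.in_cong[OF assms(2)] assms(1) by blast

lemma interface_dataD:
  assumes "interface_data N x k \<delta> u w" "i \<in> {1..2 * N - 1}"
  shows "y \<in> {x i<..<x (Suc i)} \<Longrightarrow> u y = u (x i) * cos (k * of_real (y - x i))
      + (if odd i then \<delta> else 1) * w i * sin (k * of_real (y - x i))"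
    and "u (x (Suc i)) = u (x i) * cos (k * of_real (x (Suc i) - x i))
      + (if odd i then \<delta> else 1) * w i * sin (k * of_real (x (Suc i) - x i))"
    and "(if odd i then \<delta> else 1) * w (Suc i) =
      (if odd i then \<delta> else 1) * w i * cos (k * of_real (x (Suc i) - x i))
      - u (x i) * sin (k * of_real (x (Suc i) - x i))"
  using assms unfolding interface_data_def Let_def by blast+

lemma sqrt_branch_nonzero:
  fixes e :: "complex \<Rightarrow> complex"
  assumes "\<And>\<delta>. e \<delta> ^ 2 = \<delta>"
  shows "\<forall>\<^sub>F \<delta> in at 0. e \<delta> \<noteq> 0"
proof -
  have "\<forall>\<^sub>F \<delta> in at (0::complex). \<delta> \<noteq> 0" by (simp add: eventually_at_filter)
  then show ?thesis by (rule eventually_mono) (metis assms zero_power2)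
qed

lemma sqrt_branch_norm:
  fixes e :: "complex \<Rightarrow> complex"
  assumes "\<And>\<delta>. e \<delta> ^ 2 = \<delta>"
  shows "norm (e \<delta>) = sqrt (norm \<delta>)"
  using assms[of \<delta>] by (metis norm_ge_zero norm_power real_sqrt_unique)

text \<open>A branch of the square root need not be continuous; the limit is read off from its
  modulus, which the square determines.\<close>

lemma sqrt_branch_tendsto:
  fixes e :: "complex \<Rightarrow> complex"
  assumes "\<And>\<delta>. e \<delta> ^ 2 = \<delta>"
  shows "(e \<longlongrightarrow> 0) (at 0)"
proof -
  have "((\<lambda>\<delta>::complex. sqrt (norm \<delta>)) \<longlongrightarrow> sqrt (norm (0::complex))) (at 0)"
    by (rule tendsto_real_sqrt[OF tendsto_norm[OF tendsto_ident_at]])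
  then show ?thesis by (simp add: sqrt_branch_norm[of e, OF assms] flip: tendsto_norm_zero_iff[of e])
qed

locale resonance =
  fixes N :: nat and x :: "nat \<Rightarrow> real" and k0 :: real and \<mu> :: complex
    and \<kappa> e :: "complex \<Rightarrow> complex" and u :: "complex \<Rightarrow> real \<Rightarrow> complex"
    and w :: "complex \<Rightarrow> nat \<Rightarrow> complex"
  assumes N: "1 \<le> N" and e_square: "\<And>\<delta>. e \<delta> ^ 2 = \<delta>"
    and \<kappa>: "(\<lambda>\<delta>. \<kappa> \<delta> - \<mu> * e \<delta>) \<in> O[at 0](\<lambda>\<delta>. e \<delta> ^ 2)"
    and data: "\<forall>\<^sub>F \<delta> in at 0. interface_data N x (of_real k0 + \<kappa> \<delta>) \<delta> (u \<delta>) (w \<delta>)"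
begin

definition len :: "nat \<Rightarrow> real" where "len i = x (Suc i) - x i"
definition critical :: "nat set" where "critical = {i \<in> {1..2 * N - 1}. sin (k0 * len i) = 0}"
definition U :: "complex \<Rightarrow> nat \<Rightarrow> complex" where "U \<delta> i = u \<delta> (x i) / e \<delta>"
text \<open>The total size of the data, placed in \<open>complex\<close> because both sides of a
  Landau relation have the same type.\<close>

definition M :: "complex \<Rightarrow> complex" where
  "M \<delta> = of_real (\<Sum>j\<in>{1..2 * N}. norm (U \<delta> j) + norm (w \<delta> j))"
definition C :: "nat \<Rightarrow> complex \<Rightarrow> complex" where "C i \<delta> = cos ((of_real k0 + \<kappa> \<delta>) * of_real (len i))"
definition S :: "nat \<Rightarrow> complex \<Rightarrow> complex" where "S i \<delta> = sin ((of_real k0 + \<kappa> \<delta>) * of_real (len i))"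

lemmas e_nonzero = sqrt_branch_nonzero[OF e_square]
  and norm_e = sqrt_branch_norm[OF e_square]
  and e_tendsto = sqrt_branch_tendsto[OF e_square]

lemmas shift = shift_bigo[OF e_tendsto e_nonzero \<kappa>]
  and shift_le = shift_small[OF e_tendsto e_nonzero \<kappa>]

lemma e_bigo_1: "e \<in> O[at 0](\<lambda>_. 1)"
  by (rule bigoI_tendsto[of _ _ 0]) (use e_tendsto in simp_all)

lemma CS_eq:
  "C i \<delta> = cos (of_real (k0 * len i) + \<kappa> \<delta> * of_real (len i))"
  "S i \<delta> = sin (of_real (k0 * len i) + \<kappa> \<delta> * of_real (len i))"
  by (simp_all add: C_def S_def algebra_simps)

lemma C_bigo: "(\<lambda>\<delta>. C i \<delta> - of_real (cos (k0 * len i))) \<in> O[at 0](e)"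
  and S_bigo: "(\<lambda>\<delta>. S i \<delta> - of_real (sin (k0 * len i))) \<in> O[at 0](e)"
  unfolding CS_eq by (rule trig_shift_bigo[OF e_tendsto e_nonzero \<kappa>])+

lemma S_quotient_bigo:
  "i \<in> critical \<Longrightarrow>
    (\<lambda>\<delta>. S i \<delta> / e \<delta> - of_real (cos (k0 * len i)) * (of_real (len i) * \<mu>)) \<in> O[at 0](e)"
  unfolding CS_eq by (rule sin_quotient_bigo[OF e_tendsto e_nonzero \<kappa>]) (simp add: critical_def)

lemma CS_bigo_1: "C i \<in> O[at 0](\<lambda>_. 1)" "S i \<in> O[at 0](\<lambda>_. 1)"
proof -
  have "(\<lambda>\<delta>. (C i \<delta> - of_real (cos (k0 * len i))) + of_real (cos (k0 * len i))) \<in> O[at 0](\<lambda>_. 1)"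
    by (rule sum_in_bigo(1)[OF landau_o.big_trans[OF C_bigo e_bigo_1]]) simp
  then show "C i \<in> O[at 0](\<lambda>_. 1)" by simp
  have "(\<lambda>\<delta>. (S i \<delta> - of_real (sin (k0 * len i))) + of_real (sin (k0 * len i))) \<in> O[at 0](\<lambda>_. 1)"
    by (rule sum_in_bigo(1)[OF landau_o.big_trans[OF S_bigo e_bigo_1]]) simp
  then show "S i \<in> O[at 0](\<lambda>_. 1)" by simp
qed

lemma S_nonzero:
  assumes "i \<in> {1..2 * N - 1} - critical"
  shows "\<forall>\<^sub>F \<delta> in at 0. S i \<delta> \<noteq> 0" "(\<lambda>\<delta>. inverse (S i \<delta>)) \<in> O[at 0](\<lambda>_. 1)"
proof -
  let ?s = "complex_of_real (sin (k0 * len i))"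
  have nz: "?s \<noteq> 0" using assms by (simp add: critical_def)
  have "e \<in> o[at 0](\<lambda>_. 1)" using e_tendsto by (intro smalloI_tendsto) simp_all
  then have "(\<lambda>\<delta>. S i \<delta> - ?s) \<in> o[at 0](\<lambda>_. 1)"
    using S_bigo landau_o.big_small_trans by blast
  then have "((\<lambda>\<delta>. S i \<delta> - ?s) \<longlongrightarrow> 0) (at 0)" using smalloD_tendsto by fastforce
  then have lim: "(S i \<longlongrightarrow> ?s) (at 0)" by (rule LIM_zero_cancel)
  then show "\<forall>\<^sub>F \<delta> in at 0. S i \<delta> \<noteq> 0" using nz by (rule tendsto_imp_eventually_ne)
  show "(\<lambda>\<delta>. inverse (S i \<delta>)) \<in> O[at 0](\<lambda>_. 1)"
    by (rule bigoI_tendsto[of _ _ "inverse ?s"]) (use tendsto_inverse[OF lim nz] in simp_all)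
qed

lemma component_bigo:
  assumes "j \<in> {1..2 * N}"
  shows "(\<lambda>\<delta>. U \<delta> j) \<in> O[at 0](M)" "(\<lambda>\<delta>. w \<delta> j) \<in> O[at 0](M)"
proof -
  have le: "norm (U \<delta> j) + norm (w \<delta> j) \<le> norm (M \<delta>)" for \<delta>
  proof -
    have "norm (U \<delta> j) + norm (w \<delta> j) \<le> (\<Sum>j\<in>{1..2 * N}. norm (U \<delta> j) + norm (w \<delta> j))"
      using assms by (intro member_le_sum) auto
    then show ?thesis unfolding M_def norm_of_real by linarith
  qed
  show "(\<lambda>\<delta>. U \<delta> j) \<in> O[at 0](M)"
    by (rule bigoI[of _ 1]) (use le in \<open>auto intro!: always_eventually intro: order_trans[OF _ le]\<close>)
  show "(\<lambda>\<delta>. w \<delta> j) \<in> O[at 0](M)"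
    by (rule bigoI[of _ 1]) (use le in \<open>auto intro!: always_eventually intro: order_trans[OF _ le]\<close>)
qed

lemma recurrence_even:
  assumes "i \<in> {1..2 * N - 1}" "even i"
  shows "\<forall>\<^sub>F \<delta> in at 0. U \<delta> (Suc i) = U \<delta> i * C i \<delta> + w \<delta> i * (S i \<delta> / e \<delta>)"
    and "\<forall>\<^sub>F \<delta> in at 0. w \<delta> (Suc i) = w \<delta> i * C i \<delta> - e \<delta> * (U \<delta> i * S i \<delta>)"
proof -
  have *: "\<forall>\<^sub>F \<delta> in at 0. u \<delta> (x (Suc i)) = u \<delta> (x i) * C i \<delta> + w \<delta> i * S i \<delta> \<and>
      w \<delta> (Suc i) = w \<delta> i * C i \<delta> - u \<delta> (x i) * S i \<delta>"
    using data
  proof eventually_elim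
    case (elim \<delta>)
    then show ?case
      using interface_dataD(2,3)[OF elim assms(1)] assms(2) by (simp add: C_def S_def len_def)
  qed
  from * e_nonzero show "\<forall>\<^sub>F \<delta> in at 0. U \<delta> (Suc i) = U \<delta> i * C i \<delta> + w \<delta> i * (S i \<delta> / e \<delta>)"
    by eventually_elim (simp add: U_def field_simps)
  from * e_nonzero show "\<forall>\<^sub>F \<delta> in at 0. w \<delta> (Suc i) = w \<delta> i * C i \<delta> - e \<delta> * (U \<delta> i * S i \<delta>)"
    by eventually_elim (simp add: U_def)
qed

lemma recurrence_odd:
  assumes "i \<in> {1..2 * N - 1}" "odd i"
  shows "\<forall>\<^sub>F \<delta> in at 0. U \<delta> (Suc i) = U \<delta> i * C i \<delta> + e \<delta> * (w \<delta> i * S i \<delta>)"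
    and "\<forall>\<^sub>F \<delta> in at 0. w \<delta> (Suc i) = w \<delta> i * C i \<delta> - U \<delta> i * (S i \<delta> / e \<delta>)"
proof -
  have *: "\<forall>\<^sub>F \<delta> in at 0. u \<delta> (x (Suc i)) = u \<delta> (x i) * C i \<delta> + e \<delta> ^ 2 * w \<delta> i * S i \<delta> \<and>
      e \<delta> ^ 2 * w \<delta> (Suc i) = e \<delta> ^ 2 * w \<delta> i * C i \<delta> - u \<delta> (x i) * S i \<delta>"
    using data
  proof eventually_elim
    case (elim \<delta>)
    then show ?case
      using interface_dataD(2,3)[OF elim assms(1)] assms(2)
      by (simp add: C_def S_def len_def e_square)
  qed
  from * e_nonzero show "\<forall>\<^sub>F \<delta> in at 0. U \<delta> (Suc i) = U \<delta> i * C i \<delta> + e \<delta> * (w \<delta> i * S i \<delta>)"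
    by eventually_elim (simp add: U_def field_simps power2_eq_square)
  from * e_nonzero show "\<forall>\<^sub>F \<delta> in at 0. w \<delta> (Suc i) = w \<delta> i * C i \<delta> - U \<delta> i * (S i \<delta> / e \<delta>)"
  proof eventually_elim
    case (elim \<delta>)
    have "e \<delta> ^ 2 * (w \<delta> i * C i \<delta> - U \<delta> i * (S i \<delta> / e \<delta>)) =
        e \<delta> ^ 2 * w \<delta> i * C i \<delta> - u \<delta> (x i) * S i \<delta>"
      using elim(2) by (simp add: U_def field_simps power2_eq_square)
    then have "e \<delta> ^ 2 * w \<delta> (Suc i) = e \<delta> ^ 2 * (w \<delta> i * C i \<delta> - U \<delta> i * (S i \<delta> / e \<delta>))"
      using elim(1) by (simp only:)
    then show ?case using elim(2) by simp
  qed
qed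

abbreviation G :: "complex \<Rightarrow> complex" where "G \<equiv> \<lambda>\<delta>. e \<delta> * M \<delta>"

lemma e_mult_bigo:
  assumes "f \<in> O[at 0](M)" "g \<in> O[at 0](\<lambda>_. 1)"
  shows "(\<lambda>\<delta>. e \<delta> * (f \<delta> * g \<delta>)) \<in> O[at 0](G)"
  using landau_o.big_mult[OF landau_o.big_refl[of e] landau_o.big_mult[OF assms]] by simp

text \<open>On critical intervals the coefficients are replaced by their limits, each at relative
  cost \<open>e\<close>. On the others the sine stays away from zero, and solving the relation that
  contains \<open>S i \<delta> / e \<delta>\<close> for the unknown it multiplies shows that unknown
  to be \<open>e\<close> times something of size \<open>M\<close>. At the outermost interfaces the
  radiation condition ties \<open>w\<close> to \<open>u\<close>, which is \<open>e\<close> times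
  \<open>U\<close>.\<close>

lemma near_chain:
  "near_chain N (\<lambda>i. of_real (len i)) (\<lambda>i. of_real (cos (k0 * len i))) critical \<mu> (at 0) G U w"
proof
  show "critical \<subseteq> {1..2 * N - 1}" by (auto simp: critical_def)
  show "complex_of_real (cos (k0 * len i)) * complex_of_real (cos (k0 * len i)) =
    1" if "i \<in> critical" for i
    using that sin_cos_squared_add3[of "k0 * len i"]
    by (simp add: critical_def of_real_mult[symmetric] del: of_real_mult)
next
  fix i assume crit: "i \<in> critical"
  let ?c = "complex_of_real (cos (k0 * len i))" and ?t = "complex_of_real (len i)"
  have i: "i \<in> {1..2 * N - 1}" "i \<in> {1..2 * N}" using crit by (auto simp: critical_def)
  note UW = component_bigo[OF i(2)]
  have UC: "(\<lambda>\<delta>. (C i \<delta> - ?c) * U \<delta> i) \<in> O[at 0](G)" "(\<lambda>\<delta>. (C i \<delta> - ?c) * w \<delta> i) \<in> O[at 0](G)"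
    by (intro landau_o.big_mult C_bigo UW)+
  have US: "(\<lambda>\<delta>. (S i \<delta> / e \<delta> - ?c * (?t * \<mu>)) * U \<delta> i) \<in> O[at 0](G)"
    "(\<lambda>\<delta>. (S i \<delta> / e \<delta> - ?c * (?t * \<mu>)) * w \<delta> i) \<in> O[at 0](G)"
    by (intro landau_o.big_mult S_quotient_bigo crit UW)+
  have Ue: "(\<lambda>\<delta>. e \<delta> * (U \<delta> i * S i \<delta>)) \<in> O[at 0](G)" "(\<lambda>\<delta>. e \<delta> * (w \<delta> i * S i \<delta>)) \<in> O[at 0](G)"
    by (intro e_mult_bigo UW CS_bigo_1)+
  {
    assume "even i"
    note rec = recurrence_even[OF i(1) this]
    show "(\<lambda>\<delta>. U \<delta> (Suc i) - ?c * (U \<delta> i + ?t * \<mu> * w \<delta> i)) \<in> O[at 0](G)"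
      by (rule bigo_eventually_eq[OF sum_in_bigo(1)[OF UC(1) US(2)]], rule eventually_mono[OF rec(1)])
        (simp add: algebra_simps)
    show "(\<lambda>\<delta>. w \<delta> (Suc i) - ?c * w \<delta> i) \<in> O[at 0](G)"
      by (rule bigo_eventually_eq[OF sum_in_bigo(2)[OF UC(2) Ue(1)]], rule eventually_mono[OF rec(2)])
        (simp add: algebra_simps)
  next
    assume "odd i"
    note rec = recurrence_odd[OF i(1) this]
    show "(\<lambda>\<delta>. U \<delta> (Suc i) - ?c * U \<delta> i) \<in> O[at 0](G)"
      by (rule bigo_eventually_eq[OF sum_in_bigo(1)[OF UC(1) Ue(2)]], rule eventually_mono[OF rec(1)])
        (simp add: algebra_simps)
    show "(\<lambda>\<delta>. w \<delta> (Suc i) - ?c * (w \<delta> i - ?t * \<mu> * U \<delta> i)) \<in> O[at 0](G)"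
      by (rule bigo_eventually_eq[OF sum_in_bigo(2)[OF UC(2) US(1)]], rule eventually_mono[OF rec(2)])
        (simp add: algebra_simps)
  }
next
  fix i assume non: "i \<in> {1..2 * N - 1} - critical"
  then have i: "i \<in> {1..2 * N - 1}" "i \<in> {1..2 * N}" "Suc i \<in> {1..2 * N}" by auto
  note UW = component_bigo[OF i(2)] and UW' = component_bigo[OF i(3)]
  note S = S_nonzero[OF non]
  have mult1: "(\<lambda>\<delta>. f \<delta> * C i \<delta>) \<in> O[at 0](H)" if "f \<in> O[at 0](H)" for f H
    using landau_o.big_mult[OF that CS_bigo_1(1)] by simp
  {
    assume ev: "even i"
    note rec = recurrence_even[OF i(1) ev]
    have "(\<lambda>\<delta>. e \<delta> * ((U \<delta> (Suc i) - U \<delta> i * C i \<delta>) * inverse (S i \<delta>))) \<in> O[at 0](G)"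
      by (intro e_mult_bigo sum_in_bigo UW UW' mult1 S(2))
    moreover have "\<forall>\<^sub>F \<delta> in at 0. w \<delta> i = e \<delta> * ((U \<delta> (Suc i) - U \<delta> i * C i \<delta>) * inverse (S i \<delta>))"
      using rec(1) S(1) e_nonzero by eventually_elim (simp add: field_simps)
    ultimately show W: "(\<lambda>\<delta>. w \<delta> i) \<in> O[at 0](G)" by (rule bigo_eventually_eq)
    show "(\<lambda>\<delta>. w \<delta> (Suc i)) \<in> O[at 0](G)"
      by (rule bigo_eventually_eq[OF sum_in_bigo(2)[OF mult1[OF W] e_mult_bigo[OF UW(1) CS_bigo_1(2)]] rec(2)])
  next
    assume od: "odd i"
    note rec = recurrence_odd[OF i(1) od]
    have "(\<lambda>\<delta>. e \<delta> * ((w \<delta> i * C i \<delta> - w \<delta> (Suc i)) * inverse (S i \<delta>))) \<in> O[at 0](G)"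
      by (intro e_mult_bigo sum_in_bigo UW UW' mult1 S(2))
    moreover have "\<forall>\<^sub>F \<delta> in at 0. U \<delta> i = e \<delta> * ((w \<delta> i * C i \<delta> - w \<delta> (Suc i)) * inverse (S i \<delta>))"
      using rec(2) S(1) e_nonzero by eventually_elim (simp add: field_simps)
    ultimately show V: "(\<lambda>\<delta>. U \<delta> i) \<in> O[at 0](G)" by (rule bigo_eventually_eq)
    show "(\<lambda>\<delta>. U \<delta> (Suc i)) \<in> O[at 0](G)"
      by (rule bigo_eventually_eq[OF sum_in_bigo(1)[OF mult1[OF V] e_mult_bigo[OF UW(2) CS_bigo_1(2)]] rec(1)])
  }
next
  have ends: "1 \<in> {1..2 * N}" "2 * N \<in> {1..2 * N}" using N by auto
  have one: "(\<lambda>_::complex. z) \<in> O[at 0](\<lambda>_. 1)" for z :: complex by simp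
  show "(\<lambda>\<delta>. w \<delta> 1) \<in> O[at 0](G)"
    by (rule bigo_eventually_eq[OF e_mult_bigo[OF component_bigo(1)[OF ends(1)] one[of "- \<i>"]]])
      (use data e_nonzero in \<open>eventually_elim, simp add: interface_data_def U_def\<close>)
  show "(\<lambda>\<delta>. w \<delta> (2 * N)) \<in> O[at 0](G)"
    by (rule bigo_eventually_eq[OF e_mult_bigo[OF component_bigo(1)[OF ends(2)] one[of "\<i>"]]])
      (use data e_nonzero in \<open>eventually_elim, simp add: interface_data_def U_def\<close>)
qed

end

section \<open>Normalization of the mode\<close>

context resonance
begin

lemma M_nonzero: "\<forall>\<^sub>F \<delta> in at 0. M \<delta> \<noteq> 0"
  using data e_nonzero
proof eventually_elim
  case (elim \<delta>)
  then obtain j where j: "j \<in> {1..2 * N}" "U \<delta> j \<noteq> 0 \<or> w \<delta> j \<noteq> 0"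
    unfolding interface_data_def U_def by auto
  have "0 < norm (U \<delta> j) + norm (w \<delta> j)" using j(2) by (auto simp: add_pos_nonneg add_nonneg_pos)
  also have "\<dots> \<le> (\<Sum>j\<in>{1..2 * N}. norm (U \<delta> j) + norm (w \<delta> j))"
    using j(1) by (intro member_le_sum) auto
  finally show ?case unfolding M_def of_real_eq_0_iff by linarith
qed

text \<open>The difference splits into the cosine term, the error of \<open>Q\<close> times the
  sine, and \<open>q\<close> times the change of the sine under the shift \<open>\<kappa>\<close>.
  Each is of order \<open>e\<close> uniformly in \<open>y\<close>, because \<open>y - x i\<close>
  stays below \<open>len i\<close>.\<close>

lemma uniform_trig:
  assumes P: "P \<in> O[at 0](e)" and Q: "(\<lambda>\<delta>. Q \<delta> - q) \<in> O[at 0](e)"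
    and v: "\<forall>\<^sub>F \<delta> in at 0. \<forall>y\<in>{x i<..<x (Suc i)}.
      v \<delta> y = P \<delta> * cos ((of_real k0 + \<kappa> \<delta>) * of_real (y - x i))
        + Q \<delta> * sin ((of_real k0 + \<kappa> \<delta>) * of_real (y - x i))"
  shows "uniform_bigo {x i<..<x (Suc i)}
    (\<lambda>\<delta> y. v \<delta> y - q * complex_of_real (sin (k0 * (y - x i)))) (1 / 2)"
proof -
  obtain K1 where K1: "K1 > 0" "\<forall>\<^sub>F \<delta> in at 0. norm (P \<delta>) \<le> K1 * norm (e \<delta>)"
    using P by (elim landau_o.bigE)
  obtain K2 where K2: "K2 > 0" "\<forall>\<^sub>F \<delta> in at 0. norm (Q \<delta> - q) \<le> K2 * norm (e \<delta>)"
    using Q by (elim landau_o.bigE)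
  obtain K3 where K3: "K3 > 0" "\<forall>\<^sub>F \<delta> in at 0. norm (\<kappa> \<delta>) \<le> K3 * norm (e \<delta>)"
    using shift by (elim landau_o.bigE)
  let ?L = "len i"
  let ?K = "K1 * 7 + K2 * 7 + norm q * (6 * (K3 * ?L))"
  have "\<forall>\<^sub>F \<delta> in at 0. \<forall>y\<in>{x i<..<x (Suc i)}.
      norm (v \<delta> y - q * complex_of_real (sin (k0 * (y - x i)))) \<le> ?K * norm \<delta> powr (1 / 2)"
    using v K1(2) K2(2) K3(2) shift_le[of ?L]
  proof eventually_elim
    case (elim \<delta>)
    show ?case
    proof
      fix y assume y: "y \<in> {x i<..<x (Suc i)}"
      define s where "s = y - x i"
      define z where "z = \<kappa> \<delta> * of_real s"
      have s: "0 \<le> s" "s \<le> ?L" using y by (auto simp: s_def len_def)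
      have arg: "(of_real k0 + \<kappa> \<delta>) * of_real s = of_real (k0 * s) + z"
        by (simp add: z_def algebra_simps)
      have nz: "norm z \<le> norm (\<kappa> \<delta>) * ?L"
        unfolding z_def norm_mult norm_of_real using s by (intro mult_left_mono) auto
      then have z1: "norm z \<le> 1" using elim(5) by simp
      note pert = norm_sin_cos_perturb[OF z1, of "k0 * s"]
      have sin7: "norm (sin (of_real (k0 * s) + z)) \<le> 7"
      proof -
        have "norm (sin (of_real (k0 * s) + z)) \<le> norm (complex_of_real (sin (k0 * s)))
            + norm (sin (of_real (k0 * s) + z) - of_real (sin (k0 * s)))"
          by (rule norm_triangle_sub)
        also have "\<dots> \<le> 1 + 6 * norm z" using pert(1) by (intro add_mono) simp_all
        finally show ?thesis using z1 by simp
      qed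
      have cos7: "norm (cos (of_real (k0 * s) + z)) \<le> 7"
      proof -
        have "norm (cos (of_real (k0 * s) + z)) \<le> norm (complex_of_real (cos (k0 * s)))
            + norm (cos (of_real (k0 * s) + z) - of_real (cos (k0 * s)))"
          by (rule norm_triangle_sub)
        also have "\<dots> \<le> 1 + 6 * norm z" using pert(2) by (intro add_mono) simp_all
        finally show ?thesis using z1 by simp
      qed
      have "norm z \<le> K3 * norm (e \<delta>) * ?L"
        by (rule order_trans[OF nz]) (use elim(4) s in \<open>intro mult_right_mono, auto\<close>)
      then have diff: "norm (sin (of_real (k0 * s)
        + z) - of_real (sin (k0 * s))) \<le> 6 * (K3 * norm (e \<delta>) * ?L)"
        using pert(1) by linarith
      have vy: "v \<delta> y = P \<delta> * cos (of_real (k0 * s) + z) + Q \<delta> * sin (of_real (k0 * s) + z)"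
        using bspec[OF elim(1) y] unfolding s_def[symmetric] arg .
      have "v \<delta> y - q * of_real (sin (k0 * s)) = P \<delta> * cos (of_real (k0 * s) + z)
          + (Q \<delta> - q) * sin (of_real (k0 * s) + z)
          + q * (sin (of_real (k0 * s) + z) - of_real (sin (k0 * s)))"
        unfolding vy by (simp only: right_diff_distrib left_diff_distrib) simp
      also have "norm \<dots> \<le> norm (P \<delta>) * norm (cos (of_real (k0 * s) + z))
          + norm (Q \<delta> - q) * norm (sin (of_real (k0 * s) + z))
          + norm q * norm (sin (of_real (k0 * s) + z) - of_real (sin (k0 * s)))"
        by (intro norm_triangle_le add_mono) (simp_all add: norm_mult)
      also have "\<dots> \<le> K1 * norm (e \<delta>) * 7 + K2 * norm (e \<delta>) * 7
        + norm q * (6 * (K3 * norm (e \<delta>) * ?L))"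
        by (intro add_mono mult_mono elim sin7 cos7 diff) (use K1 K2 in auto)
      also have "\<dots> = ?K * norm (e \<delta>)" by (simp add: algebra_simps)
      also have "norm (e \<delta>) = norm \<delta> powr (1 / 2)" by (simp add: norm_e powr_half_sqrt)
      finally show "norm (v \<delta> y - q * complex_of_real (sin (k0 * (y
        - x i)))) \<le> ?K * norm \<delta> powr (1 / 2)"
        unfolding s_def .
    qed
  qed
  then show ?thesis unfolding uniform_bigo_def by blast
qed

text \<open>On critical lengths the sine vanishes, so cosines multiply along the block. The phase of
  every gap can thus be counted from \<open>x a\<close> at the price of the accumulated
  sign.\<close>

lemma sin_block_shift:
  assumes "{a..b} \<subseteq> critical" "a \<le> i" "i \<le> Suc b"
  shows "sin (k0 * (x i - x a)) = 0 \<and> cos (k0 * (x i - x a)) = (\<Prod>j\<in>{a..<i}. cos (k0 * len j))"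
  using assms(2,3)
proof (induction i rule: dec_induct)
  case (step i)
  then have "i \<in> critical" using assms(1) by auto
  then have "sin (k0 * len i) = 0" by (simp add: critical_def)
  moreover have "k0 * (x (Suc i) - x a) = k0 * (x i - x a) + k0 * len i"
    by (simp add: len_def algebra_simps)
  ultimately show ?case using step by (simp add: sin_add cos_add)
qed simp

section \<open>Normalization by the free parameter of the distinguished block\<close>

context
  fixes a b :: nat and A B :: "nat \<Rightarrow> complex"
  assumes mi: "maximal_interval critical a b"
    and ch: "chain (\<lambda>i. of_real (len i)) \<mu> a b A B"
    and unique: "\<forall>a' b' A B. maximal_interval critical a' b' \<longrightarrow>
      chain (\<lambda>i. of_real (len i)) \<mu> a' b' A B \<longrightarrow> chain_closed b' A B \<longrightarrow> (a', b') = (a, b)"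
begin

interpretation nc: near_chain N "\<lambda>i. of_real (len i)"
  "\<lambda>i. of_real (cos (k0 * len i))" critical \<mu> "at 0" G U w
  by (rule near_chain)

private abbreviation (input) "f \<equiv> nc.lead a"
private definition "sg i = (\<Prod>j\<in>{a..<i}. complex_of_real (cos (k0 * len j)))"

private lemma block_bounds: "{a..b} \<subseteq> critical" "1 \<le> a" "a \<le> b" "b \<le> 2 * N - 1"
proof -
  note d = maximal_intervalD[OF mi nc.zero_notin_I]
  show "{a..b} \<subseteq> critical" "1 \<le> a" "a \<le> b" using d by auto
  have "b \<in> critical" using d(2,3) by auto
  then show "b \<le> 2 * N - 1" using nc.I by auto
qed

private lemma sg_square: "a \<le> i \<Longrightarrow> i \<le> Suc b \<Longrightarrow> sg i * sg i = 1"
  unfolding sg_def using nc.prod_signs[OF block_bounds(1)] by simp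

private lemma approx:
  assumes "a \<le> i" "i \<le> Suc b"
  shows "(\<lambda>\<delta>. sg i * U \<delta> i - f \<delta> * A i) \<in> O[at 0](G)" "(\<lambda>\<delta>. sg i * w \<delta> i - f \<delta> * B i) \<in> O[at 0](G)"
  using nc.block_approx[OF mi ch assms] unfolding sg_def by auto

text \<open>The total size \<open>M\<close> is at most a multiple of \<open>f + e M\<close>, and the second term is absorbed as
  \<open>e\<close> tends to 0.\<close>

private lemma M_bigo_lead: "M \<in> O[at 0](f)"
proof -
  \<comment> \<open>A single majorant for \<open>f\<close> and the error scale \<open>G\<close>, so
    that all components lie in one Landau class and can be summed there.\<close>
  let ?H = "\<lambda>\<delta>. complex_of_real (norm (f \<delta>) + norm (G \<delta>))"
  have fH: "f \<in> O[at 0](?H)" and GH: "G \<in> O[at 0](?H)"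
    by (rule bigoI[of _ 1], rule always_eventually, simp del: of_real_add)+
  have UwH: "(\<lambda>\<delta>. U \<delta> j) \<in> O[at 0](?H)" "(\<lambda>\<delta>. w \<delta> j) \<in> O[at 0](?H)" if j: "j \<in> {1..2 * N}" for j
  proof -
    have "(\<lambda>\<delta>. U \<delta> j) \<in> O[at 0](?H) \<and> (\<lambda>\<delta>. w \<delta> j) \<in> O[at 0](?H)"
    proof (cases "j \<in> {a..Suc b}")
      case True
      then have j: "a \<le> j" "j \<le> Suc b" by auto
      have fz: "(\<lambda>\<delta>. f \<delta> * z) \<in> O[at 0](?H)" for z
        using cmult_in_bigo[OF fH, of z] by (simp only: mult.commute)
      have "(\<lambda>\<delta>. sg j * ((sg j * U \<delta> j - f \<delta> * A j) + f \<delta> * A j)) \<in> O[at 0](?H)"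
        by (rule cmult_in_bigo[OF sum_in_bigo(1)[OF landau_o.big_trans[OF approx(1)[OF j] GH] fz]])
      moreover have "(\<lambda>\<delta>. sg j * ((sg j * w \<delta> j - f \<delta> * B j) + f \<delta> * B j)) \<in> O[at 0](?H)"
        by (rule cmult_in_bigo[OF sum_in_bigo(1)[OF landau_o.big_trans[OF approx(2)[OF j] GH] fz]])
      moreover have "sg j * (sg j * z) = z" for z using sg_square[OF j] by (metis mult.assoc mult_1)
      ultimately show ?thesis by (simp only: diff_add_cancel)
    next
      case False
      then show ?thesis
        using nc.outside_small[OF unique j] landau_o.big_trans[OF _ GH] by blast
    qed
    then show "(\<lambda>\<delta>. U \<delta> j) \<in> O[at 0](?H)" "(\<lambda>\<delta>. w \<delta> j) \<in> O[at 0](?H)" by auto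
  qed
  have norm_big: "(\<lambda>\<delta>. complex_of_real (norm (g \<delta>))) \<in> O[at 0](?H)" if "g \<in> O[at 0](?H)" for g
    using that by (subst landau_o.big.norm_iff[symmetric]) simp
  have "(\<lambda>\<delta>. \<Sum>j\<in>{1..2 * N}. complex_of_real (norm (U \<delta> j))
    + complex_of_real (norm (w \<delta> j))) \<in> O[at 0](?H)"
    by (intro big_sum_in_bigo sum_in_bigo norm_big UwH)
  then have "M \<in> O[at 0](?H)" unfolding M_def by simp
  then obtain K where K: "K > 0" "\<forall>\<^sub>F \<delta> in at 0. norm (M \<delta>) \<le> K * norm (?H \<delta>)"
    by (elim landau_o.bigE)
  have "((\<lambda>\<delta>. K * norm (e \<delta>)) \<longlongrightarrow> K * norm (0::complex)) (at 0)"
    by (intro tendsto_intros e_tendsto)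
  then have "\<forall>\<^sub>F \<delta> in at 0. K * norm (e \<delta>) < 1 / 2" by (rule order_tendstoD(2)) simp
  with K(2) have "\<forall>\<^sub>F \<delta> in at 0. norm (M \<delta>) \<le> 2 * K * norm (f \<delta>)"
  proof eventually_elim
    case (elim \<delta>)
    have "norm (?H \<delta>) = norm (f \<delta>) + norm (e \<delta>) * norm (M \<delta>)"
      unfolding norm_of_real by (simp add: norm_mult)
    then have "norm (M \<delta>) \<le> K * norm (f \<delta>) + K * norm (e \<delta>) * norm (M \<delta>)"
      using elim(1) by (simp add: algebra_simps)
    also have "K * norm (e \<delta>) * norm (M \<delta>) \<le> 1 / 2 * norm (M \<delta>)"
      using elim(2) by (intro mult_right_mono) auto
    finally show ?case by simp
  qed
  then show ?thesis by (rule bigoI)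
qed

private lemma lead_nonzero: "\<forall>\<^sub>F \<delta> in at 0. f \<delta> \<noteq> 0"
proof -
  obtain K where "\<forall>\<^sub>F \<delta> in at 0. norm (M \<delta>) \<le> K * norm (f \<delta>)"
    using M_bigo_lead by (elim landau_o.bigE)
  with M_nonzero show ?thesis by eventually_elim auto
qed

text \<open>The factor has to be nonzero for every \<delta>, while \<open>f\<close> is known to be
  nonzero only near 0; the value 1 covers the rest.\<close>

private definition "cf \<delta> = (if f \<delta> = 0 then 1 else 1 / f \<delta>)"

private lemma cf_nonzero: "cf \<delta> \<noteq> 0"
  by (simp add: cf_def)

private lemma cf_lead: "\<forall>\<^sub>F \<delta> in at 0. cf \<delta> * f \<delta> = 1"
  using lead_nonzero by eventually_elim (simp add: cf_def)

private lemma cf_M: "g \<in> O[at 0](M) \<Longrightarrow> (\<lambda>\<delta>. cf \<delta> * g \<delta>) \<in> O[at 0](\<lambda>_. 1)"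
proof -
  assume "g \<in> O[at 0](M)"
  then have "(\<lambda>\<delta>. cf \<delta> * g \<delta>) \<in> O[at 0](\<lambda>\<delta>. cf \<delta> * f \<delta>)"
    using landau_o.big_mult[OF landau_o.big_refl] landau_o.big_trans[OF _ M_bigo_lead] by blast
  then show ?thesis using landau_o.big.cong[OF cf_lead] by blast
qed

private lemma cf_G: "g \<in> O[at 0](G) \<Longrightarrow> (\<lambda>\<delta>. cf \<delta> * g \<delta>) \<in> O[at 0](e)"
proof -
  assume g: "g \<in> O[at 0](G)"
  have "G \<in> O[at 0](\<lambda>\<delta>. e \<delta> * f \<delta>)" by (rule landau_o.big_mult[OF landau_o.big_refl M_bigo_lead])
  then have "(\<lambda>\<delta>. cf \<delta> * g \<delta>) \<in> O[at 0](\<lambda>\<delta>. cf \<delta> * (e \<delta> * f \<delta>))"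
    using landau_o.big_mult[OF landau_o.big_refl] landau_o.big_trans[OF g] by blast
  moreover have ev: "\<forall>\<^sub>F \<delta> in at 0. cf \<delta> * (e \<delta> * f \<delta>) = e \<delta>"
    using cf_lead by eventually_elim (simp only: mult.left_commute mult_1_right)
  ultimately show ?thesis using landau_o.big.cong[OF ev] by blast
qed

private lemma mode_form:
  assumes i: "i \<in> {1..2 * N - 1}"
  shows "\<forall>\<^sub>F \<delta> in at 0. \<forall>y\<in>{x i<..<x (Suc i)}. cf \<delta> * u \<delta> y =
      (e \<delta> * (cf \<delta> * U \<delta> i)) * cos ((of_real k0 + \<kappa> \<delta>) * of_real (y - x i))
      + ((if odd i then e \<delta> * e \<delta> else 1) * (cf \<delta> * w \<delta> i)) * sin ((of_real k0
        + \<kappa> \<delta>) * of_real (y - x i))"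
  using data e_nonzero
proof eventually_elim
  case (elim \<delta>)
  show ?case
  proof
    fix y assume y: "y \<in> {x i<..<x (Suc i)}"
    have "(if odd i then e \<delta> * e \<delta> else 1) = (if odd i then \<delta> else 1)"
      using e_square[of \<delta>] by (simp add: power2_eq_square)
    then show "cf \<delta> * u \<delta> y =
      (e \<delta> * (cf \<delta> * U \<delta> i)) * cos ((of_real k0 + \<kappa> \<delta>) * of_real (y - x i))
      + ((if odd i then e \<delta> * e \<delta> else 1) * (cf \<delta> * w \<delta> i)) * sin ((of_real k0
        + \<kappa> \<delta>) * of_real (y - x i))"
      unfolding interface_dataD(1)[OF elim(1) i y] using elim(2)
      by (simp only:) (simp add: U_def distrib_left mult_ac)
  qed
qed

private lemma amplitude:
  assumes "i \<in> {1..2 * N - 1}"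
  shows "(\<lambda>\<delta>. e \<delta> * (cf \<delta> * U \<delta> i)) \<in> O[at 0](e)"
proof -
  have "i \<in> {1..2 * N}" using assms by auto
  from landau_o.big_mult[OF landau_o.big_refl[of e] cf_M[OF component_bigo(1)[OF this]]]
  show ?thesis by simp
qed

text \<open>Two signs cancel: \<open>sg i\<close> between the normalized \<open>w\<close> and
  \<open>B i\<close>, and \<open>sg i\<close> between the sine counted from \<open>x i\<close> and
  the one counted from \<open>x a\<close>.\<close>

private lemma gap_asymptotics:
  assumes i: "i \<in> {a..b}" "even i"
  shows "uniform_bigo {x i<..<x (Suc i)}
    (\<lambda>\<delta> y. cf \<delta> * u \<delta> y - B i * complex_of_real (sin (k0 * (y - x a)))) (1 / 2)"
proof -
  have iN: "i \<in> {1..2 * N - 1}" and ib: "a \<le> i" "i \<le> Suc b" using i block_bounds by auto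
  have "(\<lambda>\<delta>. sg i * (cf \<delta> * (sg i * w \<delta> i - f \<delta> * B i))) \<in> O[at 0](e)"
    by (intro cmult_in_bigo cf_G approx ib)
  moreover have "\<forall>\<^sub>F \<delta> in at 0. (if odd i then e \<delta> * e \<delta> else 1) * (cf \<delta> * w \<delta> i) - sg i * B i
      = sg i * (cf \<delta> * (sg i * w \<delta> i - f \<delta> * B i))"
    using cf_lead
  proof eventually_elim
    case (elim \<delta>)
    have "sg i * (cf \<delta> * (sg i * w \<delta> i - f \<delta> * B i)) =
        (sg i * sg i) * (cf \<delta> * w \<delta> i) - (cf \<delta> * f \<delta>) * (sg i * B i)"
      by (simp only: algebra_simps)
    then show ?case using i(2) unfolding elim sg_square[OF ib] by simp
  qed
  ultimately have Q: "(\<lambda>\<delta>. (if odd i then e \<delta> * e \<delta> else 1) * (cf \<delta> * w \<delta> i)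
    - sg i * B i) \<in> O[at 0](e)"
    by (rule bigo_eventually_eq)
  have "B i * complex_of_real (sin (k0 * (y - x a))) =
    sg i * B i * complex_of_real (sin (k0 * (y - x i)))" for y
  proof -
    have "k0 * (y - x a) = k0 * (y - x i) + k0 * (x i - x a)" by (simp add: algebra_simps)
    then have "sin (k0 * (y - x a)) = sin (k0 * (y - x i)) * (\<Prod>j\<in>{a..<i}. cos (k0 * len j))"
      using sin_block_shift[OF block_bounds(1) ib] by (simp add: sin_add)
    then show ?thesis by (simp add: sg_def)
  qed
  then show ?thesis using uniform_trig[OF amplitude[OF iN] Q mode_form[OF iN]] by (simp only:)
qed

text \<open>The cosine coefficient carries the factor \<open>e\<close> from undoing the rescaling of
  \<open>u\<close>. The sine coefficient carries \<delta> in a resonator, and in a gap outside the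
  block it is small by \<open>outside_gap_small\<close>.\<close>

private lemma other_asymptotics:
  assumes i: "i \<in> {1..2 * N - 1}" "odd i \<or> i \<notin> {a..b}"
  shows "uniform_bigo {x i<..<x (Suc i)} (\<lambda>\<delta> y. cf \<delta> * u \<delta> y) (1 / 2)"
proof -
  have "(\<lambda>\<delta>. (if odd i then e \<delta> * e \<delta> else 1) * (cf \<delta> * w \<delta> i) - 0) \<in> O[at 0](e)"
  proof (cases "odd i")
    case True
    have "i \<in> {1..2 * N}" using i by auto
    from landau_o.big_mult[OF landau_o.big_refl[of e]
        landau_o.big_mult[OF e_bigo_1 cf_M[OF component_bigo(2)[OF this]]]]
    show ?thesis using True by (simp add: mult.assoc)
  next
    case False
    then have "(\<lambda>\<delta>. w \<delta> i) \<in> O[at 0](G)"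
      using nc.outside_gap_small[OF unique i(1)] i(2) by blast
    from cf_G[OF this] show ?thesis using False by simp
  qed
  from uniform_trig[OF amplitude[OF i(1)] this mode_form[OF i(1)]] show ?thesis by simp
qed

lemma normalized_mode:
  "\<exists>c. (\<forall>\<delta>. c \<delta> \<noteq> 0) \<and>
    (\<forall>i\<in>{a..b}. even i \<longrightarrow> uniform_bigo {x i<..<x (Suc i)}
      (\<lambda>\<delta> y. c \<delta> * u \<delta> y - B i * complex_of_real (sin (k0 * (y - x a)))) (1 / 2)) \<and>
    (\<forall>i\<in>{1..2 * N - 1}. odd i \<or> i \<notin> {a..b} \<longrightarrow>
      uniform_bigo {x i<..<x (Suc i)} (\<lambda>\<delta> y. c \<delta> * u \<delta> y) (1 / 2))"
  using cf_nonzero gap_asymptotics other_asymptotics by blast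

end

end

section \<open>Asymptotics of the eigenmode\<close>

lemma tlen_unit: "tlen 1 x j = x (Suc j) - x j"
proof (cases "odd j")
  case True
  then obtain m where "j = 2 * m + 1" by (elim oddE)
  then show ?thesis by (simp add: tlen_def ell_def)
next
  case False
  then obtain m where "j = 2 * m" by blast
  then show ?thesis by (simp add: tlen_def gap_def)
qed

lemma index_set_unit: "index_set N 1 x k = {j \<in> {1..2 * N - 1}. sin (k * (x (Suc j) - x j)) = 0}"
  by (auto simp: index_set_def tlen_unit sin_zero_iff_int2 mult.commute)

theorem theorem2p4:
  fixes N :: nat and x :: "nat \<Rightarrow> real" and v vb r k0 :: real
    and lam \<sigma> :: complex and k :: "complex \<Rightarrow> complex"
    and u :: "complex \<Rightarrow> real \<Rightarrow> complex"
  assumes "N \<ge> 1"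
    and "strict_mono_on {1..2 * N} x"
    and "v > 0" and "vb > 0" and "r = v / vb" and "r = 1"
    and "k0 \<in> critical_set N r x" and "k0 \<noteq> 0"
    and "simple_eigenvalue (complex_mat (cap_mat N r x k0)) lam" and "lam \<noteq> 0"
    and "\<sigma> \<in> {1, - 1}"
    and "(\<lambda>\<delta>. k \<delta> - (complex_of_real k0 + \<sigma> * csqrt (lam * \<delta> / complex_of_real r)))
           \<in> O[at 0](\<lambda>\<delta>. \<delta>)"
    and "\<forall>\<^sub>F \<delta> in at 0. resonant_frequency N x v vb \<delta> (k \<delta> * complex_of_real v)"
    and "\<forall>\<^sub>F \<delta> in at 0. eigenmode N x v vb \<delta> (k \<delta> * complex_of_real v) (u \<delta>)"
  shows "(\<exists>!(a, b). maximal_interval (index_set N r x k0) a b \<and>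
            eigenvalue (complex_mat (cap_block N r x k0 a b)) lam) \<and>
    (\<forall>a b. maximal_interval (index_set N r x k0) a b \<and>
           eigenvalue (complex_mat (cap_block N r x k0 a b)) lam \<longrightarrow>
       simple_eigenvalue (complex_mat (cap_block N r x k0 a b)) lam \<and>
       (let s = length (evens a b); j0 = 2 * ((a + 1) div 2) - 2 in
         \<exists>c :: complex \<Rightarrow> complex. \<exists>\<beta> :: complex vec.
           (\<forall>\<delta>. c \<delta> \<noteq> 0) \<and>
           eigenvector (complex_mat (D_mat r x a b)) \<beta> lam \<and>
           (\<forall>j\<in>{1..s}. uniform_bigo {x (j0 + 2 * j)<..<x (j0 + 2 * j + 1)}
              (\<lambda>\<delta> y. c \<delta> * u \<delta> y - \<beta> $ (j - 1) * complex_of_real (sin (k0 * (y - x a)))) (1 / 2)) \<and>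
           (\<forall>i\<in>{1..2 * N - 1} - {j0 + 2 * j |j. j \<in> {1..s}}. \<exists>\<gamma>::nat. \<gamma> > 0 \<and>
              uniform_bigo {x i<..<x (i + 1)} (\<lambda>\<delta> y. c \<delta> * u \<delta> y) (real \<gamma> / 2))))"
proof -
  have r: "r = 1" and vb: "vb = v" using assms(4,5,6) by auto
  have tpos: "tlen r x j > 0" if "j \<in> {1..2 * N - 1}" for j
  proof -
    have "j \<in> {1..2 * N}" "Suc j \<in> {1..2 * N}" using that by auto
    from strict_mono_onD[OF assms(2) this] show ?thesis by (simp add: r tlen_unit)
  qed
  note simple = assms(9)
  define \<mu> where "\<mu> = csqrt lam"
  have mu: "\<mu> \<noteq> 0" "\<mu>\<^sup>2 = lam" using assms(10) by (simp_all add: \<mu>_def)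
  \<comment> \<open>Chosen so that \<open>\<mu> * e\<close> is exactly the signed root in the
    hypothesis on \<open>k\<close>. As \<sigma> squares to 1, \<open>e\<close> squares to \<delta>;
    this absorbs both the sign and the branch of \<open>csqrt\<close>.\<close>
  define e where "e \<delta> = \<sigma> * csqrt (lam * \<delta>) / \<mu>" for \<delta>
  have e_square: "e \<delta> ^ 2 = \<delta>" for \<delta>
    using assms(10,11) mu(2) by (auto simp: e_def power_mult_distrib power_divide)
  define \<kappa> where "\<kappa> \<delta> = k \<delta> - complex_of_real k0" for \<delta>
  have \<kappa>: "(\<lambda>\<delta>. \<kappa> \<delta> - \<mu> * e \<delta>) \<in> O[at 0](\<lambda>\<delta>. e \<delta> ^ 2)"
  proof -
    have "\<kappa> \<delta> - \<mu> * e \<delta> = k \<delta> - (complex_of_real k0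
      + \<sigma> * csqrt (lam * \<delta> / complex_of_real r))" for \<delta>
      using mu(1) by (simp add: \<kappa>_def e_def r)
    then show ?thesis unfolding e_square using assms(12) by (simp only:)
  qed
  have "(\<kappa> \<longlongrightarrow> 0) (at 0)"
    by (rule shift_tendsto[OF sqrt_branch_tendsto sqrt_branch_nonzero \<kappa>]) (rule e_square)+
  then have "((\<lambda>\<delta>. of_real k0 + \<kappa> \<delta>) \<longlongrightarrow> of_real k0 + 0) (at 0)" by (intro tendsto_intros)
  then have k_nonzero: "\<forall>\<^sub>F \<delta> in at 0. k \<delta> \<noteq> 0"
    using tendsto_imp_eventually_ne[of k "of_real k0" "at 0" 0] assms(8) by (simp add: \<kappa>_def)
  \<comment> \<open>Interface data exist only for \<delta> near 0; the choice makes \<open>w\<close>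
    a total function of \<delta>.\<close>
  define w where "w \<delta> = (SOME w. interface_data N x (k \<delta>) \<delta> (u \<delta>) w)" for \<delta>
  have data: "\<forall>\<^sub>F \<delta> in at 0. interface_data N x (of_real k0 + \<kappa> \<delta>) \<delta> (u \<delta>) (w \<delta>)"
    using assms(14) k_nonzero
  proof eventually_elim
    case (elim \<delta>)
    then have "\<exists>w. interface_data N x (k \<delta>) \<delta> (u \<delta>) w"
      using eigenmode_interface_data[OF assms(1-3)] by (simp add: vb)
    then have "interface_data N x (k \<delta>) \<delta> (u \<delta>) (w \<delta>)" unfolding w_def by (rule someI_ex)
    then show ?case by (simp add: \<kappa>_def)
  qed
  interpret res: resonance N x k0 \<mu> \<kappa> e u w
    by unfold_locales (use assms(1) e_square \<kappa> data in auto)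
  have t_eq: "(\<lambda>j. complex_of_real (tlen r x j)) = (\<lambda>j. complex_of_real (res.len j))"
    by (simp add: r tlen_unit res.len_def)
  have I_eq: "index_set N r x k0 = res.critical"
    by (simp add: r index_set_unit res.critical_def res.len_def)
  have block_iff: "eigenvalue (complex_mat (cap_block N r x k0 a b)) lam \<longleftrightarrow> chain_closed b A B"
    if "maximal_interval res.critical a b" "chain (\<lambda>j. complex_of_real (res.len j)) \<mu> a b A B" for a b A B
    using eigenvalue_cap_block_iff[of N r x k0 a b \<mu> A B] tpos that mu by (simp add: t_eq I_eq)
  have unique: "(a, b) = (a', b')"
    if "maximal_interval res.critical a b" "eigenvalue (complex_mat (cap_block N r x k0 a b)) lam"
      "maximal_interval res.critical a' b'" "eigenvalue (complex_mat (cap_block N r x k0 a' b')) lam" for a b a' b'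
    by (rule cap_block_eigenvalue_unique[of N r x, OF tpos simple]) (use that in \<open>simp_all add: I_eq\<close>)
  have "eigenvalue (complex_mat (cap_mat N r x k0)) lam" using simple by
    (simp add: simple_eigenvalue_def)
  then obtain a0 b0 where ab0: "maximal_interval res.critical a0 b0"
      "eigenvalue (complex_mat (cap_block N r x k0 a0 b0)) lam"
    using eigenvalue_some_block[of N r x k0 lam, OF tpos] assms(10) unfolding I_eq by blast
  have ex1: "\<exists>!(a, b). maximal_interval res.critical a b \<and>
    eigenvalue (complex_mat (cap_block N r x k0 a b)) lam"
    by (rule ex1I[of _ "(a0, b0)"]) (use ab0 unique in \<open>auto split: prod.splits\<close>)
  have block: "simple_eigenvalue (complex_mat (cap_block N r x k0 a b)) lam \<and>
       (let s = length (evens a b); j0 = 2 * ((a + 1) div 2) - 2 in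
         \<exists>c :: complex \<Rightarrow> complex. \<exists>\<beta> :: complex vec.
           (\<forall>\<delta>. c \<delta> \<noteq> 0) \<and>
           eigenvector (complex_mat (D_mat r x a b)) \<beta> lam \<and>
           (\<forall>j\<in>{1..s}. uniform_bigo {x (j0 + 2 * j)<..<x (j0 + 2 * j + 1)}
              (\<lambda>\<delta> y. c \<delta> * u \<delta> y - \<beta> $ (j - 1) * complex_of_real (sin (k0 * (y - x a)))) (1 / 2)) \<and>
           (\<forall>i\<in>{1..2 * N - 1} - {j0 + 2 * j |j. j \<in> {1..s}}. \<exists>\<gamma>::nat. \<gamma> > 0 \<and>
              uniform_bigo {x i<..<x (i + 1)} (\<lambda>\<delta> y. c \<delta> * u \<delta> y) (real \<gamma> / 2)))"
    if mi: "maximal_interval res.critical a b"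
      and ev: "eigenvalue (complex_mat (cap_block N r x k0 a b)) lam" for a b
  proof -
    have "0 \<notin> res.critical" by (simp add: res.critical_def)
    note d = maximal_intervalD[OF mi this]
    have tn: "\<forall>i\<in>{a..b}. tlen r x i \<noteq> 0"
      using tpos d(3) by (fastforce simp: res.critical_def)
    obtain A B where ch: "chain (\<lambda>j. complex_of_real (res.len j)) \<mu> a b A B"
      using chain_exists by blast
    have cl: "chain_closed b A B" using block_iff[OF mi ch] ev by simp
    have uniq: "\<forall>a' b' A B. maximal_interval res.critical a' b' \<longrightarrow>
      chain (\<lambda>i. complex_of_real (res.len i)) \<mu> a' b' A B \<longrightarrow> chain_closed b' A B \<longrightarrow> (a', b') = (a, b)"
    proof (intro allI impI)
      fix a' b' A B
      assume mi': "maximal_interval res.critical a' b'"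
        and "chain (\<lambda>i. complex_of_real (res.len i)) \<mu> a' b' A B" "chain_closed b' A B"
      then have "eigenvalue (complex_mat (cap_block N r x k0 a' b')) lam" using block_iff by simp
      then show "(a', b') = (a, b)" by (rule unique[OF mi' _ mi ev])
    qed
    from res.normalized_mode[OF mi ch uniq] obtain c where c: "\<forall>\<delta>. c \<delta> \<noteq> 0"
      and gaps: "\<forall>i\<in>{a..b}. even i \<longrightarrow> uniform_bigo {x i<..<x (Suc i)}
        (\<lambda>\<delta> y. c \<delta> * u \<delta> y - B i * complex_of_real (sin (k0 * (y - x a)))) (1 / 2)"
      and rest: "\<forall>i\<in>{1..2 * N - 1}. odd i \<or> i \<notin> {a..b} \<longrightarrow>
        uniform_bigo {x i<..<x (Suc i)} (\<lambda>\<delta> y. c \<delta> * u \<delta> y) (1 / 2)"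
      by (elim exE conjE) (rule that)
    define s j0 where "s = length (evens a b)" and "j0 = 2 * ((a + 1) div 2) - 2"
    define \<beta> where "\<beta> = vec s (\<lambda>p. B (evens a b ! p))"
    have "eigenvector (complex_mat (D_mat r x a b)) \<beta> (\<mu>\<^sup>2)"
      unfolding \<beta>_def s_def
      by (rule eigenvector_D_mat[OF d(1,2) tn mu(1) _ cl]) (use ch in \<open>simp add: t_eq\<close>)
    then have \<beta>: "eigenvector (complex_mat (D_mat r x a b)) \<beta> lam" by (simp add: mu(2))
    \<comment> \<open>\<open>j0\<close> is two less than the smallest even number not below
      \<open>a\<close>, so \<open>j\<close> counts from 1 where the list counts from 0. The
      subtraction does not truncate, as \<open>a\<close> is at least 1.\<close>
    have index: "j0 + 2 * j = evens a b ! (j - 1)" "j0 + 2 * j \<in> {a..b}" "even (j0 + 2 * j)"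
      if "j \<in> {1..s}" for j
    proof -
      have j: "j - 1 < length (evens a b)" using that by (auto simp: s_def)
      show *: "j0 + 2 * j = evens a b ! (j - 1)"
        using nth_evens[OF j] that d(1) by (auto simp: j0_def)
      have "evens a b ! (j - 1) \<in> set (evens a b)" using j by (rule nth_mem)
      then show "j0 + 2 * j \<in> {a..b}" "even (j0 + 2 * j)" unfolding * by (auto simp: set_evens)
    qed
    have main: "uniform_bigo {x (j0 + 2 * j)<..<x (j0 + 2 * j + 1)}
        (\<lambda>\<delta> y. c \<delta> * u \<delta> y - \<beta> $ (j - 1) * complex_of_real (sin (k0 * (y - x a)))) (1 / 2)"
      if "j \<in> {1..s}" for j
    proof -
      have "\<beta> $ (j - 1) = B (j0 + 2 * j)" using that index(1)[OF that] by (auto simp: \<beta>_def)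
      then show ?thesis using gaps[rule_format, OF index(2,3)[OF that]] by simp
    qed
    \<comment> \<open>The exponent \<gamma> = 1 serves for all these intervals at once.\<close>
    have other: "uniform_bigo {x i<..<x (i + 1)} (\<lambda>\<delta> y. c \<delta> * u \<delta> y) (real 1 / 2)"
      if i: "i \<in> {1..2 * N - 1} - {j0 + 2 * j |j. j \<in> {1..s}}" for i
    proof -
      have "odd i \<or> i \<notin> {a..b}"
      proof (rule ccontr)
        assume "\<not> ?thesis"
        then have "i \<in> set (evens a b)" by (simp add: set_evens)
        then obtain p where p: "p < s" "evens a b ! p = i" by (auto simp: in_set_conv_nth s_def)
        then have "Suc p \<in> {1..s}" "i = j0 + 2 * Suc p" using index(1)[of "Suc p"] by auto
        then show False using i by blast
      qed
      then show ?thesis using rest i by simp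
    qed
    have "\<exists>c :: complex \<Rightarrow> complex. \<exists>\<beta> :: complex vec.
           (\<forall>\<delta>. c \<delta> \<noteq> 0) \<and>
           eigenvector (complex_mat (D_mat r x a b)) \<beta> lam \<and>
           (\<forall>j\<in>{1..s}. uniform_bigo {x (j0 + 2 * j)<..<x (j0 + 2 * j + 1)}
              (\<lambda>\<delta> y. c \<delta> * u \<delta> y - \<beta> $ (j - 1) * complex_of_real (sin (k0 * (y - x a)))) (1 / 2)) \<and>
           (\<forall>i\<in>{1..2 * N - 1} - {j0 + 2 * j |j. j \<in> {1..s}}. \<exists>\<gamma>::nat. \<gamma> > 0 \<and>
              uniform_bigo {x i<..<x (i + 1)} (\<lambda>\<delta> y. c \<delta> * u \<delta> y) (real \<gamma> / 2))"
      by (rule exI[of _ c], rule exI[of _ \<beta>], intro conjI ballI c \<beta> main, assumption)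
        (rule exI[of _ 1], rule conjI, simp, erule other)
    moreover have "simple_eigenvalue (complex_mat (cap_block N r x k0 a b)) lam"
      by (rule simple_eigenvalue_cap_block[of N r x, OF tpos simple]) (use mi ev in \<open>simp_all add: I_eq\<close>)
    ultimately show ?thesis unfolding Let_def s_def[symmetric] j0_def[symmetric] by (intro conjI)
  qed
  show ?thesis unfolding I_eq by (rule conjI[OF ex1], intro allI impI, erule conjE, rule block)
qed

end
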